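(* Let $\Bbbk$ be an infinite field and $(A,\Delta)$ a cocommutative $\Bbbk$-algebra with a nilpotent maximal (two-sided) ideal $\mathfrak{m}\ne0$ such that $A=\mathfrak{m}\oplus\Bbbk\cdot1_A$ and $\Delta(\mathfrak{m})\subset\mathfrak{m}\otimes\mathfrak{m}$. Let $V$ be an $A$-module, and suppose that $\lambda$ and $\kappa_V$ are identically zero, that $\kappa_A:V\wedge V\to\mathfrak{m}$ is $\Bbbk$-linear, and that $\mathscr{H}:=\mathscr{H}_{0,\kappa_A}$ satisfies the PBW property. Then, as abelian $\Bbbk$-algebras, $$HH_0(\mathscr{H},\mathscr{H})=\frac{\mathscr{H}}{[\mathscr{H},\mathscr{H}]}\;\cong\;\Bbbk\cdot1+\Big(\mathrm{Sym}^+(V)\bigoplus\big(\mathfrak{m}/([\mathfrak{m},\mathfrak{m}]+A\cdot(\operatorname{im}\kappa_A)\cdot A)\big)\Big),$$ where the direct sum indicates that the two factors are ideals and hence multiply to zero.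
   Context: A cocommutative $\Bbbk$-algebra $(A,\Delta)$ is a unital associative $\Bbbk$-algebra $A$ with a $\Bbbk$-algebra map $\Delta:A\to A\otimes A$ satisfying $\Delta(1)=1\otimes1$, coassociativity, and $\Delta=\Delta^{op}$ (no counit or antipode is assumed). Sweedler notation: $\Delta(a)=\sum a_{(1)}\otimes a_{(2)}$. The action of $a\in A$ on $v\in V$ is written $a(v)$. $\mathrm{Sym}^+(V)=\bigoplus_{n\ge1}\mathrm{Sym}^n(V)$ is the augmentation ideal of $\mathrm{Sym}(V)$. $[X,X]$ denotes the span of the commutators $xy-yx$ with $x,y\in X$, and $HH_0$ denotes zeroth Hochschild homology. $V\wedge V\subset V\otimes V$ is the span of the $v\wedge v'=v\otimes v'-v'\otimes v$; $\kappa_A(v,v')=\kappa_A(v\wedge v')$. $\mathscr{H}_{0,\kappa_A}$ is the quotient of the tensor algebra $T(V\oplus A)$ by the multiplication in $A$ (with $1_A$ the unit) and by the relations $av=\sum a_{(1)}(v)a_{(2)}$ and $vv'-v'v=\kappa_A(v,v')$ for $a\in A$, $v,v'\in V$. It is filtered by $\deg A=0$, $\deg V=1$, and has the PBW property if the natural surjection from the smash product $\mathscr{H}_{0,0}=\mathrm{Sym}(V)\rtimes A$ (the case $\kappa_A=0$; as a vector space $\mathrm{Sym}(V)\otimes A$) onto its associated graded algebra is an isomorphism.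
   Formalization: [H,H] and [m,m]+A(im κ_A)A need not be ideals, so the isomorphism is proved as vector spaces in general, as abelian algebras whenever [H,H] is an ideal, and as abelian algebras in all cases after replacing both subspaces by the ideals they generate. *)

theory Defs
  imports "HOL-Algebra.QuotRing" "HOL-Algebra.Module" "HOL-Algebra.Algebraic_Closure_Type"
    "HOL-Library.Poly_Mapping" "HOL-Library.Product_Plus"
begin

hide_const (open) Multiset.mult Polynomial.smult

section \<open>Algebras over a field\<close>

text \<open>
  The ground field is a type \<open>'k\<close> of class \<open>field\<close>, seen as the ring record
  \<^const>\<open>ring_of_type_algebra\<close>. An algebra is a record of type \<open>('k, 'b) module\<close>; unlike the
  library locale \<^locale>\<open>algebra\<close> it need not be commutative.
\<close>

abbreviation ground :: "'k::field ring"
  where "ground \<equiv> ring_of_type_algebra"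

definition k_algebra :: "('k::field, 'b) module \<Rightarrow> bool"
  where "k_algebra R \<longleftrightarrow> ring R \<and> module ground R \<and>
    (\<forall>c. \<forall>x\<in>carrier R. \<forall>y\<in>carrier R.
       (c \<odot>\<^bsub>R\<^esub> x) \<otimes>\<^bsub>R\<^esub> y = c \<odot>\<^bsub>R\<^esub> (x \<otimes>\<^bsub>R\<^esub> y) \<and>
       x \<otimes>\<^bsub>R\<^esub> (c \<odot>\<^bsub>R\<^esub> y) = c \<odot>\<^bsub>R\<^esub> (x \<otimes>\<^bsub>R\<^esub> y))"

definition abelian_k_algebra :: "('k::field, 'b) module \<Rightarrow> bool"
  where "abelian_k_algebra R \<longleftrightarrow> k_algebra R \<and> cring R"

definition type_alg :: "('k \<Rightarrow> 'b \<Rightarrow> 'b) \<Rightarrow> ('k::field, 'b::ring_1) module"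
  where "type_alg s = \<lparr>carrier = UNIV, mult = (*), one = 1, zero = 0, add = (+), smult = s\<rparr>"

definition k_span :: "('k::field, 'b) module \<Rightarrow> 'b set \<Rightarrow> 'b set"
  where "k_span R Y = \<Inter>{W. submodule W ground R \<and> Y \<subseteq> W}"

text \<open>\<open>k_lin_on W S f\<close>: \<open>f\<close> restricts to a linear map from the subspace \<open>W\<close> of \<open>R\<close> to \<open>S\<close>.\<close>

definition k_lin_on ::
    "('k::field, 'b) module \<Rightarrow> 'b set \<Rightarrow> ('k, 'c) module \<Rightarrow> ('b \<Rightarrow> 'c) \<Rightarrow> bool"
  where "k_lin_on R W S f \<longleftrightarrow> f \<in> W \<rightarrow> carrier S \<and>
    (\<forall>x\<in>W. \<forall>y\<in>W. f (x \<oplus>\<^bsub>R\<^esub> y) = f x \<oplus>\<^bsub>S\<^esub> f y) \<and>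
    (\<forall>c. \<forall>x\<in>W. f (c \<odot>\<^bsub>R\<^esub> x) = c \<odot>\<^bsub>S\<^esub> f x)"

definition k_lin_iso :: "('k::field, 'b) module \<Rightarrow> ('k, 'c) module \<Rightarrow> ('b \<Rightarrow> 'c) set"
  where "k_lin_iso R S = {f. k_lin_on R (carrier R) S f \<and> bij_betw f (carrier R) (carrier S)}"

definition k_alg_iso :: "('k::field, 'b) module \<Rightarrow> ('k, 'c) module \<Rightarrow> ('b \<Rightarrow> 'c) set"
  where "k_alg_iso R S = {f \<in> ring_iso R S. \<forall>c. \<forall>x\<in>carrier R. f (c \<odot>\<^bsub>R\<^esub> x) = c \<odot>\<^bsub>S\<^esub> f x}"

text \<open>
  The quotient by a subspace \<open>I\<close>: the factor ring of the library together with the scalar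
  multiplication of cosets. If \<open>I\<close> is not a two-sided ideal, only the linear structure
  (\<open>carrier\<close>, \<open>add\<close>, \<open>zero\<close>, \<open>smult\<close>) is meaningful.
\<close>

definition quot_alg :: "('k::field, 'b) module \<Rightarrow> 'b set \<Rightarrow> ('k, 'b set) module"
  where "quot_alg R I =
    \<lparr>carrier = a_rcosets\<^bsub>R\<^esub> I, mult = rcoset_mult R I, one = I +>\<^bsub>R\<^esub> \<one>\<^bsub>R\<^esub>, zero = I,
     add = set_add R, smult = (\<lambda>c Y. \<Union>x\<in>Y. I +>\<^bsub>R\<^esub> (c \<odot>\<^bsub>R\<^esub> x))\<rparr>"

definition comm_span :: "('k::field, 'b) module \<Rightarrow> 'b set \<Rightarrow> 'b set"
  where "comm_span R Y = k_span R {x \<otimes>\<^bsub>R\<^esub> y \<ominus>\<^bsub>R\<^esub> y \<otimes>\<^bsub>R\<^esub> x | x y. x \<in> Y \<and> y \<in> Y}"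

definition HH0 :: "('k::field, 'b) module \<Rightarrow> ('k, 'b set) module"
  where "HH0 R = quot_alg R (comm_span R (carrier R))"

text \<open>
  For possibly non-unital algebras \<open>B\<close>, \<open>C\<close> (their fields \<open>one\<close> play no role): \<open>dsum_alg B C\<close> is
  the direct sum of algebras, in which \<open>B\<close> and \<open>C\<close> are ideals multiplying to zero, and
  \<open>unit_alg B\<close> is \<open>k 1 + B\<close>.
\<close>

definition dsum_alg :: "('k::field, 'b) module \<Rightarrow> ('k, 'c) module \<Rightarrow> ('k, 'b \<times> 'c) module"
  where "dsum_alg B C =
    \<lparr>carrier = carrier B \<times> carrier C,
     mult = (\<lambda>(x, y) (x', y'). (x \<otimes>\<^bsub>B\<^esub> x', y \<otimes>\<^bsub>C\<^esub> y')),
     one = (\<one>\<^bsub>B\<^esub>, \<one>\<^bsub>C\<^esub>), zero = (\<zero>\<^bsub>B\<^esub>, \<zero>\<^bsub>C\<^esub>),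
     add = (\<lambda>(x, y) (x', y'). (x \<oplus>\<^bsub>B\<^esub> x', y \<oplus>\<^bsub>C\<^esub> y')),
     smult = (\<lambda>c (x, y). (c \<odot>\<^bsub>B\<^esub> x, c \<odot>\<^bsub>C\<^esub> y))\<rparr>"

definition unit_alg :: "('k::field, 'b) module \<Rightarrow> ('k, 'k \<times> 'b) module"
  where "unit_alg B =
    \<lparr>carrier = UNIV \<times> carrier B,
     mult = (\<lambda>(c, x) (d, y). (c * d, c \<odot>\<^bsub>B\<^esub> y \<oplus>\<^bsub>B\<^esub> d \<odot>\<^bsub>B\<^esub> x \<oplus>\<^bsub>B\<^esub> x \<otimes>\<^bsub>B\<^esub> y)),
     one = (1, \<zero>\<^bsub>B\<^esub>), zero = (0, \<zero>\<^bsub>B\<^esub>),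
     add = (\<lambda>(c, x) (d, y). (c + d, x \<oplus>\<^bsub>B\<^esub> y)),
     smult = (\<lambda>e (c, x). (e * c, e \<odot>\<^bsub>B\<^esub> x))\<rparr>"

definition list_sum :: "('k::field, 'b) module \<Rightarrow> ('i \<Rightarrow> 'b) \<Rightarrow> 'i list \<Rightarrow> 'b"
  where "list_sum R f xs = foldr (\<lambda>i t. f i \<oplus>\<^bsub>R\<^esub> t) xs \<zero>\<^bsub>R\<^esub>"

definition list_prod :: "('k::field, 'b) module \<Rightarrow> ('i \<Rightarrow> 'b) \<Rightarrow> 'i list \<Rightarrow> 'b"
  where "list_prod R f xs = foldr (\<lambda>i t. f i \<otimes>\<^bsub>R\<^esub> t) xs \<one>\<^bsub>R\<^esub>"


section \<open>Tensor and symmetric algebras\<close>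

text \<open>
  The free monoid on \<open>'w\<close>, written additively so that \<open>'w word \<Rightarrow>\<^sub>0 'k\<close> with the convolution
  product of \<^theory>\<open>HOL-Library.Poly_Mapping\<close> is the free associative algebra on the set \<open>'w\<close>.
\<close>

datatype 'w word = Word (letters: "'w list")

instantiation word :: (type) monoid_add
begin

definition zero_word :: "'w word" where "zero_word = Word []"

definition plus_word :: "'w word \<Rightarrow> 'w word \<Rightarrow> 'w word"
  where "plus_word u w = Word (letters u @ letters w)"

instance
  by standard (auto simp: zero_word_def plus_word_def)

end

definition free_alg :: "('k::field, 'w word \<Rightarrow>\<^sub>0 'k) module"
  where "free_alg = type_alg (\<lambda>c p. Poly_Mapping.single 0 c * p)"

definition letter :: "'w \<Rightarrow> ('w word \<Rightarrow>\<^sub>0 'k::field)"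
  where "letter w = Poly_Mapping.single (Word [w]) 1"

text \<open>
  The tensor algebra \<open>T(W)\<close> of the vector space \<open>W\<close> given by the type \<open>'w\<close> with scalar
  multiplication \<open>s\<close>: the free algebra on the set \<open>W\<close> in which the generators are made to depend
  linearly on \<open>w \<in> W\<close>.
\<close>

definition lin_rels :: "('k \<Rightarrow> 'w \<Rightarrow> 'w) \<Rightarrow> ('w::ab_group_add word \<Rightarrow>\<^sub>0 'k::field) set"
  where "lin_rels s = {letter (w + w') - letter w - letter w' | w w'. True} \<union>
    {letter (s c w) - Poly_Mapping.single 0 c * letter w | c w. True}"

definition tens_ideal :: "('k \<Rightarrow> 'w \<Rightarrow> 'w) \<Rightarrow> ('w::ab_group_add word \<Rightarrow>\<^sub>0 'k::field) set"
  where "tens_ideal s = Idl\<^bsub>free_alg\<^esub> (lin_rels s)"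

definition tens_alg ::
    "('k \<Rightarrow> 'w \<Rightarrow> 'w) \<Rightarrow> ('k::field, ('w::ab_group_add word \<Rightarrow>\<^sub>0 'k) set) module"
  where "tens_alg s = quot_alg free_alg (tens_ideal s)"

definition tens_gen :: "('k \<Rightarrow> 'w \<Rightarrow> 'w) \<Rightarrow> 'w \<Rightarrow> ('w::ab_group_add word \<Rightarrow>\<^sub>0 'k::field) set"
  where "tens_gen s w = tens_ideal s +>\<^bsub>free_alg\<^esub> letter w"

text \<open>
  \<open>W \<otimes> W\<close> is the degree two component of \<open>T(W)\<close>; the pure tensor \<open>w \<otimes> w'\<close> is the product of the
  generators \<open>w\<close> and \<open>w'\<close> in \<open>T(W)\<close>. Likewise \<open>W \<otimes> W \<otimes> W\<close> lies in \<open>T(W)\<close>, as degree three part.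
\<close>

definition pure_tensor ::
    "('k \<Rightarrow> 'w \<Rightarrow> 'w) \<Rightarrow> 'w \<times> 'w \<Rightarrow> ('w::ab_group_add word \<Rightarrow>\<^sub>0 'k::field) set"
  where "pure_tensor s = (\<lambda>(w, w'). tens_gen s w \<otimes>\<^bsub>tens_alg s\<^esub> tens_gen s w')"

definition tensor_square ::
    "('k \<Rightarrow> 'w \<Rightarrow> 'w) \<Rightarrow> 'w set \<Rightarrow> ('w::ab_group_add word \<Rightarrow>\<^sub>0 'k::field) set set"
  where "tensor_square s M = k_span (tens_alg s) (pure_tensor s ` (M \<times> M))"

definition wedge ::
    "('k \<Rightarrow> 'w \<Rightarrow> 'w) \<Rightarrow> 'w \<Rightarrow> 'w \<Rightarrow> ('w::ab_group_add word \<Rightarrow>\<^sub>0 'k::field) set"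
  where "wedge s v v' = pure_tensor s (v, v') \<ominus>\<^bsub>tens_alg s\<^esub> pure_tensor s (v', v)"

definition wedge_square ::
    "('k \<Rightarrow> 'w \<Rightarrow> 'w) \<Rightarrow> ('w::ab_group_add word \<Rightarrow>\<^sub>0 'k::field) set set"
  where "wedge_square s = k_span (tens_alg s) {wedge s v v' | v v'. True}"

definition sym_ideal ::
    "('k \<Rightarrow> 'w \<Rightarrow> 'w) \<Rightarrow> ('w::ab_group_add word \<Rightarrow>\<^sub>0 'k::field) set set"
  where "sym_ideal s = Idl\<^bsub>tens_alg s\<^esub> {wedge s v v' | v v'. True}"

definition sym_alg ::
    "('k \<Rightarrow> 'w \<Rightarrow> 'w) \<Rightarrow> ('k::field, ('w::ab_group_add word \<Rightarrow>\<^sub>0 'k) set set) module"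
  where "sym_alg s = quot_alg (tens_alg s) (sym_ideal s)"

definition sym_gen ::
    "('k \<Rightarrow> 'w \<Rightarrow> 'w) \<Rightarrow> 'w \<Rightarrow> ('w::ab_group_add word \<Rightarrow>\<^sub>0 'k::field) set set"
  where "sym_gen s w = sym_ideal s +>\<^bsub>tens_alg s\<^esub> tens_gen s w"

definition sym_plus ::
    "('k \<Rightarrow> 'w \<Rightarrow> 'w) \<Rightarrow> ('w::ab_group_add word \<Rightarrow>\<^sub>0 'k::field) set set set"
  where "sym_plus s = k_span (sym_alg s) {list_prod (sym_alg s) (sym_gen s) ws | ws. ws \<noteq> []}"


section \<open>Cocommutative algebras and their modules\<close>

text \<open>
  Sweedler notation: \<open>sweedler s D a xs\<close> says that \<open>D a\<close> is the sum of \<open>x \<otimes> y\<close> over the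
  pairs \<open>(x, y)\<close> in the list \<open>xs\<close>. Formulas in Sweedler notation are required for all such
  representations; by multilinearity they do not depend on the choice.
\<close>

definition sweedler ::
    "('k \<Rightarrow> 'a \<Rightarrow> 'a) \<Rightarrow> ('a \<Rightarrow> ('a::ab_group_add word \<Rightarrow>\<^sub>0 'k::field) set) \<Rightarrow> 'a \<Rightarrow> ('a \<times> 'a) list \<Rightarrow> bool"
  where "sweedler s D a xs \<longleftrightarrow> D a = list_sum (tens_alg s) (pure_tensor s) xs"

definition cocomm_algebra ::
    "('k \<Rightarrow> 'a \<Rightarrow> 'a) \<Rightarrow> ('a \<Rightarrow> ('a::ring_1 word \<Rightarrow>\<^sub>0 'k::field) set) \<Rightarrow> bool"
  where "cocomm_algebra s D \<longleftrightarrow>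
    k_algebra (type_alg s) \<and>
    k_lin_on (type_alg s) UNIV (tens_alg s) D \<and> range D \<subseteq> tensor_square s UNIV \<and>
    D 1 = pure_tensor s (1, 1) \<and>
    (\<forall>a b xs ys. sweedler s D a xs \<and> sweedler s D b ys \<longrightarrow>
       sweedler s D (a * b)
         (map (\<lambda>((x, x'), (y, y')). (x * y, x' * y')) (List.product xs ys))) \<and>
    (\<forall>a xs. sweedler s D a xs \<longrightarrow>
       list_sum (tens_alg s) (\<lambda>(x, y). D x \<otimes>\<^bsub>tens_alg s\<^esub> tens_gen s y) xs =
       list_sum (tens_alg s) (\<lambda>(x, y). tens_gen s x \<otimes>\<^bsub>tens_alg s\<^esub> D y) xs) \<and>
    (\<forall>a xs. sweedler s D a xs \<longrightarrow> sweedler s D a (map prod.swap xs))"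

definition alg_module ::
    "('k::field \<Rightarrow> 'a::ring_1 \<Rightarrow> 'a) \<Rightarrow> ('k \<Rightarrow> 'v::ab_group_add \<Rightarrow> 'v) \<Rightarrow> ('a \<Rightarrow> 'v \<Rightarrow> 'v) \<Rightarrow> bool"
  where "alg_module sA sV act \<longleftrightarrow> vector_space sV \<and>
    (\<forall>a v v'. act a (v + v') = act a v + act a v') \<and>
    (\<forall>a b v. act (a + b) v = act a v + act b v) \<and>
    (\<forall>a b v. act (a * b) v = act a (act b v)) \<and>
    (\<forall>v. act 1 v = v) \<and>
    (\<forall>c a v. act (sA c a) v = sV c (act a v) \<and> act a (sV c v) = sV c (act a v))"


section \<open>The algebra \<open>H\<^sub>0\<^sub>,\<^sub>\<kappa>\<close> and the PBW property\<close>

definition sVA ::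
    "('k::field \<Rightarrow> 'a \<Rightarrow> 'a) \<Rightarrow> ('k \<Rightarrow> 'v \<Rightarrow> 'v) \<Rightarrow> 'k \<Rightarrow> 'v \<times> 'a \<Rightarrow> 'v \<times> 'a"
  where "sVA sA sV c = map_prod (sV c) (sA c)"

definition T_VA :: "('k \<Rightarrow> 'a \<Rightarrow> 'a) \<Rightarrow> ('k \<Rightarrow> 'v \<Rightarrow> 'v) \<Rightarrow>
    ('k::field, (('v::ab_group_add \<times> 'a::ring_1) word \<Rightarrow>\<^sub>0 'k) set) module"
  where "T_VA sA sV = tens_alg (sVA sA sV)"

definition T_V :: "('k \<Rightarrow> 'a \<Rightarrow> 'a) \<Rightarrow> ('k \<Rightarrow> 'v \<Rightarrow> 'v) \<Rightarrow> 'v \<Rightarrow>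
    (('v::ab_group_add \<times> 'a::ring_1) word \<Rightarrow>\<^sub>0 'k::field) set"
  where "T_V sA sV v = tens_gen (sVA sA sV) (v, 0)"

definition T_A :: "('k \<Rightarrow> 'a \<Rightarrow> 'a) \<Rightarrow> ('k \<Rightarrow> 'v \<Rightarrow> 'v) \<Rightarrow> 'a \<Rightarrow>
    (('v::ab_group_add \<times> 'a::ring_1) word \<Rightarrow>\<^sub>0 'k::field) set"
  where "T_A sA sV a = tens_gen (sVA sA sV) (0, a)"

definition H_rels :: "('k \<Rightarrow> 'a \<Rightarrow> 'a) \<Rightarrow> ('k \<Rightarrow> 'v \<Rightarrow> 'v) \<Rightarrow>
    ('a \<Rightarrow> ('a word \<Rightarrow>\<^sub>0 'k) set) \<Rightarrow> ('a \<Rightarrow> 'v \<Rightarrow> 'v) \<Rightarrow> (('v word \<Rightarrow>\<^sub>0 'k) set \<Rightarrow> 'a) \<Rightarrow>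
    (('v::ab_group_add \<times> 'a::ring_1) word \<Rightarrow>\<^sub>0 'k::field) set set"
  where "H_rels sA sV D act \<kappa> = (let T = T_VA sA sV; \<iota>V = T_V sA sV; \<iota>A = T_A sA sV in
    {\<iota>A a \<otimes>\<^bsub>T\<^esub> \<iota>A b \<ominus>\<^bsub>T\<^esub> \<iota>A (a * b) | a b. True} \<union>
    {\<iota>A 1 \<ominus>\<^bsub>T\<^esub> \<one>\<^bsub>T\<^esub>} \<union>
    {\<iota>A a \<otimes>\<^bsub>T\<^esub> \<iota>V v \<ominus>\<^bsub>T\<^esub> list_sum T (\<lambda>(x, y). \<iota>V (act x v) \<otimes>\<^bsub>T\<^esub> \<iota>A y) xs
       | a v xs. sweedler sA D a xs} \<union>
    {\<iota>V v \<otimes>\<^bsub>T\<^esub> \<iota>V v' \<ominus>\<^bsub>T\<^esub> \<iota>V v' \<otimes>\<^bsub>T\<^esub> \<iota>V v \<ominus>\<^bsub>T\<^esub> \<iota>A (\<kappa> (wedge sV v v')) | v v'. True})"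

definition H_ideal :: "('k \<Rightarrow> 'a \<Rightarrow> 'a) \<Rightarrow> ('k \<Rightarrow> 'v \<Rightarrow> 'v) \<Rightarrow>
    ('a \<Rightarrow> ('a word \<Rightarrow>\<^sub>0 'k) set) \<Rightarrow> ('a \<Rightarrow> 'v \<Rightarrow> 'v) \<Rightarrow> (('v word \<Rightarrow>\<^sub>0 'k) set \<Rightarrow> 'a) \<Rightarrow>
    (('v::ab_group_add \<times> 'a::ring_1) word \<Rightarrow>\<^sub>0 'k::field) set set"
  where "H_ideal sA sV D act \<kappa> = Idl\<^bsub>T_VA sA sV\<^esub> (H_rels sA sV D act \<kappa>)"

definition H_alg :: "('k \<Rightarrow> 'a \<Rightarrow> 'a) \<Rightarrow> ('k \<Rightarrow> 'v \<Rightarrow> 'v) \<Rightarrow>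
    ('a \<Rightarrow> ('a word \<Rightarrow>\<^sub>0 'k) set) \<Rightarrow> ('a \<Rightarrow> 'v \<Rightarrow> 'v) \<Rightarrow> (('v word \<Rightarrow>\<^sub>0 'k) set \<Rightarrow> 'a) \<Rightarrow>
    ('k::field, (('v::ab_group_add \<times> 'a::ring_1) word \<Rightarrow>\<^sub>0 'k) set set) module"
  where "H_alg sA sV D act \<kappa> = quot_alg (T_VA sA sV) (H_ideal sA sV D act \<kappa>)"

definition H_V :: "('k \<Rightarrow> 'a \<Rightarrow> 'a) \<Rightarrow> ('k \<Rightarrow> 'v \<Rightarrow> 'v) \<Rightarrow>
    ('a \<Rightarrow> ('a word \<Rightarrow>\<^sub>0 'k) set) \<Rightarrow> ('a \<Rightarrow> 'v \<Rightarrow> 'v) \<Rightarrow> (('v word \<Rightarrow>\<^sub>0 'k) set \<Rightarrow> 'a) \<Rightarrow>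
    'v \<Rightarrow> (('v::ab_group_add \<times> 'a::ring_1) word \<Rightarrow>\<^sub>0 'k::field) set set"
  where "H_V sA sV D act \<kappa> v = H_ideal sA sV D act \<kappa> +>\<^bsub>T_VA sA sV\<^esub> T_V sA sV v"

definition H_A :: "('k \<Rightarrow> 'a \<Rightarrow> 'a) \<Rightarrow> ('k \<Rightarrow> 'v \<Rightarrow> 'v) \<Rightarrow>
    ('a \<Rightarrow> ('a word \<Rightarrow>\<^sub>0 'k) set) \<Rightarrow> ('a \<Rightarrow> 'v \<Rightarrow> 'v) \<Rightarrow> (('v word \<Rightarrow>\<^sub>0 'k) set \<Rightarrow> 'a) \<Rightarrow>
    'a \<Rightarrow> (('v::ab_group_add \<times> 'a::ring_1) word \<Rightarrow>\<^sub>0 'k::field) set set"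
  where "H_A sA sV D act \<kappa> a = H_ideal sA sV D act \<kappa> +>\<^bsub>T_VA sA sV\<^esub> T_A sA sV a"

text \<open>
  The filtration of an algebra \<open>R\<close> generated by the images of \<open>gV\<close> (degree one) and \<open>gA\<close>
  (degree zero), and the associated graded algebra. \<open>filt_pre n\<close> is the filtered piece of index
  \<open>n - 1\<close>, the piece of index \<open>-1\<close> being zero.
\<close>

definition filt ::
    "('k::field, 'h) module \<Rightarrow> ('v \<Rightarrow> 'h) \<Rightarrow> ('a \<Rightarrow> 'h) \<Rightarrow> nat \<Rightarrow> 'h set"
  where "filt R gV gA n =
    k_span R {list_prod R (case_sum gV gA) xs | xs. length (filter isl xs) \<le> n}"

definition filt_pre ::
    "('k::field, 'h) module \<Rightarrow> ('v \<Rightarrow> 'h) \<Rightarrow> ('a \<Rightarrow> 'h) \<Rightarrow> nat \<Rightarrow> 'h set"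
  where "filt_pre R gV gA n = (case n of 0 \<Rightarrow> {\<zero>\<^bsub>R\<^esub>} | Suc m \<Rightarrow> filt R gV gA m)"

definition gr_piece ::
    "('k::field, 'h) module \<Rightarrow> ('v \<Rightarrow> 'h) \<Rightarrow> ('a \<Rightarrow> 'h) \<Rightarrow> nat \<Rightarrow> ('k, 'h set) module"
  where "gr_piece R gV gA n =
    quot_alg (R\<lparr>carrier := filt R gV gA n\<rparr>) (filt_pre R gV gA n)"

text \<open>
  Elements of the associated graded algebra are the finitely supported families
  \<open>(f n)\<close> with \<open>f n\<close> in the \<open>n\<close>-th graded piece.
\<close>

definition gr_symbol ::
    "('k::field, 'h) module \<Rightarrow> ('v \<Rightarrow> 'h) \<Rightarrow> ('a \<Rightarrow> 'h) \<Rightarrow> nat \<Rightarrow> 'h \<Rightarrow> nat \<Rightarrow> 'h set"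
  where "gr_symbol R gV gA n x =
    (\<lambda>k. if k = n then filt_pre R gV gA n +>\<^bsub>R\<^esub> x else filt_pre R gV gA k)"

definition gr_alg ::
    "('k::field, 'h) module \<Rightarrow> ('v \<Rightarrow> 'h) \<Rightarrow> ('a \<Rightarrow> 'h) \<Rightarrow> ('k, nat \<Rightarrow> 'h set) module"
  where "gr_alg R gV gA = (let G = gr_piece R gV gA in
    \<lparr>carrier = {f. (\<forall>n. f n \<in> carrier (G n)) \<and> finite {n. f n \<noteq> \<zero>\<^bsub>G n\<^esub>}},
     mult = (\<lambda>f g n. finsum (G n)
       (\<lambda>i. rcoset_mult R (filt_pre R gV gA n) (f i) (g (n - i))) {..n}),
     one = gr_symbol R gV gA 0 \<one>\<^bsub>R\<^esub>,
     zero = (\<lambda>n. \<zero>\<^bsub>G n\<^esub>),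
     add = (\<lambda>f g n. f n \<oplus>\<^bsub>G n\<^esub> g n),
     smult = (\<lambda>c f n. c \<odot>\<^bsub>G n\<^esub> f n)\<rparr>)"

text \<open>
  The natural surjection from the smash product (the case \<open>\<kappa> = 0\<close>) onto the associated graded
  algebra is the algebra map sending the generators \<open>v\<close>, \<open>a\<close> to their symbols in degree
  one and zero; as \<open>V\<close> and \<open>A\<close> generate the smash product, it is the only such map.
\<close>

definition PBW :: "('k::field \<Rightarrow> 'a::ring_1 \<Rightarrow> 'a) \<Rightarrow> ('k \<Rightarrow> 'v::ab_group_add \<Rightarrow> 'v) \<Rightarrow>
    ('a \<Rightarrow> ('a word \<Rightarrow>\<^sub>0 'k) set) \<Rightarrow> ('a \<Rightarrow> 'v \<Rightarrow> 'v) \<Rightarrow> (('v word \<Rightarrow>\<^sub>0 'k) set \<Rightarrow> 'a) \<Rightarrow> bool"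
  where "PBW sA sV D act \<kappa> \<longleftrightarrow>
    (let H = H_alg sA sV D act \<kappa>; gV = H_V sA sV D act \<kappa>; gA = H_A sA sV D act \<kappa>;
         z = (\<lambda>_. 0)
     in \<exists>\<phi> \<in> k_alg_iso (H_alg sA sV D act z) (gr_alg H gV gA).
          (\<forall>v. \<phi> (H_V sA sV D act z v) = gr_symbol H gV gA 1 (gV v)) \<and>
          (\<forall>a. \<phi> (H_A sA sV D act z a) = gr_symbol H gV gA 0 (gA a)))"

end

theory Submission
  imports Defs
begin

text \<open>
  Write \<open>N = [\<mm>, \<mm>] + A (im \<kappa>) A\<close>. The maps out of \<open>H\<close> are the easy half. Sending \<open>\<mm>\<close> to zero is
  compatible with the relations, because \<open>\<Delta> \<mm> \<subseteq> \<mm> \<otimes> \<mm>\<close> and \<open>im \<kappa> \<subseteq> \<mm>\<close>, and gives an algebra map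
  \<open>p\<close> from \<open>H\<close> onto the commutative algebra \<open>Sym V\<close>. Sending \<open>V\<close> to zero gives an algebra map \<open>q\<close>
  from \<open>H\<close> onto \<open>A / A (im \<kappa>) A\<close>. The map \<open>p\<close> kills \<open>[H, H]\<close>, the map \<open>q\<close> carries it into
  the image of \<open>N\<close>, and the two targets share the constants \<open>k 1\<close>; this yields a linear map from \<open>H / [H, H]\<close> to
  \<open>k 1 + (Sym\<^sup>+ V \<oplus> \<mm> / N)\<close>. It is multiplicative whenever \<open>N\<close> is an ideal of \<open>A\<close>, and the
  same holds with \<open>N\<close> replaced by a larger subspace of \<open>\<mm>\<close>.

  Injectivity is where nilpotency enters. For \<open>a \<in> \<mm>\<close> and a word \<open>v w\<close> in \<open>V\<close> with first letter
  \<open>v\<close>, modulo commutators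
  \<open>v w a \<equiv> a v w = \<Sum> a\<^sub>1(v) a\<^sub>2 w\<close>
  and moving \<open>a\<^sub>2\<close> to the right past \<open>w\<close> produces words of the same kind whose first letter lies in
  \<open>\<mm> V\<close>. Iterating pushes the first letter into \<open>\<mm>\<^sup>n V\<close>, which is zero for large \<open>n\<close>. So words
  of positive length followed by an element of \<open>\<mm>\<close> are sums of commutators
  (lemma \<open>hV_tensor_hA_HH\<close>). Hence \<open>H\<close> is spanned by the words in \<open>V\<close>, by \<open>\<mm>\<close> and by commutators
  (lemma \<open>H_decompose\<close>). Exchanging two neighbouring letters of a word changes it by a word
  containing some \<open>\<kappa>(v, v')\<close>, which is a sum of commutators by the same argument, or is itself the
  commutator of \<open>v\<close> and \<open>v'\<close> if no other letters are present; so words only matter through their class in \<open>Sym V\<close> (lemma \<open>sym_ideal_HH\<close>); likewise \<open>N\<close> itself consists of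
  commutators (lemma \<open>hA_N_HH\<close>). So nothing outside \<open>[H, H]\<close> is killed (lemma \<open>ker_N\<close>).

  If \<open>[H, H]\<close> is an ideal, then so is \<open>N\<close>, being the part of \<open>\<mm>\<close> that \<open>H\<close> sends into \<open>[H, H]\<close>, and the
  linear isomorphism is one of algebras. Running the argument with the ideals generated by \<open>N\<close> and by
  \<open>[H, H]\<close> gives an isomorphism of algebras in all cases.
\<close>


section \<open>Linear algebra in algebras over a field\<close>

locale kalg =
  fixes R :: "('k::field, 'b) module" (structure)
  assumes k_algebra: "k_algebra R"

sublocale kalg \<subseteq> ring R
  using k_algebra by (simp add: k_algebra_def)

sublocale kalg \<subseteq> vs: module ground R
  using k_algebra by (simp add: k_algebra_def)

lemma ground_simps [simp]:
  "carrier ground = UNIV" "\<one>\<^bsub>ground\<^esub> = 1" "\<zero>\<^bsub>ground\<^esub> = 0"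
  "x \<oplus>\<^bsub>ground\<^esub> y = x + y" "x \<otimes>\<^bsub>ground\<^esub> y = x * y"
  by (simp_all add: ring_of_type_algebra_def)

lemma ground_minus [simp]: "\<ominus>\<^bsub>ground\<^esub> x = - x"
proof -
  interpret cring "ground :: 'a ring" by (rule cring_from_type_algebra)
  show ?thesis by (rule minus_equality) simp_all
qed

lemma k_algebraI:
  fixes R :: "('k::field, 'b) module" (structure)
  assumes "ring R"
    and "\<And>c x. x \<in> carrier R \<Longrightarrow> c \<odot> x \<in> carrier R"
    and "\<And>c d x. x \<in> carrier R \<Longrightarrow> (c + d) \<odot> x = c \<odot> x \<oplus> d \<odot> x"
    and "\<And>c x y. x \<in> carrier R \<Longrightarrow> y \<in> carrier R \<Longrightarrow> c \<odot> (x \<oplus> y) = c \<odot> x \<oplus> c \<odot> y"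
    and "\<And>c d x. x \<in> carrier R \<Longrightarrow> (c * d) \<odot> x = c \<odot> (d \<odot> x)"
    and "\<And>x. x \<in> carrier R \<Longrightarrow> 1 \<odot> x = x"
    and "\<And>c x y. x \<in> carrier R \<Longrightarrow> y \<in> carrier R \<Longrightarrow> (c \<odot> x) \<otimes> y = c \<odot> (x \<otimes> y)"
    and "\<And>c x y. x \<in> carrier R \<Longrightarrow> y \<in> carrier R \<Longrightarrow> x \<otimes> (c \<odot> y) = c \<odot> (x \<otimes> y)"
  shows "k_algebra R"
proof -
  interpret ring R by fact
  have "module ground R"
    by (rule moduleI) (use assms cring_from_type_algebra in \<open>auto intro: abelian_group_axioms\<close>)
  then show ?thesis
    using assms by (auto simp: k_algebra_def)
qed

context kalg
begin

lemma smult_carrier [simp, intro]: "x \<in> carrier R \<Longrightarrow> c \<odot> x \<in> carrier R"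
  using vs.smult_closed[of c x] by simp

lemma smult_left: "x \<in> carrier R \<Longrightarrow> y \<in> carrier R \<Longrightarrow> (c \<odot> x) \<otimes> y = c \<odot> (x \<otimes> y)"
  and smult_right: "x \<in> carrier R \<Longrightarrow> y \<in> carrier R \<Longrightarrow> x \<otimes> (c \<odot> y) = c \<odot> (x \<otimes> y)"
  using k_algebra by (auto simp: k_algebra_def)

lemma smult_add: "x \<in> carrier R \<Longrightarrow> y \<in> carrier R \<Longrightarrow> c \<odot> (x \<oplus> y) = c \<odot> x \<oplus> c \<odot> y"
  using vs.smult_r_distr[of c x y] by simp

lemma add_smult: "x \<in> carrier R \<Longrightarrow> (c + d) \<odot> x = c \<odot> x \<oplus> d \<odot> x"
  using vs.smult_l_distr[of c d x] by simp

lemma mult_smult: "x \<in> carrier R \<Longrightarrow> (c * d) \<odot> x = c \<odot> (d \<odot> x)"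
  using vs.smult_assoc1[of c d x] by simp

lemma one_smult [simp]: "x \<in> carrier R \<Longrightarrow> 1 \<odot> x = x"
  using vs.smult_one[of x] by simp

lemma zero_smult [simp]: "x \<in> carrier R \<Longrightarrow> 0 \<odot> x = \<zero>"
  using vs.smult_l_null[of x] by simp

lemma smult_zero [simp]: "c \<odot> \<zero> = \<zero>"
  using vs.smult_r_null[of c] by simp

lemma smult_uminus: "x \<in> carrier R \<Longrightarrow> c \<odot> (\<ominus> x) = \<ominus> (c \<odot> x)"
  using vs.smult_r_minus[of c x] by simp

lemma neg_one_smult: "x \<in> carrier R \<Longrightarrow> (- 1) \<odot> x = \<ominus> x"
  using vs.smult_l_minus[of 1 x] by simp

lemma smult_minus: "x \<in> carrier R \<Longrightarrow> y \<in> carrier R \<Longrightarrow> c \<odot> (x \<ominus> y) = c \<odot> x \<ominus> c \<odot> y"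
  by (simp add: a_minus_def smult_add smult_uminus)

lemma subspaceI:
  assumes "W \<subseteq> carrier R" "\<zero> \<in> W" "\<And>x y. x \<in> W \<Longrightarrow> y \<in> W \<Longrightarrow> x \<oplus> y \<in> W"
    "\<And>c x. x \<in> W \<Longrightarrow> c \<odot> x \<in> W"
  shows "submodule W ground R"
proof (rule vs.submoduleI)
  show "\<ominus> x \<in> W" if "x \<in> W" for x
    using assms(1) assms(4)[OF that, of "- 1"] that by (simp add: neg_one_smult subset_iff)
qed (use assms in auto)

lemma subspaceD:
  assumes "submodule W ground R"
  shows "W \<subseteq> carrier R" "\<zero> \<in> W" "\<And>x y. x \<in> W \<Longrightarrow> y \<in> W \<Longrightarrow> x \<oplus> y \<in> W"
    "\<And>c x. x \<in> W \<Longrightarrow> c \<odot> x \<in> W" "\<And>x. x \<in> W \<Longrightarrow> \<ominus> x \<in> W"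
    "\<And>x y. x \<in> W \<Longrightarrow> y \<in> W \<Longrightarrow> x \<ominus> y \<in> W"
proof -
  interpret W: submodule W ground R by fact
  show "W \<subseteq> carrier R" "\<And>x y. x \<in> W \<Longrightarrow> y \<in> W \<Longrightarrow> x \<oplus> y \<in> W"
    using W.subset W.m_closed by auto
  show zero: "\<zero> \<in> W" using W.one_closed by simp
  show "\<And>c x. x \<in> W \<Longrightarrow> c \<odot> x \<in> W" by simp
  show inv: "\<And>x. x \<in> W \<Longrightarrow> \<ominus> x \<in> W" using vs.submoduleE(3)[OF assms] by blast
  show "\<And>x y. x \<in> W \<Longrightarrow> y \<in> W \<Longrightarrow> x \<ominus> y \<in> W"
    using W.m_closed inv by (simp add: a_minus_def)
qed

lemma subspace_abelian_subgroup:
  assumes "submodule W ground R"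
  shows "abelian_subgroup W R"
  using assms by (intro abelian_subgroupI3 additive_subgroupI abelian_group_axioms)
    (simp add: submodule_def)

lemma ideal_subspace:
  assumes "ideal W R"
  shows "submodule W ground R"
proof -
  interpret I: ideal W R by fact
  have "c \<odot> x \<in> W" if "x \<in> W" for c x
  proof -
    have "c \<odot> x = (c \<odot> \<one>) \<otimes> x" using that I.Icarr by (simp add: smult_left)
    then show ?thesis using that I.I_l_closed by simp
  qed
  then show ?thesis by (intro subspaceI) (auto intro: I.Icarr)
qed

lemma ideal_of_subspace:
  assumes "submodule W ground R"
    and "\<And>x y. x \<in> carrier R \<Longrightarrow> y \<in> W \<Longrightarrow> x \<otimes> y \<in> W"
    and "\<And>x y. x \<in> carrier R \<Longrightarrow> y \<in> W \<Longrightarrow> y \<otimes> x \<in> W"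
  shows "ideal W R"
  using assms by (intro idealI ring_axioms) (auto simp: submodule_def)

lemma subspace_k_span: "Y \<subseteq> carrier R \<Longrightarrow> submodule (k_span R Y) ground R"
proof (rule subspaceI)
  assume Y: "Y \<subseteq> carrier R"
  have "submodule (carrier R) ground R" by (rule vs.carrier_is_submodule)
  then show "k_span R Y \<subseteq> carrier R" using Y by (auto simp: k_span_def)
qed (auto simp: k_span_def intro: subspaceD(2-4))

lemma k_span_superset: "Y \<subseteq> k_span R Y"
  by (auto simp: k_span_def)

lemma k_span_least: "submodule W ground R \<Longrightarrow> Y \<subseteq> W \<Longrightarrow> k_span R Y \<subseteq> W"
  by (auto simp: k_span_def)

lemma set_add_memI: "u \<in> U \<Longrightarrow> w \<in> W \<Longrightarrow> u \<oplus> w \<in> U <+>\<^bsub>R\<^esub> W"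
  unfolding set_add_def' by blast

lemma subspace_sum:
  assumes "submodule U ground R" "submodule W ground R"
  shows "submodule (U <+>\<^bsub>R\<^esub> W) ground R"
proof (rule subspaceI)
  note U = subspaceD[OF assms(1)] and W = subspaceD[OF assms(2)]
  show "U <+>\<^bsub>R\<^esub> W \<subseteq> carrier R" using U(1) W(1) by (auto simp: set_add_def')
  show "\<zero> \<in> U <+>\<^bsub>R\<^esub> W" using U(2) W(2) by (force simp: set_add_def')
  fix x y assume "x \<in> U <+>\<^bsub>R\<^esub> W" "y \<in> U <+>\<^bsub>R\<^esub> W"
  then obtain u w u' w' where *: "x = u \<oplus> w" "y = u' \<oplus> w'" "u \<in> U" "u' \<in> U" "w \<in> W" "w' \<in> W"
    by (auto simp: set_add_def')
  moreover have "u \<oplus> w \<oplus> (u' \<oplus> w') = (u \<oplus> u') \<oplus> (w \<oplus> w')"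
    using * U(1) W(1) by (simp add: a_ac subset_iff)
  ultimately show "x \<oplus> y \<in> U <+>\<^bsub>R\<^esub> W" using U(3) W(3) set_add_memI by metis
next
  note U = subspaceD[OF assms(1)] and W = subspaceD[OF assms(2)]
  fix c x assume "x \<in> U <+>\<^bsub>R\<^esub> W"
  then obtain u w where *: "x = u \<oplus> w" "u \<in> U" "w \<in> W" by (auto simp: set_add_def')
  moreover have "c \<odot> (u \<oplus> w) = c \<odot> u \<oplus> c \<odot> w"
    using * U(1) W(1) by (intro smult_add) auto
  ultimately show "c \<odot> x \<in> U <+>\<^bsub>R\<^esub> W" using U(4) W(4) set_add_memI by metis
qed

lemma subspace_sum_superset:
  assumes "submodule U ground R" "submodule W ground R"
  shows "U \<subseteq> U <+>\<^bsub>R\<^esub> W" "W \<subseteq> U <+>\<^bsub>R\<^esub> W"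
proof -
  note U = subspaceD[OF assms(1)] and W = subspaceD[OF assms(2)]
  show "U \<subseteq> U <+>\<^bsub>R\<^esub> W"
  proof
    fix u assume u: "u \<in> U"
    then have "u \<oplus> \<zero> \<in> U <+>\<^bsub>R\<^esub> W" using W(2) by (rule set_add_memI)
    then show "u \<in> U <+>\<^bsub>R\<^esub> W" using u U(1) by auto
  qed
  show "W \<subseteq> U <+>\<^bsub>R\<^esub> W"
  proof
    fix u assume u: "u \<in> W"
    then have "\<zero> \<oplus> u \<in> U <+>\<^bsub>R\<^esub> W" using set_add_memI[OF U(2)] by blast
    then show "u \<in> U <+>\<^bsub>R\<^esub> W" using u W(1) by auto
  qed
qed

lemma subspace_sum_least:
  assumes "submodule W ground R" "U \<subseteq> W" "U' \<subseteq> W"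
  shows "U <+>\<^bsub>R\<^esub> U' \<subseteq> W"
  using assms subspaceD(3)[OF assms(1)] by (auto simp: set_add_def')

lemma subspace_comm_span: "Y \<subseteq> carrier R \<Longrightarrow> submodule (comm_span R Y) ground R"
  unfolding comm_span_def by (rule subspace_k_span) auto

lemma comm_span_memI:
  "x \<in> Y \<Longrightarrow> y \<in> Y \<Longrightarrow> x \<otimes> y \<ominus> y \<otimes> x \<in> comm_span R Y"
  unfolding comm_span_def by (rule subsetD[OF k_span_superset]) auto

lemma comm_span_least:
  assumes "submodule W ground R" "\<And>x y. x \<in> Y \<Longrightarrow> y \<in> Y \<Longrightarrow> x \<otimes> y \<ominus> y \<otimes> x \<in> W"
  shows "comm_span R Y \<subseteq> W"
  unfolding comm_span_def by (rule k_span_least) (use assms in auto)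

lemma coset_eq_iff:
  assumes "submodule W ground R" "x \<in> carrier R" "y \<in> carrier R"
  shows "W +> x = W +> y \<longleftrightarrow> x \<ominus> y \<in> W"
proof -
  interpret W: abelian_subgroup W R using assms(1) by (rule subspace_abelian_subgroup)
  have "W +> x = W +> y \<longleftrightarrow> x \<in> W +> y"
    using assms W.a_repr_independence' W.a_repr_independenceD by metis
  also have "\<dots> \<longleftrightarrow> x \<ominus> y \<in> W"
    using W.a_rcos_module_minus[of y x] assms ring_axioms by simp
  finally show ?thesis .
qed

lemma coset_zero:
  assumes "submodule W ground R" "x \<in> W"
  shows "W +> x = W"
  using assms coset_eq_iff[of W x \<zero>] subspaceD(1)[OF assms(1)]
  by (auto simp: a_minus_def)

lemma list_sum_Nil [simp]: "list_sum R f [] = \<zero>"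
  and list_sum_Cons [simp]: "list_sum R f (x # xs) = f x \<oplus> list_sum R f xs"
  and list_prod_Nil [simp]: "list_prod R f [] = \<one>"
  and list_prod_Cons [simp]: "list_prod R f (x # xs) = f x \<otimes> list_prod R f xs"
  by (simp_all add: list_sum_def list_prod_def)

lemma list_sum_mem:
  "submodule W ground R \<Longrightarrow> (\<And>x. x \<in> set xs \<Longrightarrow> f x \<in> W) \<Longrightarrow> list_sum R f xs \<in> W"
  by (induction xs) (auto intro: subspaceD(2-3))

lemma list_sum_closed [intro, simp]:
  "(\<And>x. x \<in> set xs \<Longrightarrow> f x \<in> carrier R) \<Longrightarrow> list_sum R f xs \<in> carrier R"
  by (rule list_sum_mem[OF vs.carrier_is_submodule])

lemma list_prod_closed [intro, simp]:
  "(\<And>x. x \<in> set xs \<Longrightarrow> f x \<in> carrier R) \<Longrightarrow> list_prod R f xs \<in> carrier R"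
  by (induction xs) auto

lemma list_prod_append:
  "(\<And>x. x \<in> set xs \<union> set ys \<Longrightarrow> f x \<in> carrier R) \<Longrightarrow>
    list_prod R f (xs @ ys) = list_prod R f xs \<otimes> list_prod R f ys"
  by (induction xs) (auto simp: m_assoc)

lemma list_sum_append:
  "(\<And>x. x \<in> set xs \<union> set ys \<Longrightarrow> f x \<in> carrier R) \<Longrightarrow>
    list_sum R f (xs @ ys) = list_sum R f xs \<oplus> list_sum R f ys"
  by (induction xs) (auto simp: a_assoc)

lemma smult_list_sum:
  "(\<And>x. x \<in> set xs \<Longrightarrow> f x \<in> carrier R) \<Longrightarrow>
    c \<odot> list_sum R f xs = list_sum R (\<lambda>x. c \<odot> f x) xs"
  by (induction xs) (auto simp: smult_add)

lemma list_sum_mult_right: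
  "(\<And>x. x \<in> set xs \<Longrightarrow> f x \<in> carrier R) \<Longrightarrow> y \<in> carrier R \<Longrightarrow>
    list_sum R f xs \<otimes> y = list_sum R (\<lambda>x. f x \<otimes> y) xs"
  by (induction xs) (auto simp: l_distr)

end

lemma list_sum_cong: "(\<And>x. x \<in> set xs \<Longrightarrow> f x = g x) \<Longrightarrow> list_sum R f xs = list_sum R g xs"
  by (induction xs) (auto simp: list_sum_def)


lemma list_sum_map: "list_sum R f (map g xs) = list_sum R (\<lambda>x. f (g x)) xs"
  by (induction xs) (auto simp: list_sum_def)



section \<open>Homomorphisms and quotients\<close>

definition k_alg_hom :: "('k::field, 'b) module \<Rightarrow> ('k, 'c) module \<Rightarrow> ('b \<Rightarrow> 'c) set"
  where "k_alg_hom R S = {f \<in> ring_hom R S. \<forall>c. \<forall>x\<in>carrier R. f (c \<odot>\<^bsub>R\<^esub> x) = c \<odot>\<^bsub>S\<^esub> f x}"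

lemma k_alg_homI:
  assumes "\<And>x. x \<in> carrier R \<Longrightarrow> f x \<in> carrier S"
    and "\<And>x y. x \<in> carrier R \<Longrightarrow> y \<in> carrier R \<Longrightarrow> f (x \<otimes>\<^bsub>R\<^esub> y) = f x \<otimes>\<^bsub>S\<^esub> f y"
    and "\<And>x y. x \<in> carrier R \<Longrightarrow> y \<in> carrier R \<Longrightarrow> f (x \<oplus>\<^bsub>R\<^esub> y) = f x \<oplus>\<^bsub>S\<^esub> f y"
    and "f \<one>\<^bsub>R\<^esub> = \<one>\<^bsub>S\<^esub>"
    and "\<And>c x. x \<in> carrier R \<Longrightarrow> f (c \<odot>\<^bsub>R\<^esub> x) = c \<odot>\<^bsub>S\<^esub> f x"
  shows "f \<in> k_alg_hom R S"
  using assms by (auto simp: k_alg_hom_def ring_hom_def)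

lemma k_alg_homD:
  assumes "f \<in> k_alg_hom R S"
  shows "\<And>x. x \<in> carrier R \<Longrightarrow> f x \<in> carrier S"
    and "\<And>x y. x \<in> carrier R \<Longrightarrow> y \<in> carrier R \<Longrightarrow> f (x \<otimes>\<^bsub>R\<^esub> y) = f x \<otimes>\<^bsub>S\<^esub> f y"
    and "\<And>x y. x \<in> carrier R \<Longrightarrow> y \<in> carrier R \<Longrightarrow> f (x \<oplus>\<^bsub>R\<^esub> y) = f x \<oplus>\<^bsub>S\<^esub> f y"
    and "f \<one>\<^bsub>R\<^esub> = \<one>\<^bsub>S\<^esub>"
    and "\<And>c x. x \<in> carrier R \<Longrightarrow> f (c \<odot>\<^bsub>R\<^esub> x) = c \<odot>\<^bsub>S\<^esub> f x"
  using assms by (auto simp: k_alg_hom_def ring_hom_def)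

lemma k_alg_hom_comp:
  "f \<in> k_alg_hom R S \<Longrightarrow> g \<in> k_alg_hom S T \<Longrightarrow> (\<lambda>x. g (f x)) \<in> k_alg_hom R T"
  by (rule k_alg_homI) (auto simp: k_alg_homD)

locale kalg_hom = R?: kalg R + S?: kalg S
  for R :: "('k::field, 'b) module" (structure) and S :: "('k, 'c) module" (structure) +
  fixes f
  assumes hom: "f \<in> k_alg_hom R S"
begin

lemmas hom_closed = k_alg_homD(1)[OF hom]
  and hom_mult = k_alg_homD(2)[OF hom]
  and hom_add = k_alg_homD(3)[OF hom]
  and hom_one = k_alg_homD(4)[OF hom]
  and hom_smult = k_alg_homD(5)[OF hom]

lemma hom_zero: "f \<zero>\<^bsub>R\<^esub> = \<zero>\<^bsub>S\<^esub>"
proof -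
  have "f (0 \<odot>\<^bsub>R\<^esub> \<zero>\<^bsub>R\<^esub>) = 0 \<odot>\<^bsub>S\<^esub> f \<zero>\<^bsub>R\<^esub>" by (rule hom_smult) simp
  then show ?thesis by (simp add: hom_closed)
qed

lemma hom_uminus: "x \<in> carrier R \<Longrightarrow> f (\<ominus>\<^bsub>R\<^esub> x) = \<ominus>\<^bsub>S\<^esub> f x"
  by (simp add: hom_smult hom_closed flip: R.neg_one_smult S.neg_one_smult)

lemma hom_minus: "x \<in> carrier R \<Longrightarrow> y \<in> carrier R \<Longrightarrow> f (x \<ominus>\<^bsub>R\<^esub> y) = f x \<ominus>\<^bsub>S\<^esub> f y"
  by (simp add: a_minus_def hom_add hom_uminus)

lemma hom_list_sum:
  "(\<And>x. x \<in> set xs \<Longrightarrow> h x \<in> carrier R) \<Longrightarrow>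
    f (list_sum R h xs) = list_sum S (\<lambda>x. f (h x)) xs"
  by (induction xs) (auto simp: hom_add hom_zero)

lemma hom_list_prod:
  "(\<And>x. x \<in> set xs \<Longrightarrow> h x \<in> carrier R) \<Longrightarrow>
    f (list_prod R h xs) = list_prod S (\<lambda>x. f (h x)) xs"
  by (induction xs) (auto simp: hom_mult hom_one)

lemma subspace_vimage:
  assumes "submodule W ground S"
  shows "submodule {x \<in> carrier R. f x \<in> W} ground R"
  by (rule R.subspaceI)
    (use subspaceD[OF assms] in \<open>auto simp: hom_zero hom_add hom_smult\<close>)

lemma ideal_vimage:
  assumes "ideal W S"
  shows "ideal {x \<in> carrier R. f x \<in> W} R"
  by (rule R.ideal_of_subspace)
    (use assms in \<open>auto simp: hom_mult hom_closed ideal.I_l_closed ideal.I_r_closed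
      intro: subspace_vimage S.ideal_subspace\<close>)

lemma Idl_vimage:
  assumes "ideal W S" "Y \<subseteq> carrier R" "\<And>y. y \<in> Y \<Longrightarrow> f y \<in> W" "x \<in> Idl\<^bsub>R\<^esub> Y"
  shows "f x \<in> W"
proof -
  have "Idl\<^bsub>R\<^esub> Y \<subseteq> {x \<in> carrier R. f x \<in> W}"
    by (rule R.genideal_minimal) (use assms ideal_vimage in auto)
  then show ?thesis using assms(4) by auto
qed

lemma Idl_kernel:
  assumes "Y \<subseteq> carrier R" "\<And>y. y \<in> Y \<Longrightarrow> f y = \<zero>\<^bsub>S\<^esub>" "x \<in> Idl\<^bsub>R\<^esub> Y"
  shows "f x = \<zero>\<^bsub>S\<^esub>"
  using Idl_vimage[OF S.zeroideal assms(1) _ assms(3)] assms(2) by auto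

end

lemma quot_alg_sel:
  "carrier (quot_alg R I) = (\<lambda>x. I +>\<^bsub>R\<^esub> x) ` carrier R"
  "\<one>\<^bsub>quot_alg R I\<^esub> = I +>\<^bsub>R\<^esub> \<one>\<^bsub>R\<^esub>"
  "\<zero>\<^bsub>quot_alg R I\<^esub> = I"
  by (auto simp: quot_alg_def A_RCOSETS_def')

context kalg
begin

lemma quot_add:
  assumes "submodule I ground R" "x \<in> carrier R" "y \<in> carrier R"
  shows "(I +> x) \<oplus>\<^bsub>quot_alg R I\<^esub> (I +> y) = I +> (x \<oplus> y)"
proof -
  interpret I: abelian_subgroup I R using assms(1) by (rule subspace_abelian_subgroup)
  show ?thesis using assms by (simp add: quot_alg_def I.a_rcos_sum)
qed

lemma quot_smult:
  assumes "submodule I ground R" "x \<in> carrier R"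
  shows "c \<odot>\<^bsub>quot_alg R I\<^esub> (I +> x) = I +> (c \<odot> x)"
proof -
  interpret I: abelian_subgroup I R using assms(1) by (rule subspace_abelian_subgroup)
  have "I +> (c \<odot> y) = I +> (c \<odot> x)" if "y \<in> I +> x" for y
  proof -
    have y: "y \<in> carrier R" using that assms I.a_elemrcos_carrier by blast
    have "I +> y = I +> x"
      using that assms by (metis I.a_repr_independence')
    then have "y \<ominus> x \<in> I" using coset_eq_iff assms y by blast
    then have "c \<odot> y \<ominus> c \<odot> x \<in> I"
      using subspaceD(4)[OF assms(1)] y assms by (simp flip: smult_minus)
    then show ?thesis using coset_eq_iff assms y by simp
  qed
  moreover have "x \<in> I +> x" using assms I.a_rcos_self by blast
  ultimately have "(\<Union>y\<in>I +> x. I +> (c \<odot> y)) = I +> (c \<odot> x)" by blast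
  then show ?thesis by (simp add: quot_alg_def)
qed

lemma quot_mult:
  assumes "ideal I R" "x \<in> carrier R" "y \<in> carrier R"
  shows "(I +> x) \<otimes>\<^bsub>quot_alg R I\<^esub> (I +> y) = I +> (x \<otimes> y)"
  using ideal.rcoset_mult_add[OF assms] by (simp add: quot_alg_def)

lemma k_algebra_quot:
  assumes "ideal I R"
  shows "k_algebra (quot_alg R I)"
proof (rule k_algebraI)
  have S: "submodule I ground R" using assms by (rule ideal_subspace)
  note simps = quot_alg_sel quot_add[OF S] quot_mult[OF assms]
  have zero: "I = I +> \<zero>" using coset_zero[OF S] subspaceD(2)[OF S] by simp
  show "ring (quot_alg R I)"
  proof (rule ringI)
    have "\<exists>y\<in>carrier R. (I +> y) \<oplus>\<^bsub>quot_alg R I\<^esub> (I +> x) = I" if "x \<in> carrier R" for x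
      by (rule bexI[of _ "\<ominus> x"]) (use that zero in \<open>simp_all add: simps l_neg\<close>)
    moreover have "I \<oplus>\<^bsub>quot_alg R I\<^esub> (I +> x) = I +> x" if "x \<in> carrier R" for x
      using quot_add[OF S _ that, of "\<zero>"] that by (simp flip: zero)
    moreover have "I \<in> (+>) I ` carrier R"
      using zero by blast
    ultimately show "abelian_group (quot_alg R I)"
      by (intro abelian_groupI) (auto simp: simps a_ac)
    show "monoid (quot_alg R I)"
      by (rule monoidI) (auto simp: simps m_assoc)
  qed (auto simp: simps l_distr r_distr)
qed (use ideal_subspace[OF assms] assms in
    \<open>auto simp: quot_alg_sel quot_add quot_smult quot_mult add_smult smult_add mult_smult
       smult_left smult_right\<close>)

lemma quot_proj_hom: "ideal I R \<Longrightarrow> (\<lambda>x. I +> x) \<in> k_alg_hom R (quot_alg R I)"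
  by (rule k_alg_homI)
    (auto simp: quot_alg_sel quot_add quot_smult quot_mult ideal_subspace)

lemma quot_lift:
  assumes "submodule I ground R"
    and "\<And>x y. x \<in> carrier R \<Longrightarrow> y \<in> carrier R \<Longrightarrow> x \<ominus> y \<in> I \<Longrightarrow> f x = f y"
  obtains g where "\<And>x. x \<in> carrier R \<Longrightarrow> g (I +> x) = f x"
proof
  interpret I: abelian_subgroup I R using assms(1) by (rule subspace_abelian_subgroup)
  fix x assume x: "x \<in> carrier R"
  define y where "y = (SOME y. y \<in> carrier R \<and> I +> y = I +> x)"
  have "y \<in> carrier R \<and> I +> y = I +> x" unfolding y_def by (rule someI_ex) (use x in auto)
  then have "f y = f x" using assms x coset_eq_iff by auto
  then show "(\<lambda>Y. f (SOME y. y \<in> carrier R \<and> I +> y = Y)) (I +> x) = f x"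
    by (simp add: y_def)
qed

lemma quot_hom_lift:
  assumes "ideal I R" "k_algebra S" "f \<in> k_alg_hom R S" "\<And>x. x \<in> I \<Longrightarrow> f x = \<zero>\<^bsub>S\<^esub>"
  obtains g where "g \<in> k_alg_hom (quot_alg R I) S" "\<And>x. x \<in> carrier R \<Longrightarrow> g (I +> x) = f x"
proof -
  interpret S: kalg S by standard fact
  interpret f: kalg_hom R S f by standard fact
  have sub: "submodule I ground R" using assms(1) by (rule ideal_subspace)
  have "f x = f y" if "x \<in> carrier R" "y \<in> carrier R" "x \<ominus> y \<in> I" for x y
  proof -
    have "f x \<ominus>\<^bsub>S\<^esub> f y = \<zero>\<^bsub>S\<^esub>" using that assms(4) by (simp flip: f.hom_minus)
    then show ?thesis using that S.r_right_minus_eq f.hom_closed by blast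
  qed
  then obtain g where g: "\<And>x. x \<in> carrier R \<Longrightarrow> g (I +> x) = f x"
    using quot_lift[OF sub] by metis
  moreover have "g \<in> k_alg_hom (quot_alg R I) S"
    by (rule k_alg_homI)
      (auto simp: quot_alg_sel quot_add quot_smult quot_mult sub assms(1) g f.hom_closed
        f.hom_mult f.hom_add f.hom_smult f.hom_one)
  ultimately show thesis by (rule that[rotated])
qed

text \<open>
  The first isomorphism theorem. Injectivity is a hypothesis about pairs of elements, so that nothing
  has to be known about the target.
\<close>

lemma quot_lin_iso:
  assumes I: "submodule I ground R"
    and lin: "k_lin_on R (carrier R) S f"
    and surj: "carrier S \<subseteq> f ` carrier R"
    and inj: "\<And>x y. x \<in> carrier R \<Longrightarrow> y \<in> carrier R \<Longrightarrow> f x = f y \<longleftrightarrow> x \<ominus> y \<in> I"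
  obtains g where "g \<in> k_lin_iso (quot_alg R I) S" "\<And>x. x \<in> carrier R \<Longrightarrow> g (I +> x) = f x"
proof -
  obtain g where g: "\<And>x. x \<in> carrier R \<Longrightarrow> g (I +> x) = f x"
    using quot_lift[OF I, of f] inj by metis
  have "inj_on g (carrier (quot_alg R I))"
  proof (rule inj_onI)
    fix U V assume "U \<in> carrier (quot_alg R I)" "V \<in> carrier (quot_alg R I)" "g U = g V"
    moreover from this obtain x y where "U = I +> x" "x \<in> carrier R" "V = I +> y" "y \<in> carrier R"
      by (auto simp: quot_alg_sel)
    ultimately show "U = V" by (simp add: g inj coset_eq_iff[OF I])
  qed
  moreover have "g ` carrier (quot_alg R I) = carrier S"
    using lin surj by (auto simp: quot_alg_sel g k_lin_on_def image_image)
  moreover have "k_lin_on (quot_alg R I) (carrier (quot_alg R I)) S g"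
    using lin by (auto simp: k_lin_on_def quot_alg_sel quot_add quot_smult I g)
  ultimately have "g \<in> k_lin_iso (quot_alg R I) S"
    by (simp add: k_lin_iso_def bij_betw_def)
  then show thesis using g that by blast
qed

lemma quot_lin_iso_mult:
  assumes "ideal I R" "g \<in> k_lin_iso (quot_alg R I) S"
    and "\<And>x. x \<in> carrier R \<Longrightarrow> g (I +> x) = f x"
    and "\<And>x y. x \<in> carrier R \<Longrightarrow> y \<in> carrier R \<Longrightarrow> f (x \<otimes> y) = f x \<otimes>\<^bsub>S\<^esub> f y"
    and "f \<one> = \<one>\<^bsub>S\<^esub>"
  shows "g \<in> k_alg_iso (quot_alg R I) S"
  using assms
  by (auto simp: k_lin_iso_def k_alg_iso_def k_lin_on_def ring_iso_def ring_hom_def quot_alg_sel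
      quot_mult)

lemma abelian_quot:
  assumes "ideal I R" "comm_span R (carrier R) \<subseteq> I"
  shows "abelian_k_algebra (quot_alg R I)"
proof -
  interpret Q: kalg "quot_alg R I" by standard (rule k_algebra_quot[OF assms(1)])
  have "(I +> x) \<otimes>\<^bsub>quot_alg R I\<^esub> (I +> y) = (I +> y) \<otimes>\<^bsub>quot_alg R I\<^esub> (I +> x)"
    if "x \<in> carrier R" "y \<in> carrier R" for x y
    using that assms comm_span_memI[of x "carrier R" y]
    by (auto simp: quot_mult coset_eq_iff ideal_subspace)
  then have "comm_monoid (quot_alg R I)"
    by (intro monoid.monoid_comm_monoidI Q.monoid_axioms) (auto simp: quot_alg_sel)
  then show ?thesis
    by (simp add: abelian_k_algebra_def Q.k_algebra cring_def Q.ring_axioms)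
qed

end


section \<open>Tensor algebras\<close>

lemma type_alg_sel [simp]:
  "carrier (type_alg s) = UNIV" "\<one>\<^bsub>type_alg s\<^esub> = 1" "\<zero>\<^bsub>type_alg s\<^esub> = 0"
  "x \<otimes>\<^bsub>type_alg s\<^esub> y = x * y" "x \<oplus>\<^bsub>type_alg s\<^esub> y = x + y" "c \<odot>\<^bsub>type_alg s\<^esub> x = s c x"
  by (simp_all add: type_alg_def)

lemma ring_type_alg: "ring (type_alg s)"
proof (rule ringI)
  show "abelian_group (type_alg s)"
    by (rule abelian_groupI) (auto simp: algebra_simps intro: exI[of _ "- x" for x])
  show "monoid (type_alg s)"
    by (rule monoidI) (auto simp: algebra_simps)
qed (auto simp: algebra_simps)

lemma type_alg_minus [simp]: "\<ominus>\<^bsub>type_alg s\<^esub> x = - x" "x \<ominus>\<^bsub>type_alg s\<^esub> y = x - y"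
proof -
  interpret ring "type_alg s" by (rule ring_type_alg)
  show "\<ominus>\<^bsub>type_alg s\<^esub> x = - x" for x by (rule minus_equality) simp_all
  then show "x \<ominus>\<^bsub>type_alg s\<^esub> y = x - y" by (simp add: a_minus_def)
qed

lemma poly_mapping_add_induct [case_names zero single add]:
  fixes p :: "'a \<Rightarrow>\<^sub>0 'b::comm_monoid_add"
  assumes "P 0" "\<And>w c. P (Poly_Mapping.single w c)" "\<And>p q. P p \<Longrightarrow> P q \<Longrightarrow> P (p + q)"
  shows "P p"
proof (induction p rule: Poly_Mapping.update_induct)
  case (update f a b)
  then have "Poly_Mapping.update a b f = Poly_Mapping.single a b + f"
    by (intro poly_mapping_eqI)
      (auto simp: lookup_update lookup_add lookup_single in_keys_iff when_def)
  then show ?case using assms update by simp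
qed (rule assms)

lemma scalar_central:
  fixes p :: "'w word \<Rightarrow>\<^sub>0 'k::field"
  shows "p * Poly_Mapping.single 0 c = Poly_Mapping.single 0 c * p"
  by (induction p rule: poly_mapping_add_induct)
    (simp_all add: mult_single algebra_simps)

lemma k_algebra_free_alg: "k_algebra (free_alg :: ('k::field, 'w word \<Rightarrow>\<^sub>0 'k) module)"
proof -
  have "x * (Poly_Mapping.single 0 c * y) = Poly_Mapping.single 0 c * (x * y)"
    for c and x y :: "'w word \<Rightarrow>\<^sub>0 'k"
    by (metis scalar_central mult.assoc)
  then show ?thesis
    unfolding free_alg_def
    by (intro k_algebraI ring_type_alg)
      (simp_all add: algebra_simps single_add mult_single flip: mult.assoc)
qed

lemma free_alg_sel [simp]:
  "carrier free_alg = UNIV" "\<one>\<^bsub>free_alg\<^esub> = 1" "\<zero>\<^bsub>free_alg\<^esub> = 0"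
  "x \<otimes>\<^bsub>free_alg\<^esub> y = x * y" "x \<oplus>\<^bsub>free_alg\<^esub> y = x + y"
  "c \<odot>\<^bsub>free_alg\<^esub> x = Poly_Mapping.single 0 c * x" "x \<ominus>\<^bsub>free_alg\<^esub> y = x - y"
  by (simp_all add: free_alg_def)

lemma list_prod_letter: "list_prod free_alg letter ws = Poly_Mapping.single (Word ws) (1::'k::field)"
proof (induction ws)
  case Nil
  show ?case by (simp add: list_prod_def flip: zero_word_def)
next
  case (Cons w ws)
  then show ?case by (simp add: list_prod_def letter_def mult_single plus_word_def)
qed

text \<open>The extension of a map on letters to an algebra map on the free algebra.\<close>

definition free_eval :: "('k::field, 'c) module \<Rightarrow> ('w \<Rightarrow> 'c) \<Rightarrow> ('w word \<Rightarrow>\<^sub>0 'k) \<Rightarrow> 'c"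
  where "free_eval S g p =
    finsum S (\<lambda>w. Poly_Mapping.lookup p w \<odot>\<^bsub>S\<^esub> list_prod S g (letters w)) (Poly_Mapping.keys p)"

context kalg
begin

context
  fixes g :: "'w \<Rightarrow> 'b"
  assumes g: "\<And>w. g w \<in> carrier R"
begin

lemma free_eval_superset:
  assumes "finite F" "Poly_Mapping.keys p \<subseteq> F"
  shows "free_eval R g p = (\<Oplus>w\<in>F. Poly_Mapping.lookup p w \<odot> list_prod R g (letters w))"
  unfolding free_eval_def
  by (rule add.finprod_mono_neutral_cong_left) (use assms g in \<open>auto simp: in_keys_iff\<close>)

lemma free_eval_closed: "free_eval R g p \<in> carrier R"
  unfolding free_eval_def by (rule finsum_closed) (use g in auto)

lemma free_eval_add: "free_eval R g (p + q) = free_eval R g p \<oplus> free_eval R g q"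
proof -
  let ?F = "Poly_Mapping.keys p \<union> Poly_Mapping.keys q"
  let ?t = "\<lambda>p w. Poly_Mapping.lookup p w \<odot> list_prod R g (letters w)"
  have "free_eval R g (p + q) = (\<Oplus>w\<in>?F. ?t (p + q) w)"
    by (rule free_eval_superset) (use keys_add[of p q] in auto)
  also have "\<dots> = (\<Oplus>w\<in>?F. ?t p w \<oplus> ?t q w)"
    by (rule finsum_cong') (use g in \<open>auto simp: lookup_add add_smult\<close>)
  also have "\<dots> = (\<Oplus>w\<in>?F. ?t p w) \<oplus> (\<Oplus>w\<in>?F. ?t q w)"
    by (rule finsum_addf) (use g in auto)
  also have "\<dots> = free_eval R g p \<oplus> free_eval R g q"
    using free_eval_superset[of ?F p] free_eval_superset[of ?F q] by simp
  finally show ?thesis .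
qed

lemma free_eval_single:
  "free_eval R g (Poly_Mapping.single w c) = c \<odot> list_prod R g (letters w)"
proof -
  have "free_eval R g (Poly_Mapping.single w c) =
      (\<Oplus>u\<in>{w}. Poly_Mapping.lookup (Poly_Mapping.single w c) u \<odot> list_prod R g (letters u))"
    by (rule free_eval_superset) auto
  then show ?thesis using g by simp
qed

lemma free_eval_zero: "free_eval R g 0 = \<zero>"
  by (simp add: free_eval_def)

lemma free_eval_mult: "free_eval R g (p * q) = free_eval R g p \<otimes> free_eval R g q"
proof (induction p rule: poly_mapping_add_induct)
  case (single w c)
  show ?case
  proof (induction q rule: poly_mapping_add_induct)
    case (single u d)
    show ?case
      using g by (simp add: mult_single free_eval_single plus_word_def list_prod_append smult_left
          smult_right mult.commute[of c d] flip: mult_smult)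
  qed (simp_all add: free_eval_zero free_eval_add free_eval_closed distrib_left r_distr)
qed (simp_all add: free_eval_zero free_eval_add free_eval_closed distrib_right l_distr)

lemma free_eval_hom: "free_eval R g \<in> k_alg_hom free_alg R"
proof (rule k_alg_homI)
  have one: "free_eval R g (Poly_Mapping.single 0 c) = c \<odot> \<one>" for c
    by (simp add: free_eval_single zero_word_def)
  show "free_eval R g \<one>\<^bsub>free_alg\<^esub> = \<one>"
    using one[of 1] by simp
  show "free_eval R g (c \<odot>\<^bsub>free_alg\<^esub> p) = c \<odot> free_eval R g p" for c p
    by (simp add: free_eval_mult one smult_left free_eval_closed)
qed (simp_all add: free_eval_closed free_eval_add free_eval_mult)

lemma free_eval_letter: "free_eval R g (letter w) = g w"
  using g by (simp add: letter_def free_eval_single)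

end

end

lemma ideal_tens_ideal: "ideal (tens_ideal s) free_alg"
proof -
  interpret kalg free_alg by standard (rule k_algebra_free_alg)
  show ?thesis
    unfolding tens_ideal_def by (rule genideal_ideal) simp
qed

lemma k_algebra_tens_alg: "k_algebra (tens_alg s)"
  unfolding tens_alg_def
  by (rule kalg.k_algebra_quot) (simp_all add: kalg_def k_algebra_free_alg ideal_tens_ideal)

lemma tens_proj_hom: "(\<lambda>p. tens_ideal s +>\<^bsub>free_alg\<^esub> p) \<in> k_alg_hom free_alg (tens_alg s)"
  unfolding tens_alg_def
  by (rule kalg.quot_proj_hom) (simp_all add: kalg_def k_algebra_free_alg ideal_tens_ideal)

lemma tens_gen_closed [simp, intro]: "tens_gen s w \<in> carrier (tens_alg s)"
  unfolding tens_gen_def by (rule k_alg_homD(1)[OF tens_proj_hom]) simp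

lemma
  fixes s :: "'k::field \<Rightarrow> 'w::ab_group_add \<Rightarrow> 'w"
  shows tens_gen_add: "tens_gen s (w + w') = tens_gen s w \<oplus>\<^bsub>tens_alg s\<^esub> tens_gen s w'"
  and tens_gen_smult: "tens_gen s (s c w) = c \<odot>\<^bsub>tens_alg s\<^esub> tens_gen s w"
proof -
  interpret F: kalg "free_alg :: ('k, 'w word \<Rightarrow>\<^sub>0 'k) module"
    by standard (rule k_algebra_free_alg)
  note sub = F.ideal_subspace[OF ideal_tens_ideal]
  have "lin_rels s \<subseteq> tens_ideal s"
    unfolding tens_ideal_def by (rule F.genideal_self) simp
  then have rels: "letter (w + w') - (letter w + letter w') \<in> tens_ideal s"
    "letter (s c w) - Poly_Mapping.single 0 c * letter w \<in> tens_ideal s" for c w w'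
    by (force simp: lin_rels_def diff_diff_eq)+
  show "tens_gen s (w + w') = tens_gen s w \<oplus>\<^bsub>tens_alg s\<^esub> tens_gen s w'" 
    by (simp add: tens_gen_def tens_alg_def F.quot_add[OF sub] F.coset_eq_iff[OF sub] rels)
  show "tens_gen s (s c w) = c \<odot>\<^bsub>tens_alg s\<^esub> tens_gen s w"
    by (simp add: tens_gen_def tens_alg_def F.quot_smult[OF sub] F.coset_eq_iff[OF sub] rels)
qed

text \<open>
  The universal property of the tensor algebra: the evaluation \<open>free_eval\<close> kills \<open>lin_rels\<close> because
  \<open>g\<close> is linear.
\<close>

lemma tens_alg_lift:
  fixes S :: "('k::field, 'c) module" (structure) and s :: "'k \<Rightarrow> 'w::ab_group_add \<Rightarrow> 'w"
  assumes "k_algebra S" "\<And>w. g w \<in> carrier S" "\<And>w w'. g (w + w') = g w \<oplus> g w'"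
    "\<And>c w. g (s c w) = c \<odot> g w"
  obtains f where "f \<in> k_alg_hom (tens_alg s) S" "\<And>w. f (tens_gen s w) = g w"
proof -
  interpret S: kalg S by standard fact
  interpret F: kalg "free_alg :: ('k, 'w word \<Rightarrow>\<^sub>0 'k) module"
    by standard (rule k_algebra_free_alg)
  note hom = S.free_eval_hom[of g, OF assms(2)]
  interpret f: kalg_hom free_alg S "free_eval S g" by standard (rule hom)
  have [simp]: "free_eval S g (letter w) = g w" for w
    by (rule S.free_eval_letter) (rule assms(2))
  have diff: "free_eval S g (p - q) = free_eval S g p \<ominus> free_eval S g q" for p q
    using f.hom_minus[of p q] by simp
  have smult: "free_eval S g (Poly_Mapping.single 0 c * p) = c \<odot> free_eval S g p" for c p
    using f.hom_smult[of p c] by simp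
  have "free_eval S g p = \<zero>" if "p \<in> tens_ideal s" for p
    using that unfolding tens_ideal_def
  proof (rule f.Idl_kernel[rotated 2])
    fix y assume "y \<in> lin_rels s"
    then show "free_eval S g y = \<zero>"
      using assms(2) f.hom_add
      by (auto simp: lin_rels_def diff_diff_eq diff smult assms(3,4) simp del: diff_diff_eq2)
  qed simp
  with F.quot_hom_lift[OF ideal_tens_ideal assms(1) hom, of s]
  obtain h where "h \<in> k_alg_hom (tens_alg s) S"
    "\<And>p. h (tens_ideal s +>\<^bsub>free_alg\<^esub> p) = free_eval S g p"
    by (auto simp: tens_alg_def)
  then show thesis using that by (simp add: tens_gen_def)
qed

lemma tens_alg_span:
  fixes s :: "'k::field \<Rightarrow> 'w::ab_group_add \<Rightarrow> 'w"
  assumes "submodule W ground (tens_alg s)" "\<And>ws. list_prod (tens_alg s) (tens_gen s) ws \<in> W"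
  shows "carrier (tens_alg s) \<subseteq> W"
proof -
  interpret F: kalg "free_alg :: ('k, 'w word \<Rightarrow>\<^sub>0 'k) module"
    by standard (rule k_algebra_free_alg)
  interpret T: kalg "tens_alg s" by standard (rule k_algebra_tens_alg)
  interpret f: kalg_hom free_alg "tens_alg s" "\<lambda>p. tens_ideal s +>\<^bsub>free_alg\<^esub> p"
    by standard (rule tens_proj_hom)
  note W = T.subspaceD[OF assms(1)]
  have "tens_ideal s +>\<^bsub>free_alg\<^esub> p \<in> W" for p
  proof (induction p rule: poly_mapping_add_induct)
    case zero
    show ?case using f.hom_zero W by simp
  next
    case (add p q)
    then show ?case using f.hom_add[of p q] W by simp
  next
    case (single w c)
    have "tens_ideal s +>\<^bsub>free_alg\<^esub> list_prod free_alg letter (letters w) \<in> W"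
      using f.hom_list_prod[of "letters w" letter] assms(2)[of "letters w"]
      by (simp flip: tens_gen_def)
    then have "c \<odot>\<^bsub>tens_alg s\<^esub> (tens_ideal s +>\<^bsub>free_alg\<^esub> Poly_Mapping.single w 1) \<in> W"
      using W by (simp add: list_prod_letter)
    then show ?case
      using f.hom_smult[of "Poly_Mapping.single w 1" c] by (simp add: mult_single)
  qed
  then show ?thesis by (auto simp: tens_alg_def quot_alg_sel)
qed

lemma tens_hom_eq:
  assumes "k_algebra S" "f \<in> k_alg_hom (tens_alg s) S" "f' \<in> k_alg_hom (tens_alg s) S"
    "\<And>w. f (tens_gen s w) = f' (tens_gen s w)" "x \<in> carrier (tens_alg s)"
  shows "f x = f' x"
proof -
  interpret S: kalg S by standard fact
  interpret T: kalg "tens_alg s" by standard (rule k_algebra_tens_alg)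
  interpret f: kalg_hom "tens_alg s" S f by standard fact
  interpret f': kalg_hom "tens_alg s" S f' by standard fact
  have "carrier (tens_alg s) \<subseteq> {x \<in> carrier (tens_alg s). f x = f' x}"
    by (rule tens_alg_span)
      (auto intro!: T.subspaceI simp: f.hom_zero f'.hom_zero f.hom_add f'.hom_add f.hom_smult
        f'.hom_smult f.hom_list_prod f'.hom_list_prod assms(4))
  then show ?thesis using assms(5) by auto
qed

lemma tens_alg_left_induct:
  assumes "submodule W ground (tens_alg s)" "\<one>\<^bsub>tens_alg s\<^esub> \<in> W"
    "\<And>w x. x \<in> W \<Longrightarrow> tens_gen s w \<otimes>\<^bsub>tens_alg s\<^esub> x \<in> W"
  shows "carrier (tens_alg s) \<subseteq> W"
proof (rule tens_alg_span[OF assms(1)])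
  interpret T: kalg "tens_alg s" by standard (rule k_algebra_tens_alg)
  show "list_prod (tens_alg s) (tens_gen s) ws \<in> W" for ws
    by (induction ws) (auto intro: assms)
qed


section \<open>Pure tensors and bilinear maps\<close>

lemma pure_tensor_closed [simp, intro]: "pure_tensor s t \<in> carrier (tens_alg s)"
proof -
  interpret T: kalg "tens_alg s" by standard (rule k_algebra_tens_alg)
  show ?thesis by (cases t) (simp add: pure_tensor_def)
qed

lemma pure_tensor_smult: "pure_tensor s (s c w, w') = c \<odot>\<^bsub>tens_alg s\<^esub> pure_tensor s (w, w')"
proof -
  interpret T: kalg "tens_alg s" by standard (rule k_algebra_tens_alg)
  show ?thesis by (simp add: pure_tensor_def tens_gen_smult T.smult_left)
qed

lemma tensor_square_list_sum:
  assumes "\<And>c w. w \<in> M \<Longrightarrow> s c w \<in> M" "t \<in> tensor_square s M"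
  obtains xs where "set xs \<subseteq> M \<times> M" "t = list_sum (tens_alg s) (pure_tensor s) xs"
proof -
  interpret T: kalg "tens_alg s" by standard (rule k_algebra_tens_alg)
  let ?W = "{list_sum (tens_alg s) (pure_tensor s) xs | xs. set xs \<subseteq> M \<times> M}"
  have "k_span (tens_alg s) (pure_tensor s ` (M \<times> M)) \<subseteq> ?W"
  proof (rule T.k_span_least[OF T.subspaceI])
    show "\<zero>\<^bsub>tens_alg s\<^esub> \<in> ?W" by (force intro: exI[of _ "[]"])
    show "?W \<subseteq> carrier (tens_alg s)" by auto
    show "x \<oplus>\<^bsub>tens_alg s\<^esub> y \<in> ?W" if "x \<in> ?W" "y \<in> ?W" for x y
    proof -
      from that obtain xs ys where "set xs \<subseteq> M \<times> M" "set ys \<subseteq> M \<times> M"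
        "x = list_sum (tens_alg s) (pure_tensor s) xs" "y = list_sum (tens_alg s) (pure_tensor s) ys"
        by auto
      then show ?thesis by (auto simp: T.list_sum_append intro!: exI[of _ "xs @ ys"])
    qed
    show "c \<odot>\<^bsub>tens_alg s\<^esub> x \<in> ?W" if "x \<in> ?W" for c x
    proof -
      from that obtain xs where xs: "set xs \<subseteq> M \<times> M"
        "x = list_sum (tens_alg s) (pure_tensor s) xs"
        by auto
      have "c \<odot>\<^bsub>tens_alg s\<^esub> x =
          list_sum (tens_alg s) (\<lambda>t. pure_tensor s (case t of (w, w') \<Rightarrow> (s c w, w'))) xs"
        unfolding xs(2) by (subst T.smult_list_sum)
          (auto intro!: list_sum_cong simp: pure_tensor_smult)
      also have "\<dots> = list_sum (tens_alg s) (pure_tensor s) (map (\<lambda>(w, w'). (s c w, w')) xs)"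
        by (simp add: list_sum_map)
      finally show ?thesis using xs(1) assms(1) by fastforce
    qed
    show "pure_tensor s ` (M \<times> M) \<subseteq> ?W"
      by (auto intro!: exI[of _ "[t]" for t])
  qed
  then show thesis using assms(2) that by (auto simp: tensor_square_def)
qed

text \<open>
  The algebra \<open>k 1 + W + U\<close> in which \<open>W W \<subseteq> U\<close> is given by a bilinear map \<open>\<beta>\<close> and all longer
  products vanish. The map from the tensor algebra of \<open>W\<close> to it reads off \<open>\<beta>\<close> from
  the component in degree two.
\<close>

definition bilin_alg ::
    "('k \<Rightarrow> 'w \<Rightarrow> 'w) \<Rightarrow> ('k \<Rightarrow> 'u \<Rightarrow> 'u) \<Rightarrow> ('w \<Rightarrow> 'w \<Rightarrow> 'u) \<Rightarrow>
     ('k::field, 'k \<times> 'w::ab_group_add \<times> 'u::ab_group_add) module"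
  where "bilin_alg s s' \<beta> =
    \<lparr>carrier = UNIV,
     mult = (\<lambda>(c, w, u) (d, w', u').
       (c * d, s c w' + s d w, s' c u' + s' d u + \<beta> w w')),
     one = (1, 0, 0), zero = 0, add = (+),
     smult = (\<lambda>e (c, w, u). (e * c, s e w, s' e u))\<rparr>"

lemma k_algebra_bilin_alg:
  assumes "vector_space s" "vector_space s'"
    and add: "\<And>w w' w''. \<beta> (w + w') w'' = \<beta> w w'' + \<beta> w' w''"
      "\<And>w w' w''. \<beta> w (w' + w'') = \<beta> w w' + \<beta> w w''"
    and smult: "\<And>c w w'. \<beta> (s c w) w' = s' c (\<beta> w w')" "\<And>c w w'. \<beta> w (s c w') = s' c (\<beta> w w')"
  shows "k_algebra (bilin_alg s s' \<beta>)"
proof -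
  interpret s: vector_space s by fact
  interpret s': vector_space s' by fact
  have zero [simp]: "\<beta> 0 w = 0" "\<beta> w 0 = 0" for w
    using add(1)[of 0 0 w] add(2)[of w 0 0] by simp_all
  note simps = bilin_alg_def add smult s.scale_left_distrib s.scale_right_distrib
    s'.scale_left_distrib s'.scale_right_distrib split_beta prod_eq_iff algebra_simps
  show ?thesis
  proof (rule k_algebraI)
    show "ring (bilin_alg s s' \<beta>)"
    proof (rule ringI)
      show "abelian_group (bilin_alg s s' \<beta>)"
      proof (rule abelian_groupI)
        fix x assume "x \<in> carrier (bilin_alg s s' \<beta>)"
        show "\<exists>y\<in>carrier (bilin_alg s s' \<beta>). y \<oplus>\<^bsub>bilin_alg s s' \<beta>\<^esub> x = \<zero>\<^bsub>bilin_alg s s' \<beta>\<^esub>"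
          by (rule bexI[of _ "- x"]) (simp_all add: bilin_alg_def)
      qed (simp_all add: bilin_alg_def algebra_simps)
      show "monoid (bilin_alg s s' \<beta>)"
        by (rule monoidI) (auto simp: simps)
    qed (auto simp: simps)
  qed (auto simp: simps)
qed

text \<open>
  The universal property of \<open>W \<otimes> W\<close> as a subspace of the tensor algebra, by evaluation in \<open>bilin_alg\<close>.
  It makes formulas in Sweedler notation independent of the chosen representation.
\<close>

lemma bilinear_tensor_eq:
  assumes "vector_space s" "vector_space s'"
    and add: "\<And>w w' w''. \<beta> (w + w') w'' = \<beta> w w'' + \<beta> w' w''"
      "\<And>w w' w''. \<beta> w (w' + w'') = \<beta> w w' + \<beta> w w''"
    and smult: "\<And>c w w'. \<beta> (s c w) w' = s' c (\<beta> w w')" "\<And>c w w'. \<beta> w (s c w') = s' c (\<beta> w w')"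
    and eq: "list_sum (tens_alg s) (pure_tensor s) xs = list_sum (tens_alg s) (pure_tensor s) ys"
  shows "(\<Sum>(w, w')\<leftarrow>xs. \<beta> w w') = (\<Sum>(w, w')\<leftarrow>ys. \<beta> w w')"
proof -
  interpret s: vector_space s by fact
  interpret s': vector_space s' by fact
  let ?B = "bilin_alg s s' \<beta>"
  have B: "k_algebra ?B" by (rule k_algebra_bilin_alg) fact+
  interpret T: kalg "tens_alg s" by standard (rule k_algebra_tens_alg)
  interpret B: kalg ?B by standard (rule B)
  obtain f where f: "f \<in> k_alg_hom (tens_alg s) ?B" "\<And>w. f (tens_gen s w) = (0, w, 0)"
    by (rule tens_alg_lift[OF B, of "\<lambda>w. (0, w, 0)" s]) (auto simp: bilin_alg_def)
  interpret f: kalg_hom "tens_alg s" ?B f by standard (rule f(1))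
  have pure: "f (pure_tensor s (w, w')) = (0, 0, \<beta> w w')" for w w'
    by (simp add: pure_tensor_def f.hom_mult f(2)) (simp add: bilin_alg_def)
  have "f (list_sum (tens_alg s) (pure_tensor s) zs) = (0, 0, \<Sum>(w, w')\<leftarrow>zs. \<beta> w w')" for zs
  proof (induction zs)
    case Nil
    show ?case by (simp add: f.hom_zero) (simp add: bilin_alg_def zero_prod_def)
  next
    case (Cons t zs)
    then show ?case by (cases t) (simp add: f.hom_add pure, simp add: bilin_alg_def)
  qed
  then show ?thesis using eq by (metis prod.inject)
qed


section \<open>Generators and relations of the algebra \<open>H\<close>\<close>

lemma vector_space_type_alg:
  assumes "k_algebra (type_alg s)"
  shows "vector_space s"
proof -
  interpret kalg "type_alg s" by standard fact
  show ?thesis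
    by unfold_locales
      (use smult_add add_smult mult_smult one_smult in auto)
qed

locale H_setting =
  fixes sA :: "'k::field \<Rightarrow> 'a::ring_1 \<Rightarrow> 'a"
    and sV :: "'k \<Rightarrow> 'v::ab_group_add \<Rightarrow> 'v"
    and D :: "'a \<Rightarrow> ('a word \<Rightarrow>\<^sub>0 'k) set"
    and act :: "'a \<Rightarrow> 'v \<Rightarrow> 'v"
    and \<kappa> :: "('v word \<Rightarrow>\<^sub>0 'k) set \<Rightarrow> 'a"
  assumes vector_space_sA: "vector_space sA" and vector_space_sV: "vector_space sV"
begin

abbreviation "T \<equiv> T_VA sA sV"
abbreviation "H \<equiv> H_alg sA sV D act \<kappa>"
abbreviation "hV \<equiv> H_V sA sV D act \<kappa>"
abbreviation "hA \<equiv> H_A sA sV D act \<kappa>"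
abbreviation "rels \<equiv> H_rels sA sV D act \<kappa>"

sublocale A: vector_space sA by (rule vector_space_sA)
sublocale V: vector_space sV by (rule vector_space_sV)

sublocale T: kalg T
  unfolding T_VA_def by standard (rule k_algebra_tens_alg)

lemma T_gen_closed [simp, intro]: "T_V sA sV v \<in> carrier T" "T_A sA sV a \<in> carrier T"
  by (simp_all add: T_V_def T_A_def T_VA_def)

lemma rels_closed: "rels \<subseteq> carrier T"
  by (auto simp: H_rels_def Let_def intro!: T.minus_closed T.list_sum_closed)

lemma ideal_H_ideal: "ideal (H_ideal sA sV D act \<kappa>) T"
  unfolding H_ideal_def by (rule T.genideal_ideal) (rule rels_closed)

sublocale H: kalg H
  unfolding H_alg_def by standard (rule T.k_algebra_quot, rule ideal_H_ideal)

sublocale proj: kalg_hom T H "\<lambda>x. H_ideal sA sV D act \<kappa> +>\<^bsub>T\<^esub> x"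
  by standard (use T.quot_proj_hom[OF ideal_H_ideal] in \<open>simp add: H_alg_def\<close>)

lemma rels_zero:
  assumes "x \<in> rels"
  shows "H_ideal sA sV D act \<kappa> +>\<^bsub>T\<^esub> x = \<zero>\<^bsub>H\<^esub>"
proof -
  have "x \<in> H_ideal sA sV D act \<kappa>"
    unfolding H_ideal_def using T.genideal_self[OF rels_closed] assms by blast
  then have "H_ideal sA sV D act \<kappa> +>\<^bsub>T\<^esub> x = H_ideal sA sV D act \<kappa>"
    by (rule T.coset_zero[OF T.ideal_subspace[OF ideal_H_ideal]])
  then show ?thesis by (simp add: H_alg_def quot_alg_sel)
qed

lemma H_gen_closed [simp, intro]: "hV v \<in> carrier H" "hA a \<in> carrier H"
  by (simp_all add: H_V_def H_A_def proj.hom_closed)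

lemma hA_mult: "hA a \<otimes>\<^bsub>H\<^esub> hA b = hA (a * b)"
proof -
  have "T_A sA sV a \<otimes>\<^bsub>T\<^esub> T_A sA sV b \<ominus>\<^bsub>T\<^esub> T_A sA sV (a * b) \<in> rels"
    by (auto simp: H_rels_def Let_def)
  from rels_zero[OF this] show ?thesis
    by (simp add: proj.hom_minus proj.hom_mult proj.hom_closed flip: H_A_def)
qed

lemma hA_one: "hA 1 = \<one>\<^bsub>H\<^esub>"
proof -
  have "T_A sA sV 1 \<ominus>\<^bsub>T\<^esub> \<one>\<^bsub>T\<^esub> \<in> rels"
    by (auto simp: H_rels_def Let_def)
  from rels_zero[OF this] show ?thesis
    by (simp add: proj.hom_minus proj.hom_one proj.hom_closed flip: H_A_def)
qed

lemma hA_hV: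
  assumes "sweedler sA D a xs"
  shows "hA a \<otimes>\<^bsub>H\<^esub> hV v = list_sum H (\<lambda>(x, y). hV (act x v) \<otimes>\<^bsub>H\<^esub> hA y) xs"
proof -
  let ?f = "\<lambda>(x, y). T_V sA sV (act x v) \<otimes>\<^bsub>T\<^esub> T_A sA sV y"
  have "T_A sA sV a \<otimes>\<^bsub>T\<^esub> T_V sA sV v \<ominus>\<^bsub>T\<^esub> list_sum T ?f xs \<in> rels"
    using assms by (auto simp: H_rels_def Let_def)
  from rels_zero[OF this] have "hA a \<otimes>\<^bsub>H\<^esub> hV v =
      H_ideal sA sV D act \<kappa> +>\<^bsub>T\<^esub> list_sum T ?f xs"
    by (simp add: proj.hom_minus proj.hom_mult proj.hom_closed T.list_sum_closed split_beta
        flip: H_A_def H_V_def)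
  also have "\<dots> = list_sum H (\<lambda>(x, y). hV (act x v) \<otimes>\<^bsub>H\<^esub> hA y) xs"
    by (subst proj.hom_list_sum)
      (auto intro!: list_sum_cong simp: proj.hom_mult simp flip: H_A_def H_V_def)
  finally show ?thesis .
qed

lemma hV_commutator:
  "hV v \<otimes>\<^bsub>H\<^esub> hV v' \<ominus>\<^bsub>H\<^esub> hV v' \<otimes>\<^bsub>H\<^esub> hV v = hA (\<kappa> (wedge sV v v'))"
proof -
  have "T_V sA sV v \<otimes>\<^bsub>T\<^esub> T_V sA sV v' \<ominus>\<^bsub>T\<^esub> T_V sA sV v' \<otimes>\<^bsub>T\<^esub> T_V sA sV v
      \<ominus>\<^bsub>T\<^esub> T_A sA sV (\<kappa> (wedge sV v v')) \<in> rels"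
    by (auto simp: H_rels_def Let_def)
  from rels_zero[OF this] show ?thesis
    by (simp add: proj.hom_minus proj.hom_mult proj.hom_closed flip: H_A_def H_V_def)
qed

lemma T_gen_linear:
  "T_V sA sV (v + v') = T_V sA sV v \<oplus>\<^bsub>T\<^esub> T_V sA sV v'"
  "T_V sA sV (sV c v) = c \<odot>\<^bsub>T\<^esub> T_V sA sV v"
  "T_A sA sV (a + a') = T_A sA sV a \<oplus>\<^bsub>T\<^esub> T_A sA sV a'"
  "T_A sA sV (sA c a) = c \<odot>\<^bsub>T\<^esub> T_A sA sV a"
  using tens_gen_add[of "sVA sA sV" "(v, 0)" "(v', 0)"]
    tens_gen_add[of "sVA sA sV" "(0, a)" "(0, a')"]
    tens_gen_smult[of "sVA sA sV" c "(v, 0)"] tens_gen_smult[of "sVA sA sV" c "(0, a)"]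
  by (simp_all add: T_V_def T_A_def T_VA_def) (simp_all add: sVA_def)

lemma tens_gen_T: "tens_gen (sVA sA sV) (v, a) = T_V sA sV v \<oplus>\<^bsub>T\<^esub> T_A sA sV a"
  using tens_gen_add[of "sVA sA sV" "(v, 0)" "(0, a)"] by (simp add: T_V_def T_A_def T_VA_def)

lemma H_gen_linear:
  "hV (v + v') = hV v \<oplus>\<^bsub>H\<^esub> hV v'" "hV (sV c v) = c \<odot>\<^bsub>H\<^esub> hV v"
  "hA (a + a') = hA a \<oplus>\<^bsub>H\<^esub> hA a'" "hA (sA c a) = c \<odot>\<^bsub>H\<^esub> hA a"
  by (simp_all add: H_V_def H_A_def T_gen_linear proj.hom_add proj.hom_smult)

lemma hV_zero: "hV 0 = \<zero>\<^bsub>H\<^esub>"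
  using H_gen_linear(2)[of 0 0] by simp

lemma hA_hom: "hA \<in> k_alg_hom (type_alg sA) H"
  by (rule k_alg_homI) (simp_all add: hA_mult hA_one H_gen_linear)

text \<open>
  The universal property of \<open>H\<close>: the linear map \<open>gV + gA\<close> on \<open>V \<oplus> A\<close> extends to the tensor algebra,
  and the last four hypotheses say that the extension kills the defining relations.
\<close>

lemma H_lift:
  fixes S :: "('k, 'c) module" (structure)
  assumes S: "k_algebra S" and closed: "\<And>v. gV v \<in> carrier S" "\<And>a. gA a \<in> carrier S"
    and lin: "\<And>v v'. gV (v + v') = gV v \<oplus> gV v'" "\<And>c v. gV (sV c v) = c \<odot> gV v"
      "\<And>a a'. gA (a + a') = gA a \<oplus> gA a'" "\<And>c a. gA (sA c a) = c \<odot> gA a"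
    and rel: "\<And>a b. gA a \<otimes> gA b = gA (a * b)" "gA 1 = \<one>"
      "\<And>a v xs. sweedler sA D a xs \<Longrightarrow>
        gA a \<otimes> gV v = list_sum S (\<lambda>(x, y). gV (act x v) \<otimes> gA y) xs"
      "\<And>v v'. gV v \<otimes> gV v' \<ominus> gV v' \<otimes> gV v = gA (\<kappa> (wedge sV v v'))"
  obtains f where "f \<in> k_alg_hom H S" "\<And>v. f (hV v) = gV v" "\<And>a. f (hA a) = gA a"
proof -
  interpret S: kalg S by standard (rule S)
  have zero: "gV 0 = \<zero>" "gA 0 = \<zero>"
    using lin(2)[of 0 0] lin(4)[of 0 0] closed by simp_all
  obtain h where h: "h \<in> k_alg_hom T S" "\<And>w. h (tens_gen (sVA sA sV) w) = gV (fst w) \<oplus> gA (snd w)"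
    by (rule tens_alg_lift[OF S, of "\<lambda>w. gV (fst w) \<oplus> gA (snd w)" "sVA sA sV"])
      (use closed in \<open>auto simp: lin sVA_def S.smult_add S.a_ac T_VA_def\<close>)
  interpret h: kalg_hom T S h by standard (rule h(1))
  have gen: "h (T_V sA sV v) = gV v" "h (T_A sA sV a) = gA a" for v a
    using closed by (simp_all add: T_V_def T_A_def h(2) zero)
  have sum: "h (list_sum T (\<lambda>(x, y). T_V sA sV (act x v) \<otimes>\<^bsub>T\<^esub> T_A sA sV y) xs) =
      list_sum S (\<lambda>(x, y). gV (act x v) \<otimes> gA y) xs" for v xs
    by (subst h.hom_list_sum) (auto intro!: list_sum_cong simp: h.hom_mult gen)
  have sum_closed: "list_sum T (\<lambda>(x, y). T_V sA sV (act x v) \<otimes>\<^bsub>T\<^esub> T_A sA sV y) xs \<in> carrier T" for v xs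
    by auto
  have rels: "h r = \<zero>" if "r \<in> rels" for r
    using that closed unfolding H_rels_def Let_def
    by (auto simp: h.hom_minus h.hom_mult h.hom_one gen rel sum sum_closed S.r_right_minus_eq
        simp flip: rel(3))
  have "h r = \<zero>" if "r \<in> H_ideal sA sV D act \<kappa>" for r
    using h.Idl_kernel[OF rels_closed rels] that by (simp add: H_ideal_def)
  then obtain f where "f \<in> k_alg_hom H S"
    "\<And>x. x \<in> carrier T \<Longrightarrow> f (H_ideal sA sV D act \<kappa> +>\<^bsub>T\<^esub> x) = h x"
    using T.quot_hom_lift[OF ideal_H_ideal S h(1)] unfolding H_alg_def by metis
  then show thesis using that by (simp add: H_V_def H_A_def gen)
qed

text \<open>
  Induction on words in the generators, read from right to left.
\<close>

lemma H_left_induct: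
  assumes "submodule W ground H" "\<one>\<^bsub>H\<^esub> \<in> W" "\<And>v x. x \<in> W \<Longrightarrow> hV v \<otimes>\<^bsub>H\<^esub> x \<in> W"
    "\<And>a x. x \<in> W \<Longrightarrow> hA a \<otimes>\<^bsub>H\<^esub> x \<in> W"
  shows "carrier H \<subseteq> W"
proof -
  let ?U = "{x \<in> carrier T. H_ideal sA sV D act \<kappa> +>\<^bsub>T\<^esub> x \<in> W}"
  note W = H.subspaceD[OF assms(1)]
  have "carrier (tens_alg (sVA sA sV)) \<subseteq> ?U"
  proof (rule tens_alg_left_induct)
    show "submodule ?U ground (tens_alg (sVA sA sV))"
      using proj.subspace_vimage[OF assms(1)] by (simp add: T_VA_def)
    show "\<one>\<^bsub>tens_alg (sVA sA sV)\<^esub> \<in> ?U"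
      using T.one_closed proj.hom_one assms(2) by (simp add: T_VA_def)
    fix w :: "'v \<times> 'a" and x assume x: "x \<in> ?U"
    obtain v a where w: "w = (v, a)" by (cases w)
    have gen: "H_ideal sA sV D act \<kappa> +>\<^bsub>T\<^esub> tens_gen (sVA sA sV) w = hV v \<oplus>\<^bsub>H\<^esub> hA a"
      by (simp add: w tens_gen_T proj.hom_add H_V_def H_A_def)
    have "tens_gen (sVA sA sV) w \<in> carrier T" by (simp add: T_VA_def)
    then have "tens_gen (sVA sA sV) w \<otimes>\<^bsub>T\<^esub> x \<in> ?U"
      using x assms(3,4) W(3) by (simp add: proj.hom_mult gen H.l_distr proj.hom_closed)
    then show "tens_gen (sVA sA sV) w \<otimes>\<^bsub>tens_alg (sVA sA sV)\<^esub> x \<in> ?U"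
      by (simp add: T_VA_def)
  qed
  then show ?thesis by (auto simp: H_alg_def quot_alg_sel T_VA_def)
qed

end


section \<open>Symmetric algebras\<close>

locale sym_setting =
  fixes sV :: "'k::field \<Rightarrow> 'v::ab_group_add \<Rightarrow> 'v"
begin

abbreviation "TV \<equiv> tens_alg sV"
abbreviation "SV \<equiv> sym_alg sV"

sublocale TV: kalg TV by standard (rule k_algebra_tens_alg)

lemma wedge_closed [simp, intro]: "wedge sV v v' \<in> carrier TV"
  by (simp add: wedge_def)

lemma ideal_sym_ideal: "ideal (sym_ideal sV) TV"
  unfolding sym_ideal_def by (rule TV.genideal_ideal) auto

sublocale SV: kalg SV
  unfolding sym_alg_def by standard (rule TV.k_algebra_quot, rule ideal_sym_ideal)

sublocale sproj: kalg_hom TV SV "\<lambda>x. sym_ideal sV +>\<^bsub>TV\<^esub> x"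
  by standard (use TV.quot_proj_hom[OF ideal_sym_ideal] in \<open>simp add: sym_alg_def\<close>)

lemma sym_gen_closed [simp, intro]: "sym_gen sV v \<in> carrier SV"
  by (simp add: sym_gen_def sproj.hom_closed)

lemma sym_gen_linear:
  "sym_gen sV (v + v') = sym_gen sV v \<oplus>\<^bsub>SV\<^esub> sym_gen sV v'"
  "sym_gen sV (sV c v) = c \<odot>\<^bsub>SV\<^esub> sym_gen sV v"
  by (simp_all add: sym_gen_def tens_gen_add tens_gen_smult sproj.hom_add sproj.hom_smult)

lemma sym_gen_commute: "sym_gen sV v \<otimes>\<^bsub>SV\<^esub> sym_gen sV v' = sym_gen sV v' \<otimes>\<^bsub>SV\<^esub> sym_gen sV v"
proof -
  have "wedge sV v v' \<in> sym_ideal sV"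
    unfolding sym_ideal_def by (rule subsetD[OF TV.genideal_self]) auto
  then have "sym_ideal sV +>\<^bsub>TV\<^esub> wedge sV v v' = sym_ideal sV"
    by (rule TV.coset_zero[OF TV.ideal_subspace[OF ideal_sym_ideal]])
  then have "sym_ideal sV +>\<^bsub>TV\<^esub> wedge sV v v' = \<zero>\<^bsub>SV\<^esub>"
    by (simp add: sym_alg_def quot_alg_sel)
  then show ?thesis
    by (simp add: wedge_def pure_tensor_def sproj.hom_minus sproj.hom_mult sproj.hom_closed
        flip: sym_gen_def)
qed

lemma SV_image: "carrier SV = (\<lambda>t. sym_ideal sV +>\<^bsub>TV\<^esub> t) ` carrier TV"
  by (simp add: sym_alg_def quot_alg_sel)

lemma subspace_commutant:
  assumes "y \<in> carrier SV"
  shows "submodule {x \<in> carrier SV. x \<otimes>\<^bsub>SV\<^esub> y = y \<otimes>\<^bsub>SV\<^esub> x} ground SV"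
  by (rule SV.subspaceI)
    (use assms in \<open>auto simp: SV.l_distr SV.r_distr SV.smult_left SV.smult_right\<close>)

text \<open>
  The commutant of \<open>y\<close> is a subalgebra, so it is everything once it contains the generators. Applied
  first to generators \<open>y\<close> and then to all \<open>y\<close>, this gives commutativity of the symmetric algebra.
\<close>

lemma SV_commutant_induct:
  assumes y: "y \<in> carrier SV" "\<And>v. sym_gen sV v \<otimes>\<^bsub>SV\<^esub> y = y \<otimes>\<^bsub>SV\<^esub> sym_gen sV v"
    and x: "x \<in> carrier SV"
  shows "x \<otimes>\<^bsub>SV\<^esub> y = y \<otimes>\<^bsub>SV\<^esub> x"
proof -
  let ?C = "{x \<in> carrier SV. x \<otimes>\<^bsub>SV\<^esub> y = y \<otimes>\<^bsub>SV\<^esub> x}"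
  have "carrier TV \<subseteq> {t \<in> carrier TV. sym_ideal sV +>\<^bsub>TV\<^esub> t \<in> ?C}" (is "_ \<subseteq> ?W")
  proof (rule tens_alg_left_induct)
    show "submodule ?W ground TV"
      by (rule sproj.subspace_vimage[OF subspace_commutant[OF y(1)]])
    show "\<one>\<^bsub>TV\<^esub> \<in> ?W"
      using y(1) by (simp add: sproj.hom_one)
    fix v t assume "t \<in> ?W"
    then have *: "t \<in> carrier TV" "sym_ideal sV +>\<^bsub>TV\<^esub> t \<in> carrier SV"
      "(sym_ideal sV +>\<^bsub>TV\<^esub> t) \<otimes>\<^bsub>SV\<^esub> y = y \<otimes>\<^bsub>SV\<^esub> (sym_ideal sV +>\<^bsub>TV\<^esub> t)"
      by auto
    let ?t = "sym_ideal sV +>\<^bsub>TV\<^esub> t"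
    have "sym_gen sV v \<otimes>\<^bsub>SV\<^esub> ?t \<otimes>\<^bsub>SV\<^esub> y = sym_gen sV v \<otimes>\<^bsub>SV\<^esub> y \<otimes>\<^bsub>SV\<^esub> ?t"
      using * y(1) by (simp add: SV.m_assoc)
    also have "\<dots> = y \<otimes>\<^bsub>SV\<^esub> (sym_gen sV v \<otimes>\<^bsub>SV\<^esub> ?t)"
      using * y by (simp add: SV.m_assoc)
    finally show "tens_gen sV v \<otimes>\<^bsub>TV\<^esub> t \<in> ?W"
      using * by (simp add: sproj.hom_mult flip: sym_gen_def)
  qed
  then show ?thesis using x by (auto simp: SV_image)
qed

lemma SV_commute:
  assumes "x \<in> carrier SV" "y \<in> carrier SV"
  shows "x \<otimes>\<^bsub>SV\<^esub> y = y \<otimes>\<^bsub>SV\<^esub> x"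
  by (rule SV_commutant_induct[OF assms(2) _ assms(1)])
    (rule SV_commutant_induct[OF sym_gen_closed sym_gen_commute assms(2), symmetric])

lemma subspace_sym_plus: "submodule (sym_plus sV) ground SV"
  unfolding sym_plus_def by (rule SV.subspace_k_span) auto

end


section \<open>The augmentation of \<open>A\<close>\<close>

locale nil_setting =
  fixes sA :: "'k::field \<Rightarrow> 'a::ring_1 \<Rightarrow> 'a"
    and sV :: "'k \<Rightarrow> 'v::ab_group_add \<Rightarrow> 'v"
    and D :: "'a \<Rightarrow> ('a word \<Rightarrow>\<^sub>0 'k) set"
    and act :: "'a \<Rightarrow> 'v \<Rightarrow> 'v"
    and \<kappa> :: "('v word \<Rightarrow>\<^sub>0 'k) set \<Rightarrow> 'a"
    and \<mm> :: "'a set"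
  assumes k_algebra_A: "k_algebra (type_alg sA)"
    and D_linear: "k_lin_on (type_alg sA) UNIV (tens_alg sA) D"
    and D_one: "D 1 = pure_tensor sA (1, 1)"
    and ideal_mm: "ideal \<mm> (type_alg sA)" and proper_mm: "\<mm> \<noteq> UNIV"
    and nilpotent_mm: "\<exists>n. \<forall>xs. length xs = n \<and> set xs \<subseteq> \<mm> \<longrightarrow> prod_list xs = 0"
    and mm_plus_scalars: "\<mm> <+>\<^bsub>type_alg sA\<^esub> range (\<lambda>c. sA c 1) = UNIV"
    and D_mm: "D ` \<mm> \<subseteq> tensor_square sA \<mm>"
    and act_module: "alg_module sA sV act"
    and \<kappa>_linear: "k_lin_on (tens_alg sV) (wedge_square sV) (type_alg sA) \<kappa>"
    and \<kappa>_mm: "\<kappa> ` wedge_square sV \<subseteq> \<mm>"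
begin

abbreviation "A \<equiv> type_alg sA"

sublocale H_setting sA sV D act \<kappa>
  by unfold_locales
    (use vector_space_type_alg[OF k_algebra_A] act_module in \<open>auto simp: alg_module_def vector_space_def\<close>)

sublocale sym_setting sV .

sublocale alg: kalg A by standard (rule k_algebra_A)
sublocale mm: ideal \<mm> A by (rule ideal_mm)

lemma sA_mult: "sA c a * b = sA c (a * b)" "a * sA c b = sA c (a * b)"
  using alg.smult_left[of a b c] alg.smult_right[of a b c] by simp_all

lemma subspace_mm: "submodule \<mm> ground A"
  by (rule alg.ideal_subspace) (rule ideal_mm)

lemma mm_closed:
  "0 \<in> \<mm>" "a \<in> \<mm> \<Longrightarrow> b \<in> \<mm> \<Longrightarrow> a + b \<in> \<mm>" "a \<in> \<mm> \<Longrightarrow> b \<in> \<mm> \<Longrightarrow> a - b \<in> \<mm>"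
  "a \<in> \<mm> \<Longrightarrow> sA c a \<in> \<mm>" "a \<in> \<mm> \<Longrightarrow> b * a \<in> \<mm>" "a \<in> \<mm> \<Longrightarrow> a * b \<in> \<mm>"
  using alg.subspaceD[OF subspace_mm] mm.I_l_closed[of a b] mm.I_r_closed[of a b] by simp_all

lemma one_not_mm: "1 \<notin> \<mm>"
  using proper_mm mm_closed(5)[of 1] by auto

lemma scalar_mm: "sA c 1 \<in> \<mm> \<Longrightarrow> c = 0"
  using one_not_mm mm_closed(4)[of "sA c 1" "inverse c"] by (cases "c = 0") auto

definition aug :: "'a \<Rightarrow> 'k"
  where "aug a = (THE c. a - sA c 1 \<in> \<mm>)"

lemma aug_unique: "a - sA c 1 \<in> \<mm> \<Longrightarrow> aug a = c"
  unfolding aug_def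
proof (rule the_equality)
  fix d assume "a - sA c 1 \<in> \<mm>" "a - sA d 1 \<in> \<mm>"
  then have "sA (c - d) 1 \<in> \<mm>"
    using mm_closed(3)[of "a - sA d 1" "a - sA c 1"] by (simp add: A.scale_left_diff_distrib)
  then show "d = c" using scalar_mm by fastforce
qed

lemma aug_mm: "a - sA (aug a) 1 \<in> \<mm>"
proof -
  have "a \<in> \<mm> <+>\<^bsub>A\<^esub> range (\<lambda>c. sA c 1)" using mm_plus_scalars by simp
  then obtain b c where "b \<in> \<mm>" "a = b + sA c 1" by (auto simp: set_add_def')
  moreover from this have "aug a = c" by (intro aug_unique) simp
  ultimately show ?thesis by simp
qed

lemma aug_mm_iff: "aug a = 0 \<longleftrightarrow> a \<in> \<mm>"
  using aug_mm[of a] aug_unique[of a 0] by auto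

lemma aug_hom:
  "aug (a + b) = aug a + aug b" "aug (sA c a) = c * aug a" "aug 1 = 1" "aug (a * b) = aug a * aug b"
proof -
  let ?a = "a - sA (aug a) 1" and ?b = "b - sA (aug b) 1"
  have mm: "?a \<in> \<mm>" "?b \<in> \<mm>" by (rule aug_mm)+
  show "aug (a + b) = aug a + aug b"
    using mm_closed(2)[OF mm] by (intro aug_unique) (simp add: A.scale_left_distrib algebra_simps)
  show "aug (sA c a) = c * aug a"
    using mm_closed(4)[OF mm(1), of c] by (intro aug_unique) (simp add: A.scale_right_diff_distrib)
  show "aug 1 = 1"
    by (rule aug_unique) (simp add: mm_closed)
  have "a * b - sA (aug a * aug b) 1 = ?a * b + sA (aug a) ?b"
    by (simp add: algebra_simps sA_mult A.scale_right_diff_distrib)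
  then show "aug (a * b) = aug a * aug b"
    using mm by (intro aug_unique) (simp add: mm_closed)
qed

lemma act_simps:
  "act a (v + v') = act a v + act a v'" "act (a + b) v = act a v + act b v"
  "act (a * b) v = act a (act b v)" "act 1 v = v" "act (sA c a) v = sV c (act a v)"
  "act a (sV c v) = sV c (act a v)"
  using act_module by (auto simp: alg_module_def)

lemma act_zero: "act 0 v = 0"
  using act_simps(5)[of 0 0 v] by simp

lemma sweedler_mm:
  assumes "a \<in> \<mm>"
  obtains xs where "sweedler sA D a xs" "set xs \<subseteq> \<mm> \<times> \<mm>"
proof (rule tensor_square_list_sum[of \<mm> sA "D a"])
  show "D a \<in> tensor_square sA \<mm>" using assms D_mm by auto
qed (use that mm_closed(4) in \<open>auto simp: sweedler_def\<close>)

text \<open>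
  The map \<open>id \<otimes> aug\<close> sends \<open>\<Delta> a\<close> to \<open>aug(a) 1\<close>, since it kills \<open>\<mm> \<otimes> \<mm> \<supseteq> \<Delta> \<mm>\<close> and
  \<open>\<Delta> 1 = 1 \<otimes> 1\<close>; here both sides act on \<open>v\<close>. This is what makes the relation between \<open>A\<close> and \<open>V\<close>
  in \<open>H\<close> hold in \<open>Sym V\<close> after \<open>\<mm>\<close> is killed.
\<close>

lemma sweedler_aug:
  assumes "sweedler sA D a xs"
  shows "(\<Sum>(x, y)\<leftarrow>xs. sV (aug y) (act x v)) = sV (aug a) v"
proof -
  let ?\<beta> = "\<lambda>x y. sV (aug y) (act x v)"
  interpret TA: kalg "tens_alg sA" by standard (rule k_algebra_tens_alg)
  let ?c = "aug a"
  obtain zs where zs: "sweedler sA D (a - sA ?c 1) zs" "set zs \<subseteq> \<mm> \<times> \<mm>"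
    by (rule sweedler_mm[OF aug_mm])
  have "D a = D (sA ?c 1 + (a - sA ?c 1))" by simp
  also have "\<dots> = D (sA ?c 1) \<oplus>\<^bsub>tens_alg sA\<^esub> D (a - sA ?c 1)"
    using D_linear unfolding k_lin_on_def by (metis UNIV_I type_alg_sel(5))
  also have "D (sA ?c 1) = pure_tensor sA (sA ?c 1, 1)"
    using D_linear unfolding k_lin_on_def by (simp add: D_one pure_tensor_smult)
  finally have D_a: "D a = list_sum (tens_alg sA) (pure_tensor sA) ((sA ?c 1, 1) # zs)"
    using zs(1) by (simp add: sweedler_def)
  have "(\<Sum>(x, y)\<leftarrow>xs. ?\<beta> x y) = (\<Sum>(x, y)\<leftarrow>(sA ?c 1, 1) # zs. ?\<beta> x y)"
  proof (rule bilinear_tensor_eq[OF vector_space_sA vector_space_sV])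
    show "list_sum (tens_alg sA) (pure_tensor sA) xs =
        list_sum (tens_alg sA) (pure_tensor sA) ((sA ?c 1, 1) # zs)"
      using D_a assms by (simp add: sweedler_def)
  qed (simp_all add: aug_hom act_simps V.scale_left_distrib V.scale_right_distrib mult.commute)
  also have "\<dots> = sV ?c v + (\<Sum>(x, y)\<leftarrow>zs. ?\<beta> x y)"
    by (simp add: aug_hom act_simps)
  also have "(\<Sum>(x, y)\<leftarrow>zs. ?\<beta> x y) = 0"
    using zs(2)
  proof (induction zs)
    case (Cons t zs)
    then show ?case by (cases t) (simp add: aug_mm_iff[THEN iffD2])
  qed simp
  finally show ?thesis by simp
qed


section \<open>Commutators in \<open>H\<close>\<close>

abbreviation "HH \<equiv> comm_span H (carrier H)"

lemma subspace_HH: "submodule HH ground H"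
  by (rule H.subspace_comm_span) simp

lemmas HH_closed = H.subspaceD[OF subspace_HH]

lemma HH_carrier: "x \<in> HH \<Longrightarrow> x \<in> carrier H"
  using HH_closed(1) by auto

lemma HH_swap:
  assumes "x \<in> carrier H" "y \<in> carrier H" "x \<otimes>\<^bsub>H\<^esub> y \<in> HH"
  shows "y \<otimes>\<^bsub>H\<^esub> x \<in> HH"
proof -
  have "y \<otimes>\<^bsub>H\<^esub> x \<ominus>\<^bsub>H\<^esub> x \<otimes>\<^bsub>H\<^esub> y \<in> HH"
    using assms by (intro H.comm_span_memI)
  then have "(y \<otimes>\<^bsub>H\<^esub> x \<ominus>\<^bsub>H\<^esub> x \<otimes>\<^bsub>H\<^esub> y) \<oplus>\<^bsub>H\<^esub> x \<otimes>\<^bsub>H\<^esub> y \<in> HH"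
    using assms(3) by (rule HH_closed)
  then show ?thesis
    using assms by (simp add: a_minus_def H.a_assoc H.l_neg)
qed

lemma left_mult_subspace:
  assumes "submodule W ground H" "y \<in> carrier H"
  shows "submodule {x \<in> carrier H. y \<otimes>\<^bsub>H\<^esub> x \<in> W} ground H"
  using assms H.subspaceD[OF assms(1)]
  by (intro H.subspaceI) (auto simp: H.r_distr H.smult_right)

lemma right_mult_subspace:
  assumes "submodule W ground H" "y \<in> carrier H"
  shows "submodule {x \<in> carrier H. x \<otimes>\<^bsub>H\<^esub> y \<in> W} ground H"
  using assms H.subspaceD[OF assms(1)]
  by (intro H.subspaceI) (auto simp: H.l_distr H.smult_left)

text \<open>
  The algebra map from the tensor algebra of \<open>V\<close> to \<open>H\<close>; it exists by \<open>tens_alg_lift\<close> and is unique on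
  the carrier.
\<close>

definition \<tau> :: "('v word \<Rightarrow>\<^sub>0 'k) set \<Rightarrow> (('v \<times> 'a) word \<Rightarrow>\<^sub>0 'k) set set"
  where "\<tau> = (SOME f. f \<in> k_alg_hom TV H \<and> (\<forall>v. f (tens_gen sV v) = hV v))"

lemma \<tau>: "\<tau> \<in> k_alg_hom TV H" "\<tau> (tens_gen sV v) = hV v"
proof -
  have "\<exists>f. f \<in> k_alg_hom TV H \<and> (\<forall>v. f (tens_gen sV v) = hV v)"
    using tens_alg_lift[OF H.k_algebra, of hV sV] by (metis H_gen_closed(1) H_gen_linear(1,2))
  then have "\<tau> \<in> k_alg_hom TV H \<and> (\<forall>v. \<tau> (tens_gen sV v) = hV v)"
    unfolding \<tau>_def by (rule someI_ex)
  then show "\<tau> \<in> k_alg_hom TV H" "\<tau> (tens_gen sV v) = hV v" by auto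
qed

sublocale \<tau>: kalg_hom TV H \<tau> by standard (rule \<tau>(1))

text \<open>
  The normal forms of products of letters with an element of \<open>\<mm>\<close>: by \<open>hA_tensor_VM\<close> below, that element
  can be moved to the right end.
\<close>

definition VM where "VM = k_span H {\<tau> t \<otimes>\<^bsub>H\<^esub> hA a | t a. t \<in> carrier TV \<and> a \<in> \<mm>}"

lemma subspace_VM: "submodule VM ground H"
  unfolding VM_def by (rule H.subspace_k_span) (auto simp: \<tau>.hom_closed)

lemmas VM_closed = H.subspaceD[OF subspace_VM]

lemma VM_memI: "t \<in> carrier TV \<Longrightarrow> a \<in> \<mm> \<Longrightarrow> \<tau> t \<otimes>\<^bsub>H\<^esub> hA a \<in> VM"
  unfolding VM_def by (rule subsetD[OF H.k_span_superset]) auto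

lemma VM_least:
  assumes "submodule W ground H" "\<And>t a. t \<in> carrier TV \<Longrightarrow> a \<in> \<mm> \<Longrightarrow> \<tau> t \<otimes>\<^bsub>H\<^esub> hA a \<in> W"
  shows "VM \<subseteq> W"
  unfolding VM_def by (rule H.k_span_least) (use assms in auto)

lemma hV_VM: "x \<in> VM \<Longrightarrow> hV v \<otimes>\<^bsub>H\<^esub> x \<in> VM"
proof -
  have "VM \<subseteq> {x \<in> carrier H. hV v \<otimes>\<^bsub>H\<^esub> x \<in> VM}"
  proof (rule VM_least[OF left_mult_subspace[OF subspace_VM]])
    fix t a assume *: "t \<in> carrier TV" "a \<in> \<mm>"
    then have "hV v \<otimes>\<^bsub>H\<^esub> (\<tau> t \<otimes>\<^bsub>H\<^esub> hA a) = \<tau> (tens_gen sV v \<otimes>\<^bsub>TV\<^esub> t) \<otimes>\<^bsub>H\<^esub> hA a"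
      by (simp add: \<tau>.hom_mult \<tau> H.m_assoc \<tau>.hom_closed)
    then show "\<tau> t \<otimes>\<^bsub>H\<^esub> hA a \<in> {x \<in> carrier H. hV v \<otimes>\<^bsub>H\<^esub> x \<in> VM}"
      using * by (simp add: VM_memI \<tau>.hom_closed)
  qed simp
  then show "x \<in> VM \<Longrightarrow> hV v \<otimes>\<^bsub>H\<^esub> x \<in> VM" by auto
qed

lemma VM_hA: "x \<in> VM \<Longrightarrow> x \<otimes>\<^bsub>H\<^esub> hA b \<in> VM"
proof -
  have "VM \<subseteq> {x \<in> carrier H. x \<otimes>\<^bsub>H\<^esub> hA b \<in> VM}"
    by (rule VM_least[OF right_mult_subspace[OF subspace_VM]])
      (auto simp: H.m_assoc \<tau>.hom_closed hA_mult intro!: VM_memI mm_closed)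
  then show "x \<in> VM \<Longrightarrow> x \<otimes>\<^bsub>H\<^esub> hA b \<in> VM" by auto
qed

text \<open>
  The relation \<open>a v = \<Sum> a\<^sub>1(v) a\<^sub>2\<close> moves an element of \<open>\<mm>\<close> past a letter and leaves \<open>a\<^sub>2 \<in> \<mm>\<close> behind it.
\<close>

lemma hA_tensor_VM:
  assumes "a \<in> \<mm>" "t \<in> carrier TV"
  shows "hA a \<otimes>\<^bsub>H\<^esub> \<tau> t \<in> VM"
proof -
  have "carrier TV \<subseteq> {t \<in> carrier TV. \<forall>a\<in>\<mm>. hA a \<otimes>\<^bsub>H\<^esub> \<tau> t \<in> VM}" (is "_ \<subseteq> ?W")
  proof (rule tens_alg_left_induct)
    show "submodule ?W ground TV"
      using VM_closed(2,3,4)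
      by (intro TV.subspaceI)
        (auto simp: \<tau>.hom_zero \<tau>.hom_add \<tau>.hom_smult H.r_distr H.smult_right \<tau>.hom_closed)
    show "\<one>\<^bsub>TV\<^esub> \<in> ?W"
      using VM_memI[OF TV.one_closed] by (simp add: \<tau>.hom_one)
    fix v t assume t: "t \<in> ?W"
    have "hA a \<otimes>\<^bsub>H\<^esub> \<tau> (tens_gen sV v \<otimes>\<^bsub>TV\<^esub> t) \<in> VM" if a: "a \<in> \<mm>" for a
    proof -
      obtain xs where xs: "sweedler sA D a xs" "set xs \<subseteq> \<mm> \<times> \<mm>"
        by (rule sweedler_mm[OF a])
      have "hA a \<otimes>\<^bsub>H\<^esub> \<tau> (tens_gen sV v \<otimes>\<^bsub>TV\<^esub> t) = (hA a \<otimes>\<^bsub>H\<^esub> hV v) \<otimes>\<^bsub>H\<^esub> \<tau> t"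
        using t by (simp add: \<tau>.hom_mult \<tau> H.m_assoc \<tau>.hom_closed)
      also have "\<dots> = list_sum H (\<lambda>(x, y). hV (act x v) \<otimes>\<^bsub>H\<^esub> (hA y \<otimes>\<^bsub>H\<^esub> \<tau> t)) xs"
        using t unfolding hA_hV[OF xs(1)]
        by (subst H.list_sum_mult_right)
          (auto intro!: list_sum_cong simp: H.m_assoc \<tau>.hom_closed)
      also have "\<dots> \<in> VM"
        using xs(2) t by (intro H.list_sum_mem[OF subspace_VM]) (auto intro!: hV_VM)
      finally show ?thesis .
    qed
    then show "tens_gen sV v \<otimes>\<^bsub>TV\<^esub> t \<in> ?W" using t by auto
  qed
  then show ?thesis using assms by auto
qed

text \<open>
  Modulo commutators, \<open>w t a\<close> with \<open>w \<in> V\<close> equals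
  \<open>a w t = \<Sum> a\<^sub>1(w) a\<^sub>2 t\<close>, which is a sum of terms \<open>a\<^sub>1(w) t' a'\<close> with \<open>a\<^sub>1, a' \<in> \<mm>\<close>. So the first
  letter can be moved ever deeper into \<open>\<mm>\<^sup>k V\<close>, which vanishes for large \<open>k\<close>.
\<close>

lemma hV_tensor_hA_HH:
  assumes "a \<in> \<mm>" "t \<in> carrier TV"
  shows "hV v \<otimes>\<^bsub>H\<^esub> \<tau> t \<otimes>\<^bsub>H\<^esub> hA a \<in> HH"
proof -
  obtain n where n: "\<And>xs. length xs = n \<Longrightarrow> set xs \<subseteq> \<mm> \<Longrightarrow> prod_list xs = 0"
    using nilpotent_mm by blast
  define P where "P k \<longleftrightarrow> (\<forall>bs u t a. length bs = k \<and> set bs \<subseteq> \<mm> \<and> t \<in> carrier TV \<and> a \<in> \<mm> \<longrightarrow>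
    hV (act (prod_list bs) u) \<otimes>\<^bsub>H\<^esub> \<tau> t \<otimes>\<^bsub>H\<^esub> hA a \<in> HH)" for k
  \<comment> \<open>Downward induction: \<open>P k\<close> concerns first letters in \<open>\<mm>\<^sup>k V\<close>, and \<open>\<mm>\<^sup>n = 0\<close> gives \<open>P n\<close>.\<close>
  have "P 0"
  proof (rule inc_induct[of 0 n P])
    show "P n"
      unfolding P_def using n HH_closed(2) by (auto simp: act_zero hV_zero \<tau>.hom_closed)
  next
    fix k assume IH: "P (Suc k)"
    show "P k"
      unfolding P_def
    proof (intro allI impI, elim conjE)
      fix bs u t a assume *: "length bs = k" "set bs \<subseteq> \<mm>" "t \<in> carrier TV" "a \<in> \<mm>"
      define w where "w = act (prod_list bs) u"
      obtain xs where xs: "sweedler sA D a xs" "set xs \<subseteq> \<mm> \<times> \<mm>"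
        by (rule sweedler_mm[OF *(4)])
      have VM_HH: "hV (act x w) \<otimes>\<^bsub>H\<^esub> z \<in> HH" if "x \<in> \<mm>" "z \<in> VM" for x z
      proof -
        have "VM \<subseteq> {z \<in> carrier H. hV (act x w) \<otimes>\<^bsub>H\<^esub> z \<in> HH}"
        proof (rule VM_least[OF left_mult_subspace[OF subspace_HH]])
          fix t' a' assume "t' \<in> carrier TV" "a' \<in> \<mm>"
          moreover from this have "hV (act (prod_list (x # bs)) u) \<otimes>\<^bsub>H\<^esub> \<tau> t' \<otimes>\<^bsub>H\<^esub> hA a' \<in> HH"
            using IH * that(1) unfolding P_def by (intro IH[unfolded P_def, rule_format]) auto
          ultimately show "\<tau> t' \<otimes>\<^bsub>H\<^esub> hA a' \<in> {z \<in> carrier H. hV (act x w) \<otimes>\<^bsub>H\<^esub> z \<in> HH}"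
            by (simp add: H.m_assoc \<tau>.hom_closed w_def act_simps)
        qed simp
        then show ?thesis using that by auto
      qed
      have "hA a \<otimes>\<^bsub>H\<^esub> (hV w \<otimes>\<^bsub>H\<^esub> \<tau> t) = (hA a \<otimes>\<^bsub>H\<^esub> hV w) \<otimes>\<^bsub>H\<^esub> \<tau> t"
        using * by (simp add: H.m_assoc \<tau>.hom_closed)
      also have "\<dots> = list_sum H (\<lambda>(x, y). hV (act x w) \<otimes>\<^bsub>H\<^esub> (hA y \<otimes>\<^bsub>H\<^esub> \<tau> t)) xs"
        using * unfolding hA_hV[OF xs(1)]
        by (subst H.list_sum_mult_right)
          (auto intro!: list_sum_cong simp: H.m_assoc \<tau>.hom_closed)
      also have "\<dots> \<in> HH"
        using xs(2) *(3)
        by (intro H.list_sum_mem[OF subspace_HH]) (auto intro!: VM_HH hA_tensor_VM)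
      finally show "hV (act (prod_list bs) u) \<otimes>\<^bsub>H\<^esub> \<tau> t \<otimes>\<^bsub>H\<^esub> hA a \<in> HH"
        using * by (intro HH_swap[of "hA a"]) (auto simp: w_def \<tau>.hom_closed)
    qed
  qed simp
  then have "hV (act (prod_list []) v) \<otimes>\<^bsub>H\<^esub> \<tau> t \<otimes>\<^bsub>H\<^esub> hA a \<in> HH"
    unfolding P_def by (elim allE[of _ "[]"] allE[of _ v] allE[of _ t] allE[of _ a]) (simp add: assms)
  then show ?thesis by (simp add: act_simps)
qed

lemma hA_hV_tensor_HH:
  assumes "a \<in> \<mm>" "t \<in> carrier TV"
  shows "hA a \<otimes>\<^bsub>H\<^esub> (hV v \<otimes>\<^bsub>H\<^esub> \<tau> t) \<in> HH"
  by (rule HH_swap[OF _ _ hV_tensor_hA_HH[OF assms]]) (use assms in \<open>auto simp: \<tau>.hom_closed\<close>)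

text \<open>Elements of \<open>T(V)\<close> are a scalar plus a combination of words with a first letter.\<close>

lemma tensor_first_letter_induct:
  assumes "submodule W ground TV" "\<one>\<^bsub>TV\<^esub> \<in> W"
    "\<And>v t. t \<in> carrier TV \<Longrightarrow> tens_gen sV v \<otimes>\<^bsub>TV\<^esub> t \<in> W"
  shows "carrier TV \<subseteq> W"
  by (rule tens_alg_left_induct[OF assms(1,2)])
    (use assms(3) TV.subspaceD(1)[OF assms(1)] in auto)

lemma hA_\<kappa>_HH: "hA (\<kappa> (wedge sV v v')) \<in> HH"
  unfolding hV_commutator[symmetric] by (rule H.comm_span_memI) auto

lemma wedge_mem: "wedge sV v v' \<in> wedge_square sV"
  unfolding wedge_square_def by (rule subsetD[OF TV.k_span_superset]) auto

lemma \<kappa>_wedge_mm: "\<kappa> (wedge sV v v') \<in> \<mm>"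
  using \<kappa>_mm wedge_mem by auto

text \<open>
  For scalar \<open>t\<close> this holds because \<open>\<kappa>(v, v')\<close> is the commutator of \<open>v\<close> and \<open>v'\<close>; for longer words,
  because \<open>\<kappa>(v, v') \<in> \<mm>\<close>.
\<close>

lemma hA_\<kappa>_tensor_HH:
  assumes "t \<in> carrier TV"
  shows "hA (\<kappa> (wedge sV v v')) \<otimes>\<^bsub>H\<^esub> \<tau> t \<in> HH"
proof -
  let ?k = "hA (\<kappa> (wedge sV v v'))"
  have "carrier TV \<subseteq> {t \<in> carrier TV. \<tau> t \<in> {x \<in> carrier H. ?k \<otimes>\<^bsub>H\<^esub> x \<in> HH}}"
    by (rule tensor_first_letter_induct[OF \<tau>.subspace_vimage[OF left_mult_subspace[OF subspace_HH]]])
      (auto simp: \<tau>.hom_one \<tau>.hom_mult \<tau> \<tau>.hom_closed hA_\<kappa>_HH hA_hV_tensor_HH \<kappa>_wedge_mm)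
  then show ?thesis using assms by auto
qed

text \<open>
  Modulo commutators words may be rotated, which turns \<open>y \<kappa>(v, v') z\<close> into \<open>\<kappa>(v, v') z y\<close>. Hence
  words in \<open>V\<close> depend, modulo commutators, only on their class in the symmetric algebra.
\<close>

lemma sym_ideal_HH:
  assumes "t \<in> sym_ideal sV"
  shows "\<tau> t \<in> HH"
proof -
  let ?K = "{t \<in> carrier TV. \<forall>y\<in>carrier TV. \<forall>z\<in>carrier TV. \<tau> y \<otimes>\<^bsub>H\<^esub> \<tau> t \<otimes>\<^bsub>H\<^esub> \<tau> z \<in> HH}"
  have "ideal ?K TV"
  proof (rule TV.ideal_of_subspace)
    show "submodule ?K ground TV"
      using HH_closed(2,3,4)
      by (intro TV.subspaceI)
        (auto simp: \<tau>.hom_zero \<tau>.hom_add \<tau>.hom_smult H.r_distr H.l_distr H.smult_right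
          H.smult_left \<tau>.hom_closed)
    fix x t assume *: "x \<in> carrier TV" "t \<in> ?K"
    have "\<tau> y \<otimes>\<^bsub>H\<^esub> \<tau> (x \<otimes>\<^bsub>TV\<^esub> t) \<otimes>\<^bsub>H\<^esub> \<tau> z \<in> HH"
      "\<tau> y \<otimes>\<^bsub>H\<^esub> \<tau> (t \<otimes>\<^bsub>TV\<^esub> x) \<otimes>\<^bsub>H\<^esub> \<tau> z \<in> HH"
      if "y \<in> carrier TV" "z \<in> carrier TV" for y z
    proof -
      have "\<tau> (y \<otimes>\<^bsub>TV\<^esub> x) \<otimes>\<^bsub>H\<^esub> \<tau> t \<otimes>\<^bsub>H\<^esub> \<tau> z \<in> HH" "\<tau> y \<otimes>\<^bsub>H\<^esub> \<tau> t \<otimes>\<^bsub>H\<^esub> \<tau> (x \<otimes>\<^bsub>TV\<^esub> z) \<in> HH"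
        using * that by auto
      then show "\<tau> y \<otimes>\<^bsub>H\<^esub> \<tau> (x \<otimes>\<^bsub>TV\<^esub> t) \<otimes>\<^bsub>H\<^esub> \<tau> z \<in> HH"
        "\<tau> y \<otimes>\<^bsub>H\<^esub> \<tau> (t \<otimes>\<^bsub>TV\<^esub> x) \<otimes>\<^bsub>H\<^esub> \<tau> z \<in> HH"
        using * that by (simp_all add: \<tau>.hom_mult \<tau>.hom_closed H.m_assoc)
    qed
    then show "x \<otimes>\<^bsub>TV\<^esub> t \<in> ?K" "t \<otimes>\<^bsub>TV\<^esub> x \<in> ?K"
      using * by simp_all
  qed
  moreover have "wedge sV v v' \<in> ?K" for v v'
  proof -
    have eq: "\<tau> (wedge sV v v') = hA (\<kappa> (wedge sV v v'))" (is "_ = ?k")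
      unfolding hV_commutator[symmetric]
      by (simp add: wedge_def pure_tensor_def \<tau>.hom_minus \<tau>.hom_mult \<tau>)
    have "\<tau> y \<otimes>\<^bsub>H\<^esub> ?k \<otimes>\<^bsub>H\<^esub> \<tau> z \<in> HH" if "y \<in> carrier TV" "z \<in> carrier TV" for y z
    proof -
      have "(?k \<otimes>\<^bsub>H\<^esub> \<tau> z) \<otimes>\<^bsub>H\<^esub> \<tau> y \<in> HH"
        using hA_\<kappa>_tensor_HH[of "z \<otimes>\<^bsub>TV\<^esub> y"] that
        by (simp add: \<tau>.hom_mult \<tau>.hom_closed H.m_assoc)
      then have "\<tau> y \<otimes>\<^bsub>H\<^esub> (?k \<otimes>\<^bsub>H\<^esub> \<tau> z) \<in> HH"
        by (rule HH_swap[rotated 2]) (use that in \<open>auto simp: \<tau>.hom_closed\<close>)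
      then show ?thesis using that by (simp add: \<tau>.hom_closed H.m_assoc)
    qed
    then show ?thesis by (simp add: eq)
  qed
  ultimately have "sym_ideal sV \<subseteq> ?K"
    unfolding sym_ideal_def by (intro TV.genideal_minimal) auto
  then have "\<tau> \<one>\<^bsub>TV\<^esub> \<otimes>\<^bsub>H\<^esub> \<tau> t \<otimes>\<^bsub>H\<^esub> \<tau> \<one>\<^bsub>TV\<^esub> \<in> HH" "t \<in> carrier TV"
    using assms TV.one_closed by blast+
  then show ?thesis by (simp add: \<tau>.hom_one \<tau>.hom_closed)
qed

lemma subspace_hA_image: "submodule W ground A \<Longrightarrow> submodule (hA ` W) ground H"
proof (rule H.subspaceI)
  assume "submodule W ground A"
  note W = alg.subspaceD[OF this, simplified]
  show "\<zero>\<^bsub>H\<^esub> \<in> hA ` W" using W(2) H_gen_linear(4)[of 0 0] by (metis A.scale_zero_left H.zero_smult H_gen_closed(2) imageI)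
  show "x \<oplus>\<^bsub>H\<^esub> y \<in> hA ` W" if "x \<in> hA ` W" "y \<in> hA ` W" for x y
    using that W by (auto simp flip: H_gen_linear)
  show "c \<odot>\<^bsub>H\<^esub> x \<in> hA ` W" if "x \<in> hA ` W" for x c
    using that W by (auto simp flip: H_gen_linear)
qed auto

lemma subspace_\<tau>_image: "submodule (\<tau> ` carrier TV) ground H"
proof (rule H.subspaceI)
  show "\<zero>\<^bsub>H\<^esub> \<in> \<tau> ` carrier TV" using \<tau>.hom_zero TV.zero_closed by (metis imageI)
  show "x \<oplus>\<^bsub>H\<^esub> y \<in> \<tau> ` carrier TV" if "x \<in> \<tau> ` carrier TV" "y \<in> \<tau> ` carrier TV" for x y
    using that by (auto simp flip: \<tau>.hom_add)
  show "c \<odot>\<^bsub>H\<^esub> x \<in> \<tau> ` carrier TV" if "x \<in> \<tau> ` carrier TV" for x c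
    using that by (auto simp flip: \<tau>.hom_smult)
qed (auto simp: \<tau>.hom_closed)

lemma H_eq_tensor_VM: "carrier H \<subseteq> \<tau> ` carrier TV <+>\<^bsub>H\<^esub> VM"
proof (rule H_left_induct)
  let ?W = "\<tau> ` carrier TV <+>\<^bsub>H\<^esub> VM"
  show W: "submodule ?W ground H"
    by (rule H.subspace_sum[OF subspace_\<tau>_image subspace_VM])
  note W_closed = H.subspaceD[OF W]
  note sup = H.subspace_sum_superset[OF subspace_\<tau>_image subspace_VM]
  have \<tau>_W: "\<tau> t \<in> ?W" if "t \<in> carrier TV" for t using sup that by auto
  show "\<one>\<^bsub>H\<^esub> \<in> ?W" using \<tau>_W[OF TV.one_closed] by (simp add: \<tau>.hom_one)
  show "hV v \<otimes>\<^bsub>H\<^esub> x \<in> ?W" if "x \<in> ?W" for v x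
  proof -
    from that obtain t y where x: "x = \<tau> t \<oplus>\<^bsub>H\<^esub> y" and *: "t \<in> carrier TV" "y \<in> VM"
      by (auto simp: set_add_def')
    have "hV v \<otimes>\<^bsub>H\<^esub> x = \<tau> (tens_gen sV v \<otimes>\<^bsub>TV\<^esub> t) \<oplus>\<^bsub>H\<^esub> hV v \<otimes>\<^bsub>H\<^esub> y"
      using * VM_closed(1) by (auto simp: x \<tau>.hom_mult \<tau> H.r_distr \<tau>.hom_closed)
    then show ?thesis using * by (auto intro!: H.set_add_memI hV_VM)
  qed
  have mm: "hA a \<otimes>\<^bsub>H\<^esub> x \<in> VM" if "x \<in> ?W" "a \<in> \<mm>" for a x
  proof -
    have "?W \<subseteq> {x \<in> carrier H. hA a \<otimes>\<^bsub>H\<^esub> x \<in> VM}"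
    proof (rule H.subspace_sum_least[OF left_mult_subspace[OF subspace_VM]])
      show "\<tau> ` carrier TV \<subseteq> {x \<in> carrier H. hA a \<otimes>\<^bsub>H\<^esub> x \<in> VM}"
        using that(2) by (auto simp: \<tau>.hom_closed hA_tensor_VM)
      show "VM \<subseteq> {x \<in> carrier H. hA a \<otimes>\<^bsub>H\<^esub> x \<in> VM}"
        by (rule VM_least[OF left_mult_subspace[OF subspace_VM]])
          (use that(2) in \<open>auto simp: \<tau>.hom_closed VM_hA hA_tensor_VM simp flip: H.m_assoc\<close>)
    qed simp
    then show ?thesis using that(1) by auto
  qed
  show "hA a \<otimes>\<^bsub>H\<^esub> x \<in> ?W" if "x \<in> ?W" for a x
  proof -
    have x: "x \<in> carrier H" using W_closed(1) that by auto
    have "hA a = hA ((a - sA (aug a) 1) + sA (aug a) 1)" by simp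
    also have "\<dots> = hA (a - sA (aug a) 1) \<oplus>\<^bsub>H\<^esub> aug a \<odot>\<^bsub>H\<^esub> \<one>\<^bsub>H\<^esub>"
      unfolding H_gen_linear hA_one ..
    finally have "hA a \<otimes>\<^bsub>H\<^esub> x = hA (a - sA (aug a) 1) \<otimes>\<^bsub>H\<^esub> x \<oplus>\<^bsub>H\<^esub> aug a \<odot>\<^bsub>H\<^esub> x"
      using x by (simp add: H.l_distr H.smult_left)
    moreover have "hA (a - sA (aug a) 1) \<otimes>\<^bsub>H\<^esub> x \<in> ?W"
      using mm[OF that aug_mm] by (rule subsetD[OF sup(2)])
    ultimately show ?thesis using W_closed(3)[OF _ W_closed(4)[OF that]] by simp
  qed
qed

lemma VM_sub: "VM \<subseteq> hA ` \<mm> <+>\<^bsub>H\<^esub> HH"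
proof -
  let ?W = "hA ` \<mm> <+>\<^bsub>H\<^esub> HH"
  have W: "submodule ?W ground H"
    by (rule H.subspace_sum[OF subspace_hA_image[OF subspace_mm] subspace_HH])
  note sup = H.subspace_sum_superset[OF subspace_hA_image[OF subspace_mm] subspace_HH]
  show ?thesis
  proof (rule VM_least[OF W])
    fix t a assume "t \<in> carrier TV" "a \<in> \<mm>"
    moreover have "carrier TV \<subseteq> {t \<in> carrier TV. \<tau> t \<in> {x \<in> carrier H. x \<otimes>\<^bsub>H\<^esub> hA a \<in> ?W}}" if "a \<in> \<mm>"
      by (rule tensor_first_letter_induct[OF \<tau>.subspace_vimage[OF right_mult_subspace[OF W]]])
        (use sup that hV_tensor_hA_HH[OF that] in
          \<open>auto simp: \<tau>.hom_one \<tau>.hom_mult \<tau> \<tau>.hom_closed\<close>)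
    ultimately show "\<tau> t \<otimes>\<^bsub>H\<^esub> hA a \<in> ?W" by auto
  qed
qed

text \<open>
  The spanning set of \<open>H / [H, H]\<close>: in \<open>T(V) + T(V) \<mm>\<close>, the words of positive length that are followed
  by an element of \<open>\<mm>\<close> are sums of commutators.
\<close>

lemma H_decompose:
  assumes "x \<in> carrier H"
  obtains t a h where "t \<in> carrier TV" "a \<in> \<mm>" "h \<in> HH" "x = \<tau> t \<oplus>\<^bsub>H\<^esub> (hA a \<oplus>\<^bsub>H\<^esub> h)"
proof -
  obtain t y where "t \<in> carrier TV" "y \<in> VM" "x = \<tau> t \<oplus>\<^bsub>H\<^esub> y"
    using H_eq_tensor_VM assms unfolding set_add_def' by blast
  moreover from this obtain a h where "a \<in> \<mm>" "h \<in> HH" "y = hA a \<oplus>\<^bsub>H\<^esub> h"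
    using VM_sub unfolding set_add_def' by blast
  ultimately show thesis using that by blast
qed

text \<open>The ideal of \<open>A\<close> generated by the image of \<open>\<kappa>\<close>, and the subspace to be divided out of \<open>\<mm>\<close>.\<close>

definition K where "K = k_span A {a * \<kappa> t * b | a t b. t \<in> wedge_square sV}"

definition N where "N = comm_span A \<mm> <+>\<^bsub>A\<^esub> K"

lemma ideal_K: "ideal K A"
proof (rule alg.ideal_of_subspace)
  let ?Y = "{a * \<kappa> t * b | a t b. t \<in> wedge_square sV}"
  show sub: "submodule K ground A"
    unfolding K_def by (rule alg.subspace_k_span) simp
  note closed = alg.subspaceD[OF sub, simplified]
  have mem: "a * \<kappa> t * b \<in> K" if "t \<in> wedge_square sV" for a t b
    unfolding K_def by (rule subsetD[OF alg.k_span_superset]) (use that in auto)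
  fix x y assume y: "y \<in> K"
  have "K \<subseteq> {y. x * y \<in> K \<and> y * x \<in> K}"
    unfolding K_def
  proof (rule alg.k_span_least)
    show "submodule {y. x * y \<in> k_span A ?Y \<and> y * x \<in> k_span A ?Y} ground A"
      unfolding K_def[symmetric]
      by (rule alg.subspaceI) (use closed in \<open>auto simp: distrib_left distrib_right sA_mult\<close>)
    show "?Y \<subseteq> {y. x * y \<in> k_span A ?Y \<and> y * x \<in> k_span A ?Y}"
    proof safe
      fix a t b assume "t \<in> wedge_square sV"
      then show "x * (a * \<kappa> t * b) \<in> k_span A ?Y" "a * \<kappa> t * b * x \<in> k_span A ?Y"
        using mem[of t "x * a" b] mem[of t a "b * x"] by (simp_all add: mult.assoc K_def)
    qed
  qed
  then show "x \<otimes>\<^bsub>A\<^esub> y \<in> K" "y \<otimes>\<^bsub>A\<^esub> x \<in> K" using y by auto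
qed

lemma subspace_K: "submodule K ground A"
  by (rule alg.ideal_subspace[OF ideal_K])

lemma subspace_N: "submodule N ground A"
  unfolding N_def by (rule alg.subspace_sum[OF alg.subspace_comm_span subspace_K]) simp

lemma N_superset: "comm_span A \<mm> \<subseteq> N" "K \<subseteq> N"
  unfolding N_def by (rule alg.subspace_sum_superset[OF alg.subspace_comm_span subspace_K]; simp)+

lemma N_mm: "N \<subseteq> \<mm>"
  unfolding N_def
proof (rule alg.subspace_sum_least[OF subspace_mm])
  show "comm_span A \<mm> \<subseteq> \<mm>"
    by (rule alg.comm_span_least[OF subspace_mm]) (auto intro: mm_closed)
  show "K \<subseteq> \<mm>"
    unfolding K_def by (rule alg.k_span_least[OF subspace_mm]) (use \<kappa>_mm in \<open>auto intro: mm_closed\<close>)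
qed

lemma \<kappa>_wedge_K: "\<kappa> (wedge sV v v') \<in> K"
  unfolding K_def
  by (rule subsetD[OF alg.k_span_superset]) (use wedge_mem in \<open>force intro: exI[of _ 1]\<close>)

interpretation hA: kalg_hom A H hA
  by standard (rule hA_hom)

lemma hA_diff: "hA (a - b) = hA a \<ominus>\<^bsub>H\<^esub> hA b"
  using hA.hom_minus[of a b] by simp

text \<open>
  If \<open>c\<close> is a scalar, this is a multiple of a commutator. If \<open>c \<in> \<mm>\<close>, then
  \<open>c \<kappa>(v, v') = c v v' - c v' v\<close> is a difference of elements that are already known to be sums of
  commutators.
\<close>

lemma hA_mult_\<kappa>_HH: "hA (c * \<kappa> (wedge sV v v')) \<in> HH"
proof -
  let ?k = "\<kappa> (wedge sV v v')" and ?c = "c - sA (aug c) 1"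
  have word: "hA ?c \<otimes>\<^bsub>H\<^esub> (hV v \<otimes>\<^bsub>H\<^esub> hV v') \<in> HH" for v v'
    using hA_hV_tensor_HH[OF aug_mm, of "tens_gen sV v'" c v] by (simp add: \<tau>)
  have "hA (?c * ?k) = hA ?c \<otimes>\<^bsub>H\<^esub> (hV v \<otimes>\<^bsub>H\<^esub> hV v' \<ominus>\<^bsub>H\<^esub> hV v' \<otimes>\<^bsub>H\<^esub> hV v)"
    by (simp add: hV_commutator hA_mult)
  also have "\<dots> = hA ?c \<otimes>\<^bsub>H\<^esub> (hV v \<otimes>\<^bsub>H\<^esub> hV v') \<ominus>\<^bsub>H\<^esub> hA ?c \<otimes>\<^bsub>H\<^esub> (hV v' \<otimes>\<^bsub>H\<^esub> hV v)"
    by (simp add: a_minus_def H.r_distr H.r_minus)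
  also have "\<dots> \<in> HH" using word by (intro HH_closed)
  finally have "hA (?c * ?k) \<in> HH" .
  moreover have "c * ?k = ?c * ?k + sA (aug c) ?k"
    by (simp add: algebra_simps sA_mult)
  ultimately show ?thesis
    using HH_closed(3,4) hA_\<kappa>_HH by (metis H_gen_linear(3,4))
qed

lemma hA_N_HH: "a \<in> N \<Longrightarrow> hA a \<in> HH"
proof -
  have vimage: "submodule {a \<in> carrier A. hA a \<in> HH} ground A"
    by (rule hA.subspace_vimage[OF subspace_HH])
  have "a * \<kappa> t * b \<in> {a \<in> carrier A. hA a \<in> HH}" if "t \<in> wedge_square sV" for a t b
  proof -
    note lin = \<kappa>_linear[unfolded k_lin_on_def, simplified]
    have sub: "submodule (wedge_square sV) ground TV"
      unfolding wedge_square_def by (rule TV.subspace_k_span) auto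
    note closed = TV.subspaceD[OF sub]
    have "\<kappa> \<zero>\<^bsub>TV\<^esub> = 0"
      using lin closed(2) TV.smult_zero[of 0] A.scale_zero_left by metis
    then have "submodule {t \<in> wedge_square sV. hA (a * \<kappa> t * b) \<in> HH} ground TV"
      using closed lin HH_closed hA.hom_zero
      by (intro TV.subspaceI)
        (auto simp: distrib_left distrib_right sA_mult H_gen_linear)
    moreover have "hA (a * \<kappa> (wedge sV v v') * b) \<in> HH" for v v'
      using HH_swap[of "hA b" "hA (a * \<kappa> (wedge sV v v'))"] hA_mult_\<kappa>_HH[of "b * a"]
      by (simp add: hA_mult mult.assoc)
    ultimately have "wedge_square sV \<subseteq> {t \<in> wedge_square sV. hA (a * \<kappa> t * b) \<in> HH}"
      by (subst wedge_square_def, intro TV.k_span_least) (use wedge_mem in blast)+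
    then show ?thesis using that by auto
  qed
  moreover have "x * y - y * x \<in> {a \<in> carrier A. hA a \<in> HH}" for x y
    using H.comm_span_memI[of "hA x" "carrier H" "hA y"]
    by (simp add: hA_diff hA_mult)
  ultimately have "N \<subseteq> {a \<in> carrier A. hA a \<in> HH}"
    unfolding N_def K_def
    by (intro alg.subspace_sum_least[OF vimage] alg.comm_span_least[OF vimage]
        alg.k_span_least[OF vimage]) auto
  then show "a \<in> N \<Longrightarrow> hA a \<in> HH" by auto
qed


section \<open>Two quotients of \<open>H\<close>\<close>

interpretation AK: kalg "quot_alg A K"
  by standard (rule alg.k_algebra_quot[OF ideal_K])

interpretation Aproj: kalg_hom A "quot_alg A K" "\<lambda>a. K +>\<^bsub>A\<^esub> a"
  by standard (rule alg.quot_proj_hom[OF ideal_K])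

lemma K_closed: "0 \<in> K" "a \<in> K \<Longrightarrow> b \<in> K \<Longrightarrow> a + b \<in> K" "a \<in> K \<Longrightarrow> b \<in> K \<Longrightarrow> a - b \<in> K"
  "a \<in> K \<Longrightarrow> sA c a \<in> K"
  using alg.subspaceD[OF subspace_K] by simp_all

text \<open>
  The quotient map of \<open>H\<close> by the ideal generated by \<open>V\<close>. The ideal \<open>K\<close> of \<open>A\<close> has to be divided out
  because the commutators of elements of \<open>V\<close> become zero.
\<close>

definition q where
  "q = (SOME f. f \<in> k_alg_hom H (quot_alg A K) \<and> (\<forall>v. f (hV v) = K) \<and> (\<forall>a. f (hA a) = K +>\<^bsub>A\<^esub> a))"

lemma q: "q \<in> k_alg_hom H (quot_alg A K)" "q (hV v) = K" "q (hA a) = K +>\<^bsub>A\<^esub> a"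
proof -
  let ?zero = "\<zero>\<^bsub>quot_alg A K\<^esub>" and ?gA = "\<lambda>a. K +>\<^bsub>A\<^esub> a"
  obtain f where "f \<in> k_alg_hom H (quot_alg A K)" "\<And>v. f (hV v) = ?zero" "\<And>a. f (hA a) = ?gA a"
  proof (rule H_lift[OF AK.k_algebra, of "\<lambda>_. ?zero" ?gA])
    show closed: "?gA a \<in> carrier (quot_alg A K)" for a
      using Aproj.hom_closed[of a] by simp
    have sum: "list_sum (quot_alg A K) (\<lambda>(x, y). ?zero \<otimes>\<^bsub>quot_alg A K\<^esub> ?gA y) xs = ?zero" for xs :: "('a \<times> 'a) list"
      by (induction xs) (auto simp: closed)
    show "?gA a \<otimes>\<^bsub>quot_alg A K\<^esub> ?zero =
        list_sum (quot_alg A K) (\<lambda>(x, y). ?zero \<otimes>\<^bsub>quot_alg A K\<^esub> ?gA y) xs" for a and xs :: "('a \<times> 'a) list"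
      unfolding sum using closed by simp
    show "?zero \<otimes>\<^bsub>quot_alg A K\<^esub> ?zero \<ominus>\<^bsub>quot_alg A K\<^esub> ?zero \<otimes>\<^bsub>quot_alg A K\<^esub> ?zero =
        ?gA (\<kappa> (wedge sV v v'))" for v v'
    proof -
      have "?gA (\<kappa> (wedge sV v v')) = ?zero"
        using alg.coset_zero[OF subspace_K \<kappa>_wedge_K, of v v'] by (simp add: quot_alg_sel)
      then show ?thesis by (simp add: a_minus_def)
    qed
  qed (use Aproj.hom_add Aproj.hom_smult Aproj.hom_mult Aproj.hom_one in auto)
  then have "\<exists>f. f \<in> k_alg_hom H (quot_alg A K) \<and> (\<forall>v. f (hV v) = K) \<and> (\<forall>a. f (hA a) = ?gA a)"
    by (auto simp: quot_alg_sel)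
  from someI_ex[OF this] show "q \<in> k_alg_hom H (quot_alg A K)" "q (hV v) = K" "q (hA a) = ?gA a"
    by (auto simp: q_def)
qed

interpretation q: kalg_hom H "quot_alg A K" q
  by standard (rule q)

text \<open>The quotient map of \<open>H\<close> by the ideal generated by \<open>\<mm>\<close>.\<close>

definition p where
  "p = (SOME f. f \<in> k_alg_hom H SV \<and> (\<forall>v. f (hV v) = sym_gen sV v) \<and>
    (\<forall>a. f (hA a) = aug a \<odot>\<^bsub>SV\<^esub> \<one>\<^bsub>SV\<^esub>))"

lemma sym_gen_sweedler:
  assumes "sweedler sA D a xs"
  shows "list_sum SV (\<lambda>(x, y). sym_gen sV (act x v) \<otimes>\<^bsub>SV\<^esub> (aug y \<odot>\<^bsub>SV\<^esub> \<one>\<^bsub>SV\<^esub>)) xs =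
    aug a \<odot>\<^bsub>SV\<^esub> sym_gen sV v"
proof -
  have zero: "sym_gen sV 0 = \<zero>\<^bsub>SV\<^esub>" using sym_gen_linear(2)[of 0 0] by simp
  have "list_sum SV (\<lambda>(x, y). sym_gen sV (act x v) \<otimes>\<^bsub>SV\<^esub> (aug y \<odot>\<^bsub>SV\<^esub> \<one>\<^bsub>SV\<^esub>)) xs =
      sym_gen sV (\<Sum>(x, y)\<leftarrow>xs. sV (aug y) (act x v))"
    by (induction xs) (auto simp: zero sym_gen_linear SV.smult_right)
  then show ?thesis by (simp add: sweedler_aug[OF assms] sym_gen_linear)
qed

lemma p: "p \<in> k_alg_hom H SV" "p (hV v) = sym_gen sV v" "p (hA a) = aug a \<odot>\<^bsub>SV\<^esub> \<one>\<^bsub>SV\<^esub>"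
proof -
  let ?gA = "\<lambda>a. aug a \<odot>\<^bsub>SV\<^esub> \<one>\<^bsub>SV\<^esub>"
  obtain f where "f \<in> k_alg_hom H SV" "\<And>v. f (hV v) = sym_gen sV v" "\<And>a. f (hA a) = ?gA a"
  proof (rule H_lift[OF SV.k_algebra, of "sym_gen sV" ?gA])
    show "?gA a \<otimes>\<^bsub>SV\<^esub> sym_gen sV v =
        list_sum SV (\<lambda>(x, y). sym_gen sV (act x v) \<otimes>\<^bsub>SV\<^esub> ?gA y) xs"
      if "sweedler sA D a xs" for a v xs
      using that by (simp add: sym_gen_sweedler SV.smult_left)
    show "sym_gen sV v \<otimes>\<^bsub>SV\<^esub> sym_gen sV v' \<ominus>\<^bsub>SV\<^esub> sym_gen sV v' \<otimes>\<^bsub>SV\<^esub> sym_gen sV v =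
        ?gA (\<kappa> (wedge sV v v'))" for v v'
      using sym_gen_commute[of v v']
      by (simp add: aug_mm_iff[THEN iffD2, OF \<kappa>_wedge_mm] SV.r_right_minus_eq)
  qed (auto simp: sym_gen_linear aug_hom SV.add_smult SV.mult_smult SV.smult_left)
  then have "\<exists>f. f \<in> k_alg_hom H SV \<and> (\<forall>v. f (hV v) = sym_gen sV v) \<and> (\<forall>a. f (hA a) = ?gA a)"
    by blast
  from someI_ex[OF this] show "p \<in> k_alg_hom H SV" "p (hV v) = sym_gen sV v" "p (hA a) = ?gA a"
    by (auto simp: p_def)
qed

interpretation p: kalg_hom H SV p
  by standard (rule p)

text \<open>
  Representatives in \<open>A\<close> of the values of \<open>q\<close>, which are only well-defined modulo \<open>K\<close>, and their
  components \<open>e\<close> in \<open>k\<close> and \<open>r\<close> in \<open>\<mm>\<close>. Since \<open>K \<subseteq> \<mm>\<close>, the map \<open>e\<close> is a character of \<open>H\<close>.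
\<close>

definition rep where "rep x = (SOME b. q x = K +>\<^bsub>A\<^esub> b)"
definition e where "e x = aug (rep x)"
definition r where "r x = rep x - sA (e x) 1"

lemma rep:
  assumes "x \<in> carrier H"
  shows "q x = K +>\<^bsub>A\<^esub> rep x"
  unfolding rep_def by (rule someI_ex) (use q.hom_closed[OF assms] in \<open>auto simp: quot_alg_sel\<close>)

lemma rep_unique:
  assumes "x \<in> carrier H" "q x = K +>\<^bsub>A\<^esub> b"
  shows "rep x - b \<in> K"
  using rep[OF assms(1)] assms(2) alg.coset_eq_iff[OF subspace_K, of "rep x" b] by simp

lemma e_eq:
  assumes "x \<in> carrier H" "q x = K +>\<^bsub>A\<^esub> b"
  shows "e x = aug b"
proof -
  have "rep x - b \<in> \<mm>" using rep_unique[OF assms] N_superset N_mm by blast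
  moreover have "aug (rep x) = aug (rep x - b) + aug b" by (simp flip: aug_hom)
  ultimately show ?thesis by (simp add: e_def aug_mm_iff[THEN iffD2])
qed

lemma r_unique:
  assumes "x \<in> carrier H" "q x = K +>\<^bsub>A\<^esub> b"
  shows "r x - (b - sA (e x) 1) \<in> K"
  using rep_unique[OF assms] by (simp add: r_def)

lemma rep_eq: "rep x = r x + sA (e x) 1"
  by (simp add: r_def)

lemma r_mm: "r x \<in> \<mm>"
  unfolding r_def e_def by (rule aug_mm)

lemma q_rep:
  assumes "x \<in> carrier H" "y \<in> carrier H"
  shows "q (x \<oplus>\<^bsub>H\<^esub> y) = K +>\<^bsub>A\<^esub> (rep x + rep y)" "q (x \<otimes>\<^bsub>H\<^esub> y) = K +>\<^bsub>A\<^esub> (rep x * rep y)"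
    "q (x \<ominus>\<^bsub>H\<^esub> y) = K +>\<^bsub>A\<^esub> (rep x - rep y)"
  using assms Aproj.hom_add[of "rep x" "rep y"] Aproj.hom_mult[of "rep x" "rep y"]
    Aproj.hom_minus[of "rep x" "rep y"]
  by (simp_all add: q.hom_add q.hom_mult q.hom_minus rep[OF assms(1)] rep[OF assms(2)])

lemma q_smult: "x \<in> carrier H \<Longrightarrow> q (c \<odot>\<^bsub>H\<^esub> x) = K +>\<^bsub>A\<^esub> sA c (rep x)"
  using Aproj.hom_smult[of "rep x" c] by (simp add: q.hom_smult rep[of x])

lemma aug_diff: "aug (a - b) = aug a - aug b"
  using aug_hom(1)[of "a - b" b] by simp

lemma e_simps:
  assumes "x \<in> carrier H" "y \<in> carrier H"
  shows "e (x \<oplus>\<^bsub>H\<^esub> y) = e x + e y" "e (x \<otimes>\<^bsub>H\<^esub> y) = e x * e y" "e (x \<ominus>\<^bsub>H\<^esub> y) = e x - e y"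
  using assms e_eq[OF _ q_rep(1)[OF assms]] e_eq[OF _ q_rep(2)[OF assms]]
    e_eq[OF _ q_rep(3)[OF assms]]
  by (simp_all add: aug_hom aug_diff e_def)

lemma e_smult: "x \<in> carrier H \<Longrightarrow> e (c \<odot>\<^bsub>H\<^esub> x) = c * e x"
  using e_eq[OF _ q_smult[of x c]] by (simp add: aug_hom e_def)

lemma e_gen: "e (hA a) = aug a" "e (hV v) = 0" "e \<one>\<^bsub>H\<^esub> = 1"
proof -
  show A: "e (hA a) = aug a" for a by (rule e_eq) (simp_all add: q)
  have "K = K +>\<^bsub>A\<^esub> 0" using alg.coset_zero[OF subspace_K K_closed(1)] by simp
  then have "e (hV v) = aug 0" by (intro e_eq) (simp_all add: q)
  then show "e (hV v) = 0" by (simp add: aug_mm_iff mm_closed)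
  show "e \<one>\<^bsub>H\<^esub> = 1" using A[of 1] by (simp add: hA_one aug_hom)
qed

lemma r_simps:
  assumes "x \<in> carrier H" "y \<in> carrier H"
  shows "r (x \<oplus>\<^bsub>H\<^esub> y) - (r x + r y) \<in> K"
    "r (x \<otimes>\<^bsub>H\<^esub> y) - (sA (e x) (r y) + sA (e y) (r x) + r x * r y) \<in> K"
    "r (x \<ominus>\<^bsub>H\<^esub> y) - (r x - r y) \<in> K"
  using r_unique[OF _ q_rep(1)[OF assms]] r_unique[OF _ q_rep(2)[OF assms]]
    r_unique[OF _ q_rep(3)[OF assms]] assms
  by (simp_all add: rep_eq e_simps algebra_simps sA_mult A.scale_right_distrib)

lemma r_smult: "x \<in> carrier H \<Longrightarrow> r (c \<odot>\<^bsub>H\<^esub> x) - sA c (r x) \<in> K"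
  using r_unique[OF _ q_smult[of x c]]
  by (simp add: rep_eq e_smult A.scale_right_distrib)

lemma r_hA: "a \<in> \<mm> \<Longrightarrow> r (hA a) - a \<in> K"
  using r_unique[of "hA a" a] by (simp add: q e_gen aug_mm_iff[THEN iffD2])

lemma r_one: "r \<one>\<^bsub>H\<^esub> \<in> K"
  using r_unique[of "\<one>\<^bsub>H\<^esub>" 1] by (simp add: q.hom_one quot_alg_sel e_gen)

lemma subspace_add_cancel:
  assumes "submodule J ground A" "K \<subseteq> J" "a - b \<in> K"
  shows "a \<in> J \<longleftrightarrow> b \<in> J"
proof -
  note J = alg.subspaceD[OF assms(1), simplified]
  show ?thesis
    using J(6)[of a "a - b"] J(3)[of "a - b" b] assms(2,3) by auto
qed

text \<open>
  The component of \<open>p x\<close> in \<open>Sym\<^sup>+ V\<close>; its constant term is \<open>e x\<close>.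
\<close>

definition s where "s x = p x \<ominus>\<^bsub>SV\<^esub> e x \<odot>\<^bsub>SV\<^esub> \<one>\<^bsub>SV\<^esub>"

lemma s_closed: "x \<in> carrier H \<Longrightarrow> s x \<in> carrier SV"
  by (simp add: s_def p.hom_closed)

lemma p_eq: "x \<in> carrier H \<Longrightarrow> p x = s x \<oplus>\<^bsub>SV\<^esub> e x \<odot>\<^bsub>SV\<^esub> \<one>\<^bsub>SV\<^esub>"
  by (simp add: s_def a_minus_def p.hom_closed SV.a_assoc SV.l_neg)

lemma s_unique: "y \<in> carrier SV \<Longrightarrow> p x = y \<oplus>\<^bsub>SV\<^esub> e x \<odot>\<^bsub>SV\<^esub> \<one>\<^bsub>SV\<^esub> \<Longrightarrow> s x = y"
  by (simp add: s_def a_minus_def SV.a_assoc SV.r_neg)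

lemma s_simps:
  assumes "x \<in> carrier H" "y \<in> carrier H"
  shows "s (x \<oplus>\<^bsub>H\<^esub> y) = s x \<oplus>\<^bsub>SV\<^esub> s y"
    "s (x \<otimes>\<^bsub>H\<^esub> y) = e x \<odot>\<^bsub>SV\<^esub> s y \<oplus>\<^bsub>SV\<^esub> e y \<odot>\<^bsub>SV\<^esub> s x \<oplus>\<^bsub>SV\<^esub> s x \<otimes>\<^bsub>SV\<^esub> s y"
  by (rule s_unique; use assms in \<open>simp add: p.hom_add p.hom_mult p_eq[OF assms(1)] p_eq[OF assms(2)]
    e_simps s_closed SV.add_smult SV.l_distr SV.r_distr SV.smult_left SV.smult_right SV.a_ac
    SV.smult_add mult.commute[of "e y" "e x"] flip: SV.mult_smult\<close>)+

lemma s_smult: "x \<in> carrier H \<Longrightarrow> s (c \<odot>\<^bsub>H\<^esub> x) = c \<odot>\<^bsub>SV\<^esub> s x"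
  by (rule s_unique)
    (simp_all add: p.hom_smult p_eq[of x] e_smult s_closed SV.smult_add SV.mult_smult)

lemma sym_gen_mult_sym_plus:
  assumes "y \<in> carrier SV"
  shows "sym_gen sV v \<otimes>\<^bsub>SV\<^esub> y \<in> sym_plus sV"
proof -
  let ?W = "{y \<in> carrier SV. sym_gen sV v \<otimes>\<^bsub>SV\<^esub> y \<in> sym_plus sV}"
  have W: "submodule ?W ground SV"
    using SV.subspaceD[OF subspace_sym_plus]
    by (intro SV.subspaceI) (auto simp: SV.r_distr SV.smult_right)
  have "carrier TV \<subseteq> {t \<in> carrier TV. sym_ideal sV +>\<^bsub>TV\<^esub> t \<in> ?W}"
  proof (rule tens_alg_span[OF sproj.subspace_vimage[OF W]])
    fix ws
    have "sym_ideal sV +>\<^bsub>TV\<^esub> list_prod TV (tens_gen sV) ws = list_prod SV (sym_gen sV) ws"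
      by (subst sproj.hom_list_prod) (simp_all add: sym_gen_def[abs_def])
    moreover have "list_prod SV (sym_gen sV) (v # ws) \<in> sym_plus sV"
      unfolding sym_plus_def by (rule subsetD[OF SV.k_span_superset]) blast
    ultimately show "list_prod TV (tens_gen sV) ws \<in> {t \<in> carrier TV. sym_ideal sV +>\<^bsub>TV\<^esub> t \<in> ?W}"
      by simp
  qed
  then show ?thesis using assms by (auto simp: SV_image)
qed

lemma s_sym_plus:
  assumes "x \<in> carrier H"
  shows "s x \<in> sym_plus sV"
proof -
  note closed = SV.subspaceD[OF subspace_sym_plus]
  have "carrier H \<subseteq> {x \<in> carrier H. s x \<in> sym_plus sV}" (is "_ \<subseteq> ?W")
  proof (rule H_left_induct)
    have zero: "s \<zero>\<^bsub>H\<^esub> = \<zero>\<^bsub>SV\<^esub>"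
      using s_smult[of "\<zero>\<^bsub>H\<^esub>" 0] by (simp add: s_closed)
    show "submodule ?W ground H"
      using closed by (intro H.subspaceI) (auto simp: zero s_simps s_smult)
    have "s \<one>\<^bsub>H\<^esub> = \<zero>\<^bsub>SV\<^esub>"
      by (rule s_unique) (simp_all add: p.hom_one e_gen)
    then show "\<one>\<^bsub>H\<^esub> \<in> ?W" using closed by simp
    fix x assume x: "x \<in> ?W"
    have "s (hV v \<otimes>\<^bsub>H\<^esub> x) = sym_gen sV v \<otimes>\<^bsub>SV\<^esub> p x" for v
      by (rule s_unique) (use x in \<open>simp_all add: p.hom_mult p p.hom_closed e_simps e_gen\<close>)
    then show "hV v \<otimes>\<^bsub>H\<^esub> x \<in> ?W" for v
      using x by (simp add: sym_gen_mult_sym_plus p.hom_closed)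
    have "s (hA a \<otimes>\<^bsub>H\<^esub> x) = aug a \<odot>\<^bsub>SV\<^esub> s x" for a
      by (rule s_unique)
        (use x in \<open>simp_all add: s_closed p.hom_mult p p_eq[of x] p.hom_closed e_simps e_gen SV.smult_left
          SV.smult_add SV.mult_smult\<close>)
    then show "hA a \<otimes>\<^bsub>H\<^esub> x \<in> ?W" for a
      using x closed by simp
  qed
  then show ?thesis using assms by auto
qed

text \<open>
  Words in \<open>V\<close> reach all of \<open>Sym\<^sup>+ V\<close> without contributing to the components in \<open>k\<close> and \<open>\<mm> / N\<close>.
\<close>

lemma s_surj:
  assumes "y \<in> sym_plus sV"
  obtains x where "x \<in> carrier H" "e x = 0" "r x \<in> K" "s x = y"
proof -
  let ?W = "{s x | x. x \<in> carrier H \<and> e x = 0 \<and> r x \<in> K}"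
  have memI: "y \<in> ?W" if "x \<in> carrier H" "q x = K" "p x = y" for x y
  proof -
    have "q x = K +>\<^bsub>A\<^esub> 0" using that(2) alg.coset_zero[OF subspace_K K_closed(1)] by simp
    then have "e x = 0" "rep x \<in> K"
      using e_eq[OF that(1), of 0] rep_unique[OF that(1), of 0] aug_mm_iff mm_closed(1) by auto
    then show ?thesis using that by (force simp: s_def r_def p.hom_closed a_minus_def)
  qed
  have "sym_plus sV \<subseteq> ?W"
    unfolding sym_plus_def
  proof (rule SV.k_span_least[OF SV.subspaceI])
    have "q \<zero>\<^bsub>H\<^esub> = K" using q.hom_zero by (simp add: quot_alg_sel)
    then show "\<zero>\<^bsub>SV\<^esub> \<in> ?W" by (intro memI[of "\<zero>\<^bsub>H\<^esub>"]) (auto simp: p.hom_zero)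
    show "?W \<subseteq> carrier SV" by (auto simp: s_closed)
    show "y \<oplus>\<^bsub>SV\<^esub> y' \<in> ?W" if "y \<in> ?W" "y' \<in> ?W" for y y'
    proof -
      from that obtain x x' where x: "x \<in> carrier H" "e x = 0" "r x \<in> K" "y = s x"
        "x' \<in> carrier H" "e x' = 0" "r x' \<in> K" "y' = s x'"
        by auto
      then have "r (x \<oplus>\<^bsub>H\<^esub> x') \<in> K"
        using subspace_add_cancel[OF subspace_K order_refl r_simps(1)[of x x']] K_closed(2) by simp
      moreover have "e (x \<oplus>\<^bsub>H\<^esub> x') = 0" "y \<oplus>\<^bsub>SV\<^esub> y' = s (x \<oplus>\<^bsub>H\<^esub> x')"
        using x by (simp_all add: e_simps s_simps)
      ultimately show ?thesis using x by blast
    qed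
    show "c \<odot>\<^bsub>SV\<^esub> y \<in> ?W" if "y \<in> ?W" for c y
    proof -
      from that obtain x where x: "x \<in> carrier H" "e x = 0" "r x \<in> K" "y = s x"
        by auto
      then have "r (c \<odot>\<^bsub>H\<^esub> x) \<in> K"
        using subspace_add_cancel[OF subspace_K order_refl r_smult[of x c]] K_closed(4) by simp
      moreover have "e (c \<odot>\<^bsub>H\<^esub> x) = 0" "c \<odot>\<^bsub>SV\<^esub> y = s (c \<odot>\<^bsub>H\<^esub> x)"
        using x by (simp_all add: e_smult s_smult)
      ultimately show ?thesis using x by blast
    qed
    show "{list_prod SV (sym_gen sV) ws | ws. ws \<noteq> []} \<subseteq> ?W"
    proof
      fix y assume "y \<in> {list_prod SV (sym_gen sV) ws | ws. ws \<noteq> []}"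
      then obtain v vs ws where ws: "ws = v # vs" and y: "y = list_prod SV (sym_gen sV) ws"
        by (auto simp: neq_Nil_conv)
      have "list_prod H hV ws = hV v \<otimes>\<^bsub>H\<^esub> list_prod H hV vs" by (simp add: ws)
      moreover have "q (hV v) = \<zero>\<^bsub>quot_alg A K\<^esub>" by (simp add: q quot_alg_sel)
      ultimately have "q (list_prod H hV ws) = \<zero>\<^bsub>quot_alg A K\<^esub>"
        by (simp add: q.hom_mult q.hom_closed)
      moreover have "p (list_prod H hV ws) = list_prod SV (sym_gen sV) ws"
        by (subst p.hom_list_prod) (auto simp: p)
      ultimately show "y \<in> ?W"
        unfolding y by (intro memI[of "list_prod H hV ws"]) (auto simp: quot_alg_sel)
    qed
  qed
  then obtain x where "x \<in> carrier H" "e x = 0" "r x \<in> K" "y = s x"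
    using assms by blast
  then show thesis using that by metis
qed


section \<open>The isomorphisms\<close>

text \<open>
  The kernel of the map \<open>\<Phi> J\<close> defined below.
\<close>

definition ker where
  "ker J = {x \<in> carrier H. e x = 0 \<and> p x = \<zero>\<^bsub>SV\<^esub> \<and> r x \<in> J}"

lemma subspace_ker:
  assumes "submodule J ground A" "K \<subseteq> J"
  shows "submodule (ker J) ground H"
proof (rule H.subspaceI)
  note J = alg.subspaceD[OF assms(1), simplified] and cancel = subspace_add_cancel[OF assms]
  have zero: "e \<zero>\<^bsub>H\<^esub> = 0" "r \<zero>\<^bsub>H\<^esub> \<in> J"
    using e_smult[of "\<zero>\<^bsub>H\<^esub>" 0] cancel[OF r_smult[of "\<zero>\<^bsub>H\<^esub>" 0]] J(2) by simp_all
  then show "\<zero>\<^bsub>H\<^esub> \<in> ker J" by (simp add: ker_def p.hom_zero)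
  show "x \<oplus>\<^bsub>H\<^esub> y \<in> ker J" if "x \<in> ker J" "y \<in> ker J" for x y
    using that cancel[OF r_simps(1)[of x y]] J(3)
    by (simp add: ker_def e_simps p.hom_add)
  show "c \<odot>\<^bsub>H\<^esub> x \<in> ker J" if "x \<in> ker J" for c x
    using that cancel[OF r_smult[of x c]] J(4)
    by (simp add: ker_def e_smult p.hom_smult)
qed (auto simp: ker_def)

lemma ideal_ker:
  assumes "ideal J A" "K \<subseteq> J"
  shows "ideal (ker J) H"
proof (rule H.ideal_of_subspace)
  have sub: "submodule J ground A" using assms(1) by (rule alg.ideal_subspace)
  show "submodule (ker J) ground H" by (rule subspace_ker[OF sub assms(2)])
  note J = alg.subspaceD[OF sub, simplified] and cancel = subspace_add_cancel[OF sub assms(2)]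
  have mult: "a * b \<in> J" "b * a \<in> J" if "b \<in> J" for a b
    using ideal.I_l_closed[OF assms(1) that] ideal.I_r_closed[OF assms(1) that] by simp_all
  fix x y assume *: "x \<in> carrier H" "y \<in> ker J"
  then show "x \<otimes>\<^bsub>H\<^esub> y \<in> ker J"
    using cancel[OF r_simps(2)[of x y]] J(3,4) mult
    by (simp add: ker_def e_simps p.hom_mult p.hom_closed)
  show "y \<otimes>\<^bsub>H\<^esub> x \<in> ker J"
    using * cancel[OF r_simps(2)[of y x]] J(3,4) mult
    by (simp add: ker_def e_simps p.hom_mult p.hom_closed)
qed

lemma HH_ker: "HH \<subseteq> ker N"
proof (rule H.comm_span_least[OF subspace_ker[OF subspace_N N_superset(2)]])
  fix x y assume *: "x \<in> carrier H" "y \<in> carrier H"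
  let ?z = "x \<otimes>\<^bsub>H\<^esub> y \<ominus>\<^bsub>H\<^esub> y \<otimes>\<^bsub>H\<^esub> x"
  have "e ?z = 0" using * by (simp add: e_simps)
  moreover have "p ?z = \<zero>\<^bsub>SV\<^esub>"
    using * SV_commute[of "p x" "p y"]
    by (simp add: p.hom_minus p.hom_mult p.hom_closed SV.r_right_minus_eq)
  moreover have "r ?z \<in> N"
  proof -
    have "q ?z = K +>\<^bsub>A\<^esub> (rep x * rep y - rep y * rep x)"
      using * Aproj.hom_minus[of "rep x * rep y" "rep y * rep x"]
      by (simp add: q.hom_minus q_rep)
    from r_unique[OF _ this] have "r ?z - (rep x * rep y - rep y * rep x) \<in> K"
      using * \<open>e ?z = 0\<close> by simp
    moreover have "rep x * rep y - rep y * rep x = r x * r y - r y * r x"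
      by (simp add: rep_eq algebra_simps sA_mult)
    moreover have "r x * r y - r y * r x \<in> N"
      using alg.comm_span_memI[OF r_mm r_mm, of x y] N_superset(1) by auto
    ultimately show ?thesis
      using subspace_add_cancel[OF subspace_N N_superset(2)] by simp
  qed
  ultimately show "?z \<in> ker N" using * by (simp add: ker_def)
qed

lemma p_\<tau>: "t \<in> carrier TV \<Longrightarrow> p (\<tau> t) = sym_ideal sV +>\<^bsub>TV\<^esub> t"
  by (rule tens_hom_eq[OF SV.k_algebra k_alg_hom_comp[OF \<tau>(1) p(1)] sproj.hom])
    (simp_all add: \<tau> p sym_gen_def)

text \<open>
  Decompose \<open>x = t + a + h\<close> with \<open>t\<close> a combination of words in \<open>V\<close>, \<open>a \<in> \<mm>\<close> and \<open>h\<close> a sum of commutators.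
  The map \<open>p\<close> sees only the class of \<open>t\<close> in \<open>Sym V\<close>, so \<open>t\<close> lies in the symmetric ideal and is itself a
  sum of commutators; after that, \<open>r\<close> sees only \<open>a\<close>.
\<close>

lemma ker_sub:
  assumes "submodule J ground A" "N \<subseteq> J" "x \<in> ker J"
  obtains a h where "a \<in> J" "h \<in> HH" "x = hA a \<oplus>\<^bsub>H\<^esub> h"
proof -
  have KJ: "K \<subseteq> J" using assms(2) N_superset by blast
  have x: "x \<in> carrier H" using assms(3) by (simp add: ker_def)
  obtain t a h where *: "t \<in> carrier TV" "a \<in> \<mm>" "h \<in> HH" "x = \<tau> t \<oplus>\<^bsub>H\<^esub> (hA a \<oplus>\<^bsub>H\<^esub> h)"
    by (rule H_decompose[OF x])
  have h: "h \<in> carrier H" "p h = \<zero>\<^bsub>SV\<^esub>" using HH_ker *(3) by (auto simp: ker_def)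
  have "p (\<tau> t) = \<zero>\<^bsub>SV\<^esub>"
    using assms(3) * h
    by (simp add: ker_def p.hom_add \<tau>.hom_closed p.hom_closed p aug_mm_iff[THEN iffD2])
  then have "sym_ideal sV +>\<^bsub>TV\<^esub> t = sym_ideal sV +>\<^bsub>TV\<^esub> \<zero>\<^bsub>TV\<^esub>"
    using * sproj.hom_zero by (simp add: p_\<tau>)
  then have "t \<in> sym_ideal sV"
    using * TV.coset_eq_iff[OF TV.ideal_subspace[OF ideal_sym_ideal], of t "\<zero>\<^bsub>TV\<^esub>"]
    by (simp add: a_minus_def)
  then have h': "\<tau> t \<oplus>\<^bsub>H\<^esub> h \<in> HH" using *(3) sym_ideal_HH HH_closed(3) by blast
  have eq: "x = hA a \<oplus>\<^bsub>H\<^esub> (\<tau> t \<oplus>\<^bsub>H\<^esub> h)"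
    using * h by (simp add: H.a_ac \<tau>.hom_closed)
  note cancel = subspace_add_cancel[OF assms(1) KJ] and J = alg.subspaceD[OF assms(1), simplified]
  have "r (hA a) + r (\<tau> t \<oplus>\<^bsub>H\<^esub> h) \<in> J"
    using cancel[OF r_simps(1)[of "hA a" "\<tau> t \<oplus>\<^bsub>H\<^esub> h"]] assms(3) h' HH_carrier
    by (simp add: ker_def flip: eq)
  moreover have "r (\<tau> t \<oplus>\<^bsub>H\<^esub> h) \<in> J" using h' HH_ker assms(2) by (auto simp: ker_def)
  ultimately have "r (hA a) \<in> J" using J(6) by force
  then have "a \<in> J" using cancel[OF r_hA[OF *(2)]] by simp
  then show thesis using that h' eq by blast
qed

lemma ker_N: "ker N = HH"
proof
  show "ker N \<subseteq> HH"
  proof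
    fix x assume "x \<in> ker N"
    then obtain a h where "a \<in> N" "h \<in> HH" "x = hA a \<oplus>\<^bsub>H\<^esub> h"
      by (rule ker_sub[OF subspace_N order_refl])
    then show "x \<in> HH" using hA_N_HH HH_closed(3) by simp
  qed
qed (rule HH_ker)

lemma Idl_N: "ideal (Idl\<^bsub>A\<^esub> N) A" "N \<subseteq> Idl\<^bsub>A\<^esub> N" "Idl\<^bsub>A\<^esub> N \<subseteq> \<mm>"
  using alg.genideal_ideal[of N] alg.genideal_self[of N] alg.genideal_minimal[OF ideal_mm N_mm]
  by simp_all

lemma ideal_Idl_HH: "ideal (Idl\<^bsub>H\<^esub> HH) H"
  by (rule H.genideal_ideal) (rule HH_closed(1))

lemma ker_Idl_N: "ker (Idl\<^bsub>A\<^esub> N) = Idl\<^bsub>H\<^esub> HH"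
proof
  have HH: "HH \<subseteq> Idl\<^bsub>H\<^esub> HH" by (rule H.genideal_self) (rule HH_closed(1))
  note closed = H.subspaceD[OF H.ideal_subspace[OF ideal_Idl_HH]]
  show "ker (Idl\<^bsub>A\<^esub> N) \<subseteq> Idl\<^bsub>H\<^esub> HH"
  proof
    fix x assume "x \<in> ker (Idl\<^bsub>A\<^esub> N)"
    then obtain a h where "a \<in> Idl\<^bsub>A\<^esub> N" "h \<in> HH" "x = hA a \<oplus>\<^bsub>H\<^esub> h"
      by (rule ker_sub[OF alg.ideal_subspace[OF Idl_N(1)] Idl_N(2)])
    moreover have "hA a \<in> Idl\<^bsub>H\<^esub> HH" if "a \<in> Idl\<^bsub>A\<^esub> N" for a
      by (rule hA.Idl_vimage[OF ideal_Idl_HH _ _ that]) (use HH hA_N_HH in auto)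
    ultimately show "x \<in> Idl\<^bsub>H\<^esub> HH" using HH closed(3) by blast
  qed
  have "ker N \<subseteq> ker (Idl\<^bsub>A\<^esub> N)" using Idl_N(2) by (auto simp: ker_def)
  then show "Idl\<^bsub>H\<^esub> HH \<subseteq> ker (Idl\<^bsub>A\<^esub> N)"
    using Idl_N N_superset by (intro H.genideal_minimal ideal_ker) (auto simp: ker_N)
qed

text \<open>
  By \<open>ker_N\<close>, the subspace \<open>N\<close> is the part of \<open>\<mm>\<close> that \<open>H\<close> sends to sums of commutators. So it is an
  intersection of two ideals if these sums form an ideal.
\<close>

lemma ideal_N:
  assumes "ideal HH H"
  shows "ideal N A"
proof -
  have "a \<in> N \<longleftrightarrow> hA a \<in> HH" if "a \<in> \<mm>" for a
    using hA_N_HH[of a] that subspace_add_cancel[OF subspace_N N_superset(2) r_hA[OF that]]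
    by (auto simp: ker_def simp flip: ker_N)
  then have "N = {a \<in> carrier A. hA a \<in> HH} \<inter> \<mm>" using N_mm by auto
  then show ?thesis
    using alg.i_intersect[OF hA.ideal_vimage[OF assms] ideal_mm] by simp
qed

definition target where
  "target J = unit_alg (dsum_alg (SV\<lparr>carrier := sym_plus sV\<rparr>) (quot_alg (A\<lparr>carrier := \<mm>\<rparr>) J))"

definition \<Phi> where "\<Phi> J x = (e x, s x, J +>\<^bsub>A\<^esub> r x)"

lemma quot_mm:
  "quot_alg (A\<lparr>carrier := \<mm>\<rparr>) J = (quot_alg A J)\<lparr>carrier := (\<lambda>a. J +>\<^bsub>A\<^esub> a) ` \<mm>\<rparr>"
  by (auto simp: quot_alg_def A_RCOSETS_def' a_r_coset_def' set_add_def' rcoset_mult_def fun_eq_iff)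

lemma coset_eq:
  "submodule J ground A \<Longrightarrow> J +>\<^bsub>A\<^esub> a = J +>\<^bsub>A\<^esub> b \<longleftrightarrow> a - b \<in> J"
  using alg.coset_eq_iff[of J a b] by simp

lemma quot_A_ops:
  assumes "submodule J ground A"
  shows "(J +>\<^bsub>A\<^esub> a) \<oplus>\<^bsub>quot_alg A J\<^esub> (J +>\<^bsub>A\<^esub> b) = J +>\<^bsub>A\<^esub> (a + b)"
    "c \<odot>\<^bsub>quot_alg A J\<^esub> (J +>\<^bsub>A\<^esub> a) = J +>\<^bsub>A\<^esub> sA c a"
  using alg.quot_add[OF assms, of a b] alg.quot_smult[OF assms, of a c] by simp_all

lemma target_sel:
  "carrier (target J) = UNIV \<times> sym_plus sV \<times> (\<lambda>a. J +>\<^bsub>A\<^esub> a) ` \<mm>"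
  "(c, y, u) \<oplus>\<^bsub>target J\<^esub> (c', y', u') = (c + c', y \<oplus>\<^bsub>SV\<^esub> y', u \<oplus>\<^bsub>quot_alg A J\<^esub> u')"
  "d \<odot>\<^bsub>target J\<^esub> (c, y, u) = (d * c, d \<odot>\<^bsub>SV\<^esub> y, d \<odot>\<^bsub>quot_alg A J\<^esub> u)"
  "(c, y, u) \<otimes>\<^bsub>target J\<^esub> (c', y', u') =
    (c * c', c \<odot>\<^bsub>SV\<^esub> y' \<oplus>\<^bsub>SV\<^esub> c' \<odot>\<^bsub>SV\<^esub> y \<oplus>\<^bsub>SV\<^esub> y \<otimes>\<^bsub>SV\<^esub> y',
     c \<odot>\<^bsub>quot_alg A J\<^esub> u' \<oplus>\<^bsub>quot_alg A J\<^esub> c' \<odot>\<^bsub>quot_alg A J\<^esub> u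
       \<oplus>\<^bsub>quot_alg A J\<^esub> u \<otimes>\<^bsub>quot_alg A J\<^esub> u')"
  "\<one>\<^bsub>target J\<^esub> = (1, \<zero>\<^bsub>SV\<^esub>, J)"
  by (simp_all add: target_def unit_alg_def dsum_alg_def quot_mm quot_alg_sel)

text \<open>
  The subspace \<open>J\<close> is \<open>N\<close> for the description of \<open>HH\<^sub>0\<close>, and the ideal generated by \<open>N\<close> for the
  quotient of \<open>H\<close> by the ideal generated by the commutators.
\<close>

context
  fixes J
  assumes J: "submodule J ground A" "N \<subseteq> J" "J \<subseteq> \<mm>"
begin

lemma KJ: "K \<subseteq> J"
  using J(2) N_superset by blast

lemma \<Phi>_linear: "k_lin_on H (carrier H) (target J) (\<Phi> J)"
  using KJ r_simps(1) r_smult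
  by (auto simp: k_lin_on_def \<Phi>_def target_sel s_sym_plus e_simps s_simps e_smult s_smult
      quot_A_ops[OF J(1)] coset_eq[OF J(1)] intro!: imageI r_mm)

lemma \<Phi>_surj: "carrier (target J) \<subseteq> \<Phi> J ` carrier H"
proof
  fix z assume "z \<in> carrier (target J)"
  then obtain c y a where z: "z = (c, y, J +>\<^bsub>A\<^esub> a)" "y \<in> sym_plus sV" "a \<in> \<mm>"
    by (auto simp: target_sel)
  obtain x where x: "x \<in> carrier H" "e x = 0" "r x \<in> K" "s x = y"
    by (rule s_surj[OF z(2)])
  \<comment> \<open>The element \<open>b\<close> of \<open>A\<close> has the components \<open>c\<close> and \<open>a\<close>, and \<open>x\<close> supplies the third one.\<close>
  define b where "b = a + sA c 1"
  have aug_b: "aug b = c" using aug_unique[of b c] z(3) by (simp add: b_def)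
  have y: "y \<in> carrier SV" using x s_closed by blast
  have s: "s (hA b) = \<zero>\<^bsub>SV\<^esub>"
    by (rule s_unique) (simp_all add: p e_gen)
  have "r (hA b) - a \<in> K"
    using r_unique[of "hA b" b] by (simp add: q e_gen aug_b) (simp add: b_def)
  then have "(r (hA b) - a) + r x \<in> K" using x(3) by (rule K_closed(2))
  from K_closed(2)[OF r_simps(1)[of "hA b" x] this] have "r (hA b \<oplus>\<^bsub>H\<^esub> x) - a \<in> K"
    using x by simp
  then have "r (hA b \<oplus>\<^bsub>H\<^esub> x) - a \<in> J" using KJ by blast
  then have "\<Phi> J (hA b \<oplus>\<^bsub>H\<^esub> x) = z"
    using x y by (simp add: \<Phi>_def z e_simps s_simps e_gen aug_b s coset_eq[OF J(1)])
  then show "z \<in> \<Phi> J ` carrier H" using x by blast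
qed

lemma \<Phi>_eq_iff:
  assumes "x \<in> carrier H" "y \<in> carrier H"
  shows "\<Phi> J x = \<Phi> J y \<longleftrightarrow> x \<ominus>\<^bsub>H\<^esub> y \<in> ker J"
proof -
  have "r x - r y \<in> J \<longleftrightarrow> r (x \<ominus>\<^bsub>H\<^esub> y) \<in> J"
    using subspace_add_cancel[OF J(1) KJ r_simps(3)] assms by simp
  moreover have "p (x \<ominus>\<^bsub>H\<^esub> y) = \<zero>\<^bsub>SV\<^esub> \<longleftrightarrow> p x = p y"
    using assms by (simp add: p.hom_minus p.hom_closed SV.r_right_minus_eq)
  moreover have "s x = s y \<longleftrightarrow> p x = p y" if "e x = e y"
    using that p_eq assms unfolding s_def by metis
  ultimately show ?thesis
    using assms by (auto simp: \<Phi>_def ker_def e_simps coset_eq[OF J(1)])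
qed

lemma \<Phi>_mult:
  assumes "ideal J A"
  shows "\<And>x y. x \<in> carrier H \<Longrightarrow> y \<in> carrier H \<Longrightarrow> \<Phi> J (x \<otimes>\<^bsub>H\<^esub> y) = \<Phi> J x \<otimes>\<^bsub>target J\<^esub> \<Phi> J y"
    and "\<Phi> J \<one>\<^bsub>H\<^esub> = \<one>\<^bsub>target J\<^esub>"
proof -
  have "(J +>\<^bsub>A\<^esub> a) \<otimes>\<^bsub>quot_alg A J\<^esub> (J +>\<^bsub>A\<^esub> b) = J +>\<^bsub>A\<^esub> (a * b)" for a b
    using alg.quot_mult[OF assms, of a b] by simp
  moreover have "r (x \<otimes>\<^bsub>H\<^esub> y) - (sA (e x) (r y) + sA (e y) (r x) + r x * r y) \<in> J"
    if "x \<in> carrier H" "y \<in> carrier H" for x y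
    using r_simps(2)[OF that] KJ by blast
  ultimately show "\<Phi> J (x \<otimes>\<^bsub>H\<^esub> y) = \<Phi> J x \<otimes>\<^bsub>target J\<^esub> \<Phi> J y"
    if "x \<in> carrier H" "y \<in> carrier H" for x y
    using that by (simp add: \<Phi>_def target_sel quot_A_ops[OF J(1)] coset_eq[OF J(1)] e_simps s_simps)
  have "s \<one>\<^bsub>H\<^esub> = \<zero>\<^bsub>SV\<^esub>"
    by (rule s_unique) (simp_all add: p.hom_one e_gen)
  moreover have "J +>\<^bsub>A\<^esub> r \<one>\<^bsub>H\<^esub> = J"
    using alg.coset_zero[OF J(1)] r_one KJ by blast
  ultimately show "\<Phi> J \<one>\<^bsub>H\<^esub> = \<one>\<^bsub>target J\<^esub>"
    by (simp add: \<Phi>_def target_sel e_gen)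
qed

lemma \<Phi>_iso:
  obtains g where "g \<in> k_lin_iso (quot_alg H (ker J)) (target J)"
    "\<And>x. x \<in> carrier H \<Longrightarrow> g (ker J +>\<^bsub>H\<^esub> x) = \<Phi> J x"
    "ideal J A \<Longrightarrow> g \<in> k_alg_iso (quot_alg H (ker J)) (target J)"
proof (rule H.quot_lin_iso[OF subspace_ker[OF J(1) KJ] \<Phi>_linear \<Phi>_surj \<Phi>_eq_iff])
  fix g assume g: "g \<in> k_lin_iso (quot_alg H (ker J)) (target J)"
    "\<And>x. x \<in> carrier H \<Longrightarrow> g (ker J +>\<^bsub>H\<^esub> x) = \<Phi> J x"
  have "g \<in> k_alg_iso (quot_alg H (ker J)) (target J)" if "ideal J A"
    by (rule H.quot_lin_iso_mult[OF ideal_ker[OF that KJ] g \<Phi>_mult[OF that]])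
  then show thesis using that g by blast
qed

end

lemma HH0_iso:
  "\<exists>F \<in> k_lin_iso (HH0 H) (target N).
    (ideal HH H \<longrightarrow> ideal N A \<and> abelian_k_algebra (HH0 H) \<and> F \<in> k_alg_iso (HH0 H) (target N)) \<and>
    abelian_k_algebra (quot_alg H (Idl\<^bsub>H\<^esub> HH)) \<and>
    (\<exists>G \<in> k_alg_iso (quot_alg H (Idl\<^bsub>H\<^esub> HH)) (target (Idl\<^bsub>A\<^esub> N)).
       \<forall>x\<in>carrier H. \<forall>c y a. a \<in> \<mm> \<and> F (HH +>\<^bsub>H\<^esub> x) = (c, y, N +>\<^bsub>A\<^esub> a) \<longrightarrow>
         G ((Idl\<^bsub>H\<^esub> HH) +>\<^bsub>H\<^esub> x) = (c, y, (Idl\<^bsub>A\<^esub> N) +>\<^bsub>A\<^esub> a))"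
proof -
  have sub: "submodule (Idl\<^bsub>A\<^esub> N) ground A" by (rule alg.ideal_subspace[OF Idl_N(1)])
  have HH: "HH \<subseteq> Idl\<^bsub>H\<^esub> HH" by (rule H.genideal_self) (rule HH_closed(1))
  obtain F where F: "F \<in> k_lin_iso (HH0 H) (target N)"
    "\<And>x. x \<in> carrier H \<Longrightarrow> F (HH +>\<^bsub>H\<^esub> x) = \<Phi> N x"
    "ideal N A \<Longrightarrow> F \<in> k_alg_iso (HH0 H) (target N)"
    by (rule \<Phi>_iso[OF subspace_N order_refl N_mm, unfolded ker_N, folded HH0_def]) (rule that; simp)
  obtain G where G':
    "\<And>x. x \<in> carrier H \<Longrightarrow> G (Idl\<^bsub>H\<^esub> HH +>\<^bsub>H\<^esub> x) = \<Phi> (Idl\<^bsub>A\<^esub> N) x"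
    "ideal (Idl\<^bsub>A\<^esub> N) A \<Longrightarrow> G \<in> k_alg_iso (quot_alg H (Idl\<^bsub>H\<^esub> HH)) (target (Idl\<^bsub>A\<^esub> N))"
    by (rule \<Phi>_iso[OF sub Idl_N(2,3), unfolded ker_Idl_N]) (rule that; simp)
  note G = G'(2)[OF Idl_N(1)] G'(1)
  have "G (Idl\<^bsub>H\<^esub> HH +>\<^bsub>H\<^esub> x) = (c, y, Idl\<^bsub>A\<^esub> N +>\<^bsub>A\<^esub> a)"
    if "x \<in> carrier H" "F (HH +>\<^bsub>H\<^esub> x) = (c, y, N +>\<^bsub>A\<^esub> a)" for x c y a
    using that Idl_N(2) by (auto simp: F G \<Phi>_def coset_eq[OF sub] coset_eq[OF subspace_N])
  moreover have "abelian_k_algebra (HH0 H)" if "ideal HH H"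
    unfolding HH0_def using that by (rule H.abelian_quot) simp
  moreover have "abelian_k_algebra (quot_alg H (Idl\<^bsub>H\<^esub> HH))"
    by (rule H.abelian_quot[OF ideal_Idl_HH HH])
  ultimately show ?thesis
    by (intro bexI[OF _ F(1)] bexI[OF _ G(1)] conjI impI ballI allI F(3) ideal_N) simp_all
qed

end


section \<open>Zeroth Hochschild homology\<close>

theorem theorem6p8:
  fixes sA :: "'k::field \<Rightarrow> 'a::ring_1 \<Rightarrow> 'a"
    and sV :: "'k \<Rightarrow> 'v::ab_group_add \<Rightarrow> 'v"
    and D :: "'a \<Rightarrow> ('a word \<Rightarrow>\<^sub>0 'k) set"
    and act :: "'a \<Rightarrow> 'v \<Rightarrow> 'v"
    and \<kappa> :: "('v word \<Rightarrow>\<^sub>0 'k) set \<Rightarrow> 'a"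
    and \<mm> :: "'a set"
  defines "A \<equiv> type_alg sA"
    and "H \<equiv> H_alg sA sV D act \<kappa>"
  defines "N \<equiv> comm_span A \<mm> <+>\<^bsub>A\<^esub>
      k_span A {a * \<kappa> t * b | a t b. t \<in> wedge_square sV}"
    and "HHcomm \<equiv> comm_span H (carrier H)"
  defines "RHS \<equiv> (\<lambda>I. unit_alg (dsum_alg ((sym_alg sV)\<lparr>carrier := sym_plus sV\<rparr>)
      (quot_alg (A\<lparr>carrier := \<mm>\<rparr>) I)))"
  assumes "infinite (UNIV :: 'k set)"
    and "cocomm_algebra sA D"
    and "maximalideal \<mm> A" and "\<mm> \<noteq> {0}"
    and "\<exists>n. \<forall>xs. length xs = n \<and> set xs \<subseteq> \<mm> \<longrightarrow> prod_list xs = 0"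
    and "\<mm> <+>\<^bsub>A\<^esub> range (\<lambda>c. sA c 1) = UNIV" and "\<mm> \<inter> range (\<lambda>c. sA c 1) = {0}"
    and "D ` \<mm> \<subseteq> tensor_square sA \<mm>"
    and "alg_module sA sV act"
    and "k_lin_on (tens_alg sV) (wedge_square sV) A \<kappa>" and "\<kappa> ` wedge_square sV \<subseteq> \<mm>"
    and "PBW sA sV D act \<kappa>"
  shows "\<exists>\<Phi> \<in> k_lin_iso (HH0 H) (RHS N).
    (ideal HHcomm H \<longrightarrow> ideal N A \<and> abelian_k_algebra (HH0 H) \<and> \<Phi> \<in> k_alg_iso (HH0 H) (RHS N)) \<and>
    abelian_k_algebra (quot_alg H (Idl\<^bsub>H\<^esub> HHcomm)) \<and>
    (\<exists>\<Psi> \<in> k_alg_iso (quot_alg H (Idl\<^bsub>H\<^esub> HHcomm)) (RHS (Idl\<^bsub>A\<^esub> N)).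
       \<forall>x\<in>carrier H. \<forall>c s a. a \<in> \<mm> \<and> \<Phi> (HHcomm +>\<^bsub>H\<^esub> x) = (c, s, N +>\<^bsub>A\<^esub> a) \<longrightarrow>
         \<Psi> ((Idl\<^bsub>H\<^esub> HHcomm) +>\<^bsub>H\<^esub> x) = (c, s, (Idl\<^bsub>A\<^esub> N) +>\<^bsub>A\<^esub> a))"
proof -
  have "cocomm_algebra sA D" "\<mm> \<noteq> UNIV" "ideal \<mm> (type_alg sA)"
    using assms(7) maximalideal.I_notcarr[OF assms(8)] maximalideal.axioms(1)[OF assms(8)]
    by (auto simp: A_def)
  then interpret S: nil_setting sA sV D act \<kappa> \<mm>
    using assms(10-16) unfolding A_def cocomm_algebra_def by (intro nil_setting.intro) blast+
  show ?thesis
    using S.HH0_iso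
    unfolding A_def H_def N_def HHcomm_def RHS_def S.N_def S.K_def S.target_def .
qed

end
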